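(* Let $\Bbbk$ be a field and let $T$ be an unmixed balanced forest (every connected component is an unmixed balanced tree) with connected components $T_1,\dots,T_c$. Let $R=\Bbbk[V_{even}]$ and $R_i=\Bbbk[V_{even}(T_i)]$. For each $i$ let $Z_i\subseteq R_i$ be: $\{v\}$ if $T_i$ has height 0 with $V(T_i)=\{v\}$; $\{\ell_1-\ell_j: 2\le j\le n_0\}$ if $T_i$ has height 1 with leaves $\ell_1,\dots,\ell_{n_0}$; and $\{u_a-\ell_{a,b}: 1\le a\le n_1, 1\le b\le m_a\}$ if $T_i$ has height 3, where $V_1(T_i)=\{s_1,\dots,s_{n_1}\}$, $u_a$ is the unique height-2 vertex adjacent to $s_a$, and $\ell_{a,1},\dots,\ell_{a,m_a}$ are the leaves adjacent to $s_a$. Set $Z=\bigcup_{i=1}^cZ_i$. Then (1) $Z$ is a maximal $R/\mathcal{N}_{odd}(T)$-regular sequence in the ideal $(V_{even})R$; (2) $\mathrm{type}(R/\mathcal{N}_{odd}(T))$ equals the number of minimal $V_3$-TD-sets of $T$.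
   Context: $N(v)=\{u:uv\in E\}$, $N(D)=\bigcup_{v\in D}N(v)$, $X_U=\prod_{v\in U}v$. A leaf is a vertex of degree 1; height of a vertex = minimum distance to a leaf (isolated vertex: 0); $V_k$ = height-$k$ vertices; $V_{even}$, $V_{odd}$ = vertices of even/odd height; a tree is balanced if no two adjacent vertices have equal height. A TD-set is $D$ with $N(D)=V$, minimal if no proper subset is; a tree is unmixed if all minimal TD-sets have the same size. Unmixed balanced trees have height 0, 1 or 3, and in one of height 3 each height-1 vertex has exactly one height-2 neighbor. $\mathcal{N}_{odd}(T)$ is the ideal of $R$ generated by $X_{N(v)}$, $v\in V_{odd}$. A $V_3$-TD-set is $D$ with $N(D)\supseteq V_3$, minimal if no proper subset is one. $\mathrm{type}$ denotes Cohen–Macaulay type. *)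

theory Defs
  imports Main "HOL-Library.Poly_Mapping"
begin

definition simple_graph :: "'v set \<Rightarrow> ('v \<Rightarrow> 'v \<Rightarrow> bool) \<Rightarrow> bool" where
  "simple_graph V E \<longleftrightarrow> finite V \<and>
     (\<forall>u v. E u v \<longrightarrow> u \<in> V \<and> v \<in> V \<and> E v u \<and> u \<noteq> v)"

definition nbhd :: "('v \<Rightarrow> 'v \<Rightarrow> bool) \<Rightarrow> 'v \<Rightarrow> 'v set" where
  "nbhd E v = {u. E u v}"

definition nbhd_set :: "('v \<Rightarrow> 'v \<Rightarrow> bool) \<Rightarrow> 'v set \<Rightarrow> 'v set" where
  "nbhd_set E D = (\<Union>v\<in>D. nbhd E v)"

definition walk :: "('v \<Rightarrow> 'v \<Rightarrow> bool) \<Rightarrow> 'v list \<Rightarrow> bool" where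
  "walk E xs \<longleftrightarrow> xs \<noteq> [] \<and> (\<forall>i. Suc i < length xs \<longrightarrow> E (xs ! i) (xs ! Suc i))"

definition acyclic_graph :: "('v \<Rightarrow> 'v \<Rightarrow> bool) \<Rightarrow> bool" where
  "acyclic_graph E \<longleftrightarrow>
     \<not> (\<exists>xs. walk E xs \<and> distinct xs \<and> length xs \<ge> 3 \<and> E (last xs) (hd xs))"

definition restr :: "('v \<Rightarrow> 'v \<Rightarrow> bool) \<Rightarrow> 'v set \<Rightarrow> 'v \<Rightarrow> 'v \<Rightarrow> bool" where
  "restr E W u v \<longleftrightarrow> E u v \<and> u \<in> W \<and> v \<in> W"

definition components :: "'v set \<Rightarrow> ('v \<Rightarrow> 'v \<Rightarrow> bool) \<Rightarrow> 'v set set" where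
  "components V E = {{u. E\<^sup>*\<^sup>* v u} | v. v \<in> V}"

definition is_leaf :: "('v \<Rightarrow> 'v \<Rightarrow> bool) \<Rightarrow> 'v \<Rightarrow> bool" where
  "is_leaf E v \<longleftrightarrow> card (nbhd E v) = 1"

text \<open>Height: minimum distance to a leaf (0 if no leaf is reachable, e.g. an isolated
  vertex).\<close>
definition hgt :: "('v \<Rightarrow> 'v \<Rightarrow> bool) \<Rightarrow> 'v \<Rightarrow> nat" where
  "hgt E v = (if \<exists>xs. walk E xs \<and> hd xs = v \<and> is_leaf E (last xs)
              then (LEAST n. \<exists>xs. walk E xs \<and> hd xs = v \<and> is_leaf E (last xs)
                                   \<and> length xs = Suc n)
              else 0)"

definition Vk :: "'v set \<Rightarrow> ('v \<Rightarrow> 'v \<Rightarrow> bool) \<Rightarrow> nat \<Rightarrow> 'v set" where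
  "Vk V E k = {v \<in> V. hgt E v = k}"

definition Veven :: "'v set \<Rightarrow> ('v \<Rightarrow> 'v \<Rightarrow> bool) \<Rightarrow> 'v set" where
  "Veven V E = {v \<in> V. even (hgt E v)}"

definition Vodd :: "'v set \<Rightarrow> ('v \<Rightarrow> 'v \<Rightarrow> bool) \<Rightarrow> 'v set" where
  "Vodd V E = {v \<in> V. odd (hgt E v)}"

definition balanced :: "'v set \<Rightarrow> ('v \<Rightarrow> 'v \<Rightarrow> bool) \<Rightarrow> bool" where
  "balanced V E \<longleftrightarrow> (\<forall>u\<in>V. \<forall>v\<in>V. E u v \<longrightarrow> hgt E u \<noteq> hgt E v)"

definition TD_set :: "'v set \<Rightarrow> ('v \<Rightarrow> 'v \<Rightarrow> bool) \<Rightarrow> 'v set \<Rightarrow> bool" where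
  "TD_set V E D \<longleftrightarrow> D \<subseteq> V \<and> nbhd_set E D = V"

definition minimal_TD_set :: "'v set \<Rightarrow> ('v \<Rightarrow> 'v \<Rightarrow> bool) \<Rightarrow> 'v set \<Rightarrow> bool" where
  "minimal_TD_set V E D \<longleftrightarrow> TD_set V E D \<and> (\<forall>D'. D' \<subset> D \<longrightarrow> \<not> TD_set V E D')"

definition unmixed :: "'v set \<Rightarrow> ('v \<Rightarrow> 'v \<Rightarrow> bool) \<Rightarrow> bool" where
  "unmixed V E \<longleftrightarrow> (\<forall>D1 D2. minimal_TD_set V E D1 \<longrightarrow> minimal_TD_set V E D2
                       \<longrightarrow> card D1 = card D2)"

definition V3_TD_set :: "'v set \<Rightarrow> ('v \<Rightarrow> 'v \<Rightarrow> bool) \<Rightarrow> 'v set \<Rightarrow> bool" where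
  "V3_TD_set V E D \<longleftrightarrow> D \<subseteq> V \<and> Vk V E 3 \<subseteq> nbhd_set E D"

definition minimal_V3_TD_set :: "'v set \<Rightarrow> ('v \<Rightarrow> 'v \<Rightarrow> bool) \<Rightarrow> 'v set \<Rightarrow> bool" where
  "minimal_V3_TD_set V E D \<longleftrightarrow> V3_TD_set V E D \<and> (\<forall>D'. D' \<subset> D \<longrightarrow> \<not> V3_TD_set V E D')"

definition tree_height :: "'v set \<Rightarrow> ('v \<Rightarrow> 'v \<Rightarrow> bool) \<Rightarrow> nat" where
  "tree_height V E = Max (hgt E ` V)"

definition unmixed_balanced_forest :: "'v set \<Rightarrow> ('v \<Rightarrow> 'v \<Rightarrow> bool) \<Rightarrow> bool" where
  "unmixed_balanced_forest V E \<longleftrightarrow> simple_graph V E \<and> acyclic_graph E \<and>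
     (\<forall>W \<in> components V E. balanced W (restr E W) \<and> unmixed W (restr E W))"

type_synonym ('v, 'k) mpoly = "('v \<Rightarrow>\<^sub>0 nat) \<Rightarrow>\<^sub>0 'k"

definition Var :: "'v \<Rightarrow> ('v, 'k::comm_ring_1) mpoly" where
  "Var v = Poly_Mapping.single (Poly_Mapping.single v 1) 1"

definition Const :: "'k::comm_ring_1 \<Rightarrow> ('v, 'k) mpoly" where
  "Const c = Poly_Mapping.single 0 c"

definition poly_ring :: "'v set \<Rightarrow> ('v, 'k::comm_ring_1) mpoly set" where
  "poly_ring W = {p. \<forall>m \<in> Poly_Mapping.keys p. Poly_Mapping.keys m \<subseteq> W}"

definition ideal_gen :: "('v, 'k::comm_ring_1) mpoly set \<Rightarrow> ('v, 'k) mpoly set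
                         \<Rightarrow> ('v, 'k) mpoly set" where
  "ideal_gen R S = {p. \<exists>A f. finite A \<and> A \<subseteq> S \<and> (\<forall>a\<in>A. f a \<in> R) \<and> p = (\<Sum>a\<in>A. f a * a)}"

definition monomial_of_set :: "'v set \<Rightarrow> ('v, 'k::comm_ring_1) mpoly" where
  "monomial_of_set U = (\<Prod>u\<in>U. Var u)"

definition nzd_mod :: "('v, 'k::comm_ring_1) mpoly set \<Rightarrow> ('v, 'k) mpoly set
                        \<Rightarrow> ('v, 'k) mpoly \<Rightarrow> bool" where
  "nzd_mod R J x \<longleftrightarrow> (\<forall>f\<in>R. x * f \<in> J \<longrightarrow> f \<in> J)"

definition regular_seq :: "('v, 'k::comm_ring_1) mpoly set \<Rightarrow> ('v, 'k) mpoly set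
                            \<Rightarrow> ('v, 'k) mpoly list \<Rightarrow> bool" where
  "regular_seq R I zs \<longleftrightarrow> set zs \<subseteq> R \<and>
     (\<forall>j < length zs. nzd_mod R (ideal_gen R (I \<union> set (take j zs))) (zs ! j)) \<and>
     1 \<notin> ideal_gen R (I \<union> set zs)"

definition maximal_regular_seq_in :: "('v, 'k::comm_ring_1) mpoly set \<Rightarrow> ('v, 'k) mpoly set
        \<Rightarrow> ('v, 'k) mpoly set \<Rightarrow> ('v, 'k) mpoly list \<Rightarrow> bool" where
  "maximal_regular_seq_in R I m zs \<longleftrightarrow> regular_seq R I zs \<and> set zs \<subseteq> m \<and>
     \<not> (\<exists>x\<in>m. regular_seq R I (zs @ [x]))"

definition socle_dim :: "('v, 'k::field) mpoly set \<Rightarrow> ('v, 'k) mpoly set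
                         \<Rightarrow> ('v, 'k) mpoly set \<Rightarrow> nat" where
  "socle_dim R m J = (GREATEST n. \<exists>F. finite F \<and> card F = n \<and>
       F \<subseteq> {f \<in> R. \<forall>x\<in>m. x * f \<in> J} \<and>
       (\<forall>c. (\<Sum>f\<in>F. Const (c f) * f) \<in> J \<longrightarrow> (\<forall>f\<in>F. c f = 0)))"

definition cm_type :: "('v, 'k::field) mpoly set \<Rightarrow> ('v, 'k) mpoly set
                       \<Rightarrow> ('v, 'k) mpoly set \<Rightarrow> nat" where
  "cm_type R m I = socle_dim R m
      (ideal_gen R (I \<union> set (SOME zs. maximal_regular_seq_in R I m zs)))"

definition N_odd :: "'v set \<Rightarrow> ('v \<Rightarrow> 'v \<Rightarrow> bool) \<Rightarrow> ('v, 'k::comm_ring_1) mpoly set" where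
  "N_odd V E = ideal_gen (poly_ring (Veven V E))
                 {monomial_of_set (nbhd E v) | v. v \<in> Vodd V E}"

text \<open>The set Z_i attached to a component W (with the choice of the distinguished leaf
  l_1 in the height-1 case left arbitrary).\<close>
definition component_Z :: "'v set \<Rightarrow> ('v \<Rightarrow> 'v \<Rightarrow> bool) \<Rightarrow> ('v, 'k::comm_ring_1) mpoly set
                           \<Rightarrow> bool" where
  "component_Z W E Zi \<longleftrightarrow>
     (tree_height W E = 0 \<and> (\<exists>v. W = {v} \<and> Zi = {Var v})) \<or>
     (tree_height W E = 1 \<and> (\<exists>l1 \<in> W. is_leaf E l1 \<and>
         Zi = {Var l1 - Var l | l. l \<in> W \<and> is_leaf E l \<and> l \<noteq> l1})) \<or>
     (tree_height W E = 3 \<and>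
         Zi = {Var u - Var l | u l. \<exists>s \<in> W. hgt E s = 1 \<and> E s u \<and> hgt E u = 2
                                     \<and> E s l \<and> is_leaf E l})"

definition is_Z_set :: "'v set \<Rightarrow> ('v \<Rightarrow> 'v \<Rightarrow> bool) \<Rightarrow> ('v, 'k::comm_ring_1) mpoly set
                        \<Rightarrow> bool" where
  "is_Z_set V E Z \<longleftrightarrow> (\<exists>Zs. (\<forall>W \<in> components V E. component_Z W E (Zs W)) \<and>
                          Z = (\<Union>W \<in> components V E. Zs W))"

end

theory Submission
  imports Defs
begin

text \<open>Socle dimensions do not depend on the maximal regular sequence: for a regular sequence of
  length \<open>n\<close> on \<open>R/I\<close>, the socle of the quotient is the \<open>n\<close>-th cohomology of \<open>R/I\<close> with
  respect to the maximal ideal \<open>m\<close>, and all maximal regular sequences have the same length because,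
  \<open>R\<close> being Noetherian, an ideal consisting of zero-divisors annihilates a nonzero element. This also
  covers sequences of inhomogeneous polynomials, so the type can be computed from \<open>Z\<close>.

  Unmixedness forces every vertex of height 2 to have exactly one neighbour of height 1 and vice
  versa: in a tree rooted at a vertex of height 1, explicit irredundant covers of the vertices of
  height 3 extend to minimal TD-sets whose sizes are compared. Hence the neighbourhoods of the
  height-1 vertices partition the non-isolated even vertices into blocks, and \<open>Z\<close> identifies the
  variables in each block with one representative. Dividing by part of \<open>Z\<close> leaves a monomial ideal
  on which the remaining forms are nonzerodivisors; dividing by all of \<open>Z\<close> leaves powers of
  the representatives and the products \<open>X_N(w)\<close> for \<open>w\<close> of height 3, whose socle monomials correspond
  to the minimal sets meeting all \<open>N(w)\<close>.\<close>

text \<open>\<open>cm_type\<close> fixes its sequence by \<open>SOME\<close>, so nothing is known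
  about that sequence beyond its maximality in the ideal of variables; a computation with
  \<open>Z\<close> alone would not reach it. The invariant is carried as the statement that n
  independent classes exist, which passes from one quotient to the next; a number appears only at
  the end. Unmixedness acts through one count: for irredundant covers \<open>A\<close> of height 3,
  the size of \<open>A\<close> plus the number of height-1 vertices without a neighbour in
  \<open>A\<close> is constant. Two height-1 neighbours of one height-2 vertex, or two height-2
  neighbours of one height-1 vertex, would produce covers with different counts. As \<open>Z\<close>
  may be listed in any order, regularity is shown for the elimination of an arbitrary set of
  non-representatives. A height-1 vertex is not a leaf, so each block has at least two elements;
  hence the largest exponent outside the ideal, block size minus one, is positive, and the zero
  exponents of a socle monomial really mark a set of vertices.\<close>

definition subring :: "'a::comm_ring_1 set \<Rightarrow> bool" where
  "subring R \<longleftrightarrow> 0 \<in> R \<and> 1 \<in> R \<and>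
     (\<forall>a\<in>R. \<forall>b\<in>R. a + b \<in> R \<and> a * b \<in> R) \<and> (\<forall>a\<in>R. - a \<in> R)"

lemma subringD:
  assumes "subring R"
  shows "0 \<in> R" "1 \<in> R" "a \<in> R \<Longrightarrow> b \<in> R \<Longrightarrow> a + b \<in> R" "a \<in> R \<Longrightarrow> b \<in> R \<Longrightarrow> a * b \<in> R"
    "a \<in> R \<Longrightarrow> - a \<in> R" "a \<in> R \<Longrightarrow> b \<in> R \<Longrightarrow> a - b \<in> R"
  using assms unfolding subring_def
  by (auto simp del: add_uminus_conv_diff simp: diff_conv_add_uminus)

lemma subring_sum:
  assumes "subring R" "\<And>i. i \<in> A \<Longrightarrow> f i \<in> R"
  shows "sum f A \<in> R"
  using assms(2) by (induction A rule: infinite_finite_induct) (auto intro: subringD[OF assms(1)])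

lemma subring_prod:
  assumes "subring R" "\<And>i. i \<in> A \<Longrightarrow> f i \<in> R"
  shows "prod f A \<in> R"
  using assms(2) by (induction A rule: infinite_finite_induct) (auto intro: subringD[OF assms(1)])

section \<open>Ideals of a subring and their generators\<close>

definition idealof :: "'a::comm_ring_1 set \<Rightarrow> 'a set \<Rightarrow> bool" where
  "idealof R J \<longleftrightarrow> J \<subseteq> R \<and> 0 \<in> J \<and> (\<forall>a\<in>J. \<forall>b\<in>J. a + b \<in> J) \<and> (\<forall>r\<in>R. \<forall>a\<in>J. r * a \<in> J)"

lemma idealofD:
  assumes "subring R" "idealof R J"
  shows "a \<in> J \<Longrightarrow> a \<in> R" "0 \<in> J" "a \<in> J \<Longrightarrow> b \<in> J \<Longrightarrow> a + b \<in> J"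
    "r \<in> R \<Longrightarrow> a \<in> J \<Longrightarrow> r * a \<in> J" "r \<in> R \<Longrightarrow> a \<in> J \<Longrightarrow> a * r \<in> J"
    "a \<in> J \<Longrightarrow> - a \<in> J" "a \<in> J \<Longrightarrow> b \<in> J \<Longrightarrow> a - b \<in> J"
proof -
  show 1: "a \<in> J \<Longrightarrow> a \<in> R" "0 \<in> J" and 2: "a \<in> J \<Longrightarrow> b \<in> J \<Longrightarrow> a + b \<in> J"
    and 3: "r \<in> R \<Longrightarrow> a \<in> J \<Longrightarrow> r * a \<in> J" for a b r
    using assms(2) unfolding idealof_def by auto
  show "r \<in> R \<Longrightarrow> a \<in> J \<Longrightarrow> a * r \<in> J" using 3[of r a] by (simp add: mult.commute)
  show 4: "a \<in> J \<Longrightarrow> - a \<in> J" for a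
    using 3[of "- 1" a] subringD(2,5)[OF assms(1)] by simp
  show "a \<in> J \<Longrightarrow> b \<in> J \<Longrightarrow> a - b \<in> J"
    using 2[of a "- b"] 4[of b] by simp
qed

lemma idealof_sum:
  assumes "idealof R J" "\<And>i. i \<in> A \<Longrightarrow> f i \<in> J"
  shows "sum f A \<in> J"
  using assms(2)
  by (induction A rule: infinite_finite_induct) (use assms(1) in \<open>auto simp: idealof_def\<close>)

lemma idealof_ideal_gen:
  assumes "subring R" "S \<subseteq> R"
  shows "idealof R (ideal_gen R S)"
proof -
  note R = subringD[OF assms(1)]
  have sub: "ideal_gen R S \<subseteq> R"
    using assms unfolding ideal_gen_def by (auto intro!: subring_sum R)
  have zero: "0 \<in> ideal_gen R S"
    unfolding ideal_gen_def by (auto intro: exI[of _ "{}"])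
  have add: "a + b \<in> ideal_gen R S" if a: "a \<in> ideal_gen R S" and b: "b \<in> ideal_gen R S" for a b
  proof -
    obtain A f where A: "finite A" "A \<subseteq> S" "\<forall>a\<in>A. f a \<in> R" "a = (\<Sum>a\<in>A. f a * a)"
      using a unfolding ideal_gen_def by auto
    obtain B g where B: "finite B" "B \<subseteq> S" "\<forall>a\<in>B. g a \<in> R" "b = (\<Sum>a\<in>B. g a * a)"
      using b unfolding ideal_gen_def by auto
    \<comment> \<open>Extending both coefficient functions by 0 lets the two sums run over the
      common index set.\<close>
    define f' where "f' x = (if x \<in> A then f x else 0)" for x
    define g' where "g' x = (if x \<in> B then g x else 0)" for x
    have "a = (\<Sum>x\<in>A \<union> B. f' x * x)"
      unfolding A(4) f'_def using A(1) B(1) by (intro sum.mono_neutral_cong_left) auto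
    moreover have "b = (\<Sum>x\<in>A \<union> B. g' x * x)"
      unfolding B(4) g'_def using A(1) B(1) by (intro sum.mono_neutral_cong_left) auto
    ultimately have "a + b = (\<Sum>x\<in>A \<union> B. (f' x + g' x) * x)"
      by (simp add: sum.distrib distrib_right)
    moreover have "\<forall>x\<in>A \<union> B. f' x + g' x \<in> R"
      using A B R by (auto simp: f'_def g'_def)
    ultimately show ?thesis
      unfolding ideal_gen_def using A(1,2) B(1,2)
      by (intro CollectI exI[of _ "A \<union> B"] exI[of _ "\<lambda>x. f' x + g' x"]) auto
  qed
  have mult: "r * a \<in> ideal_gen R S" if a: "a \<in> ideal_gen R S" and r: "r \<in> R" for a r
  proof -
    obtain A f where A: "finite A" "A \<subseteq> S" "\<forall>a\<in>A. f a \<in> R" "a = (\<Sum>a\<in>A. f a * a)"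
      using a unfolding ideal_gen_def by auto
    have "r * a = (\<Sum>x\<in>A. (r * f x) * x)" unfolding A(4) by (simp add: sum_distrib_left mult.assoc)
    then show ?thesis unfolding ideal_gen_def using A(1-3) R r
      by (intro CollectI exI[of _ A] exI[of _ "\<lambda>x. r * f x"]) auto
  qed
  show ?thesis unfolding idealof_def using sub zero add mult by blast
qed

lemma ideal_gen_superset:
  assumes "subring R" shows "S \<subseteq> ideal_gen R S"
proof
  fix s assume "s \<in> S"
  then show "s \<in> ideal_gen R S" unfolding ideal_gen_def using subringD(2)[OF assms]
    by (intro CollectI exI[of _ "{s}"] exI[of _ "\<lambda>_. 1"]) auto
qed

lemma ideal_gen_least:
  assumes "idealof R J" "S \<subseteq> J"
  shows "ideal_gen R S \<subseteq> J"
  unfolding ideal_gen_def using assms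
  by (auto intro!: idealof_sum[OF assms(1)]) (auto simp: idealof_def)

lemma ideal_gen_mono:
  assumes "subring R" "S \<subseteq> T" "T \<subseteq> R"
  shows "ideal_gen R S \<subseteq> ideal_gen R T"
  using assms idealof_ideal_gen ideal_gen_least ideal_gen_superset by (metis dual_order.trans)

lemma ideal_gen_gen:
  assumes "subring R" "S \<subseteq> R" "T \<subseteq> R"
  shows "ideal_gen R (ideal_gen R S \<union> T) = ideal_gen R (S \<union> T)" (is "?L = ?RR")
proof
  have i: "idealof R (ideal_gen R S)" "idealof R ?RR" using assms by (auto intro: idealof_ideal_gen)
  have sub: "ideal_gen R S \<union> T \<subseteq> R" using i assms by (auto simp: idealof_def)
  show "?L \<subseteq> ?RR"
    using ideal_gen_mono[OF assms(1), of S "S \<union> T"] ideal_gen_superset[OF assms(1), of "S \<union> T"] assms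
    by (intro ideal_gen_least[OF i(2)]) auto
  show "?RR \<subseteq> ?L"
    using ideal_gen_superset[OF assms(1), of S]
      ideal_gen_superset[OF assms(1), of "ideal_gen R S \<union> T"]
    by (intro ideal_gen_least[OF idealof_ideal_gen[OF assms(1) sub]]) auto
qed

lemma ideal_gen_ideal:
  assumes "subring R" "idealof R J"
  shows "ideal_gen R J = J"
  using ideal_gen_least[OF assms(2), of J] ideal_gen_superset[OF assms(1), of J] by auto

text \<open>One coefficient on \<open>x\<close> is enough because \<open>J\<close> is already an
  ideal. This is the form of \<open>K\<close> that \<open>shift\<close> works with.\<close>

lemma ideal_gen_insert:
  assumes R: "subring R" and J: "idealof R J" and x: "x \<in> R"
  shows "ideal_gen R (J \<union> {x}) = {a + x * r | a r. a \<in> J \<and> r \<in> R}" (is "_ = ?K")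
proof
  note I = idealofD[OF R J] and S = subringD[OF R]
  have "idealof R ?K"
    unfolding idealof_def
  proof (intro conjI ballI)
    show "?K \<subseteq> R" using I(1) S x by auto
    show "0 \<in> ?K" by (rule CollectI, rule exI[of _ 0], rule exI[of _ 0]) (use I(2) S(1) in simp)
    show "p + q \<in> ?K" if pq: "p \<in> ?K" "q \<in> ?K" for p q
    proof -
      obtain a r b s where "p = a + x * r" "q = b + x * s" "a \<in> J" "b \<in> J" "r \<in> R" "s \<in> R"
        using pq by blast
      then show ?thesis
        by (intro CollectI exI[of _ "a + b"] exI[of _ "r + s"]) (auto intro: I S simp: algebra_simps)
    qed
    show "s * p \<in> ?K" if ps: "p \<in> ?K" "s \<in> R" for p s
    proof -
      obtain a r where "p = a + x * r" "a \<in> J" "r \<in> R"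
        using ps by blast
      then show ?thesis using ps
        by (intro CollectI exI[of _ "s * a"] exI[of _ "s * r"]) (auto intro: I S simp: algebra_simps)
    qed
  qed
  moreover have "J \<subseteq> ?K"
  proof
    fix a assume "a \<in> J" then show "a \<in> ?K"
      by (intro CollectI exI[of _ a] exI[of _ 0]) (auto intro: S)
  qed
  moreover have "x \<in> ?K"
    by (intro CollectI exI[of _ 0] exI[of _ 1]) (auto intro: S I)
  ultimately show "ideal_gen R (J \<union> {x}) \<subseteq> ?K" by (intro ideal_gen_least) auto
  have "J \<union> {x} \<subseteq> R" using I(1) x by auto
  note G = idealofD[OF R idealof_ideal_gen[OF R this]] and g = ideal_gen_superset[OF R, of "J \<union> {x}"]
  show "?K \<subseteq> ideal_gen R (J \<union> {x})"
  proof
    fix p assume "p \<in> ?K"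
    then obtain a r where "p = a + x * r" "a \<in> J" "r \<in> R" by auto
    moreover from this have "a \<in> ideal_gen R (J \<union> {x})" "x * r \<in> ideal_gen R (J \<union> {x})"
      using g G(5)[of r x] by blast+
    ultimately show "p \<in> ideal_gen R (J \<union> {x})" using G(3) by blast
  qed
qed

section \<open>A Koszul-type complex on lists\<close>

text \<open>Cochains of degree \<open>i\<close> are arbitrary functions on lists of length \<open>i\<close> over an ideal \<open>m\<close>; the
  alternating condition of the Koszul complex is not needed, since contraction with \<open>u \<in> m\<close> is
  already a null-homotopy of multiplication by \<open>u\<close>: this is the recursion equation of \<open>kd\<close>.\<close>

primrec kd :: "'a::comm_ring_1 list \<Rightarrow> ('a list \<Rightarrow> 'a) \<Rightarrow> 'a" where
  "kd [] f = 0"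
| "kd (u # us) f = u * f us - kd us (\<lambda>ws. f (u # ws))"

lemma kd_add: "kd us (\<lambda>w. f w + g w) = kd us f + kd us g"
  by (induction us arbitrary: f g) (auto simp: algebra_simps)

lemma kd_diff: "kd us (\<lambda>w. f w - g w) = kd us f - kd us g"
  by (induction us arbitrary: f g) (auto simp: algebra_simps)

lemma kd_mult: "kd us (\<lambda>w. r * f w) = r * kd us f"
  by (induction us arbitrary: f) (auto simp: algebra_simps)

lemma kd_zero: "kd us (\<lambda>w. 0) = 0"
  by (induction us) auto

lemma kd_sum: "kd us (\<lambda>w. \<Sum>k\<in>A. f k w) = (\<Sum>k\<in>A. kd us (f k))"
  by (induction A rule: infinite_finite_induct) (auto simp: kd_add kd_zero)

text \<open>The square of the differential is zero: unfolding at the head \<open>u\<close>, the two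
  copies of \<open>u * kd us f\<close> cancel, and what remains is the induction hypothesis for the
  contraction of \<open>f\<close> with \<open>u\<close>.\<close>

lemma kd_kd: "kd us (\<lambda>ws. kd ws f) = 0"
  by (induction us arbitrary: f) (auto simp: kd_diff kd_mult)

locale koszul =
  fixes R :: "'a::comm_ring_1 set" and m :: "'a set" and C :: "'k::field \<Rightarrow> 'a"
  assumes R: "subring R" and m: "idealof R m"
    and C_in: "C c \<in> R" and C_mult: "C (c * d) = C c * C d" and C_1: "C 1 = 1"
begin

text \<open>Cochains are total functions, so their degree is recorded by restricting attention to
  lists of length \<open>i\<close>. Congruence modulo \<open>J\<close> in degree \<open>i\<close>
  means that the difference lies here.\<close>

definition vals :: "nat \<Rightarrow> 'a set \<Rightarrow> ('a list \<Rightarrow> 'a) set" where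
  "vals i X = {f. \<forall>us. set us \<subseteq> m \<longrightarrow> length us = i \<longrightarrow> f us \<in> X}"

definition cochains :: "('a list \<Rightarrow> 'a) set" where
  "cochains = {f. \<forall>us. set us \<subseteq> m \<longrightarrow> f us \<in> R}"

text \<open>Cocycles, and below coboundaries, with coefficients in R/J. No quotient is formed:
  representatives in \<open>R\<close> are compared through \<open>vals\<close>.\<close>

definition cyc :: "nat \<Rightarrow> 'a set \<Rightarrow> ('a list \<Rightarrow> 'a) set" where
  "cyc i J = {f \<in> cochains. (\<lambda>us. kd us f) \<in> vals (Suc i) J}"

definition bnd :: "nat \<Rightarrow> 'a set \<Rightarrow> ('a list \<Rightarrow> 'a) set" where
  "bnd i J = {f. \<exists>g\<in>cochains. (\<lambda>us. f us - kd us g) \<in> vals i J}"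

text \<open>The existence of such a family says that the \<open>i\<close>-th cohomology of R/J has
  dimension at least \<open>n\<close> over the field, a form that also makes sense in infinite
  dimension.\<close>

definition indep :: "nat \<Rightarrow> nat \<Rightarrow> 'a set \<Rightarrow> (nat \<Rightarrow> 'a list \<Rightarrow> 'a) \<Rightarrow> bool" where
  "indep n i J f \<longleftrightarrow> (\<forall>k<n. f k \<in> cyc i J) \<and>
     (\<forall>c. (\<lambda>us. \<Sum>k<n. C (c k) * f k us) \<in> bnd i J \<longrightarrow> (\<forall>k<n. c k = 0))"

lemma m_sub: "u \<in> m \<Longrightarrow> u \<in> R" using m by (auto simp: idealof_def)

lemma kd_vals:
  assumes J: "idealof R J" and "f \<in> vals i J"
  shows "(\<lambda>us. kd us f) \<in> vals (Suc i) J"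
proof -
  note I = idealofD[OF R J]
  have "kd us f \<in> J" if "set us \<subseteq> m" "length us = Suc i" "f \<in> vals i J" for us
    using that
  proof (induction i arbitrary: us f)
    case 0
    then obtain u where "us = [u]" "u \<in> m" by (auto simp: length_Suc_conv)
    then show ?case using 0 m_sub by (auto simp: vals_def intro: I)
  next
    case (Suc i)
    then obtain u vs where us: "us = u # vs" "u \<in> m" "set vs \<subseteq> m" "length vs = Suc i"
      by (auto simp: length_Suc_conv)
    have "(\<lambda>ws. f (u # ws)) \<in> vals i J"
      using Suc.prems us by (auto simp: vals_def)
    then have "kd vs (\<lambda>ws. f (u # ws)) \<in> J" using Suc.IH us by blast
    moreover have "f vs \<in> J" using Suc.prems us by (auto simp: vals_def)
    ultimately show ?case using us m_sub by (auto intro!: I(4,7))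
  qed
  then show ?thesis using assms(2) by (auto simp: vals_def)
qed

lemma R_ideal: "idealof R R"
  using subringD[OF R] by (auto simp: idealof_def)

lemma kd_cochain: "f \<in> cochains \<Longrightarrow> (\<lambda>us. kd us f) \<in> cochains"
proof -
  assume f: "f \<in> cochains"
  have "kd us f \<in> R" if "set us \<subseteq> m" for us
  proof (cases us)
    case Nil then show ?thesis using subringD(1)[OF R] by simp
  next
    case (Cons a list)
    have "f \<in> vals (length list) R" using f by (auto simp: vals_def cochains_def)
    from kd_vals[OF R_ideal this] show ?thesis using that unfolding vals_def Cons
      by (auto simp del: kd.simps)
  qed
  then show ?thesis by (auto simp: cochains_def)
qed

lemma cochains_lin:
  assumes "\<And>k. k < n \<Longrightarrow> f k \<in> cochains"
  shows "(\<lambda>us. \<Sum>k<n. C (c k) * f k us) \<in> cochains"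
  using assms by (auto simp: cochains_def intro!: subring_sum[OF R] subringD(4)[OF R] C_in)

lemma cochains_intros:
  "f \<in> cochains \<Longrightarrow> g \<in> cochains \<Longrightarrow> (\<lambda>us. f us - g us) \<in> cochains"
  "f \<in> cochains \<Longrightarrow> g \<in> cochains \<Longrightarrow> (\<lambda>us. f us + g us) \<in> cochains"
  "r \<in> R \<Longrightarrow> f \<in> cochains \<Longrightarrow> (\<lambda>us. r * f us) \<in> cochains"
  using subringD[OF R] by (auto simp: cochains_def)

lemma vals_lin:
  assumes J: "idealof R J"
  shows "f \<in> vals i J \<Longrightarrow> g \<in> vals i J \<Longrightarrow> (\<lambda>us. f us - g us) \<in> vals i J"
  "f \<in> vals i J \<Longrightarrow> g \<in> vals i J \<Longrightarrow> (\<lambda>us. f us + g us) \<in> vals i J"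
  "r \<in> R \<Longrightarrow> f \<in> vals i J \<Longrightarrow> (\<lambda>us. r * f us) \<in> vals i J"
  "(\<And>k. k < n \<Longrightarrow> F k \<in> vals i J) \<Longrightarrow> (\<lambda>us. \<Sum>k<n. C (c k) * F k us) \<in> vals i J"
  using idealofD[OF R J] C_in by (auto simp: vals_def intro!: idealof_sum[OF J])

text \<open>Expresses nonvanishing of cohomology as the case \<open>n = 1\<close> of
  \<open>indep\<close>, so that \<open>shift\<close> transports vanishing as well. A nonzero
  multiple of a non-coboundary stays one because constants are invertible.\<close>

lemma vanish_iff:
  assumes J: "idealof R J"
  shows "(\<exists>f. indep 1 i J f) \<longleftrightarrow> \<not> cyc i J \<subseteq> bnd i J"
proof
  assume "\<exists>f. indep 1 i J f"
  then obtain f where f: "indep 1 i J f" by blast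
  have "C 1 = 1" by (rule C_1)
  have "(\<lambda>us. C ((\<lambda>_. 1) (0::nat)) * f 0 us) \<notin> bnd i J"
    using f unfolding indep_def by (auto dest!: spec[of _ "\<lambda>_. 1"])
  then have "f 0 \<notin> bnd i J" using C_1 by simp
  then show "\<not> cyc i J \<subseteq> bnd i J" using f by (auto simp: indep_def)
next
  assume "\<not> cyc i J \<subseteq> bnd i J"
  then obtain f where f: "f \<in> cyc i J" "f \<notin> bnd i J" by auto
  have "indep 1 i J (\<lambda>_. f)"
    unfolding indep_def
  proof (intro conjI allI impI)
    fix c :: "nat \<Rightarrow> 'k" and k :: nat
    assume b: "(\<lambda>us. \<Sum>k<1. C (c k) * f us) \<in> bnd i J" and k: "k < 1"
    show "c k = 0"
    proof (rule ccontr)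
      assume "c k \<noteq> 0"
      then have inv: "C (inverse (c 0)) * C (c 0) = 1"
        using k C_1 by (simp flip: C_mult)
      obtain g where g: "g \<in> cochains" "(\<lambda>us. C (c 0) * f us - kd us g) \<in> vals i J"
        using b by (auto simp: bnd_def)
      have "(\<lambda>us. C (inverse (c 0)) * (C (c 0) * f us - kd us g)) \<in> vals i J"
        using g by (intro vals_lin(3)[OF J] C_in)
      moreover have "C (inverse (c 0)) * (C (c 0) * f us - kd us g)
          = f us - kd us (\<lambda>us. C (inverse (c 0)) * g us)" for us
        by (simp add: right_diff_distrib kd_mult inv flip: mult.assoc)
      ultimately have "f \<in> bnd i J"
        unfolding bnd_def using g C_in
        by (auto intro!: bexI[of _ "\<lambda>us. C (inverse (c 0)) * g us"] cochains_intros)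
      then show False using f by simp
    qed
  qed (use f in auto)
  then show "\<exists>f. indep 1 i J f" by blast
qed

text \<open>The connecting isomorphism \<open>H\<^sup>i(R/(J + x)) \<cong> H\<^sup>i\<^sup>+\<^sup>1(R/J)\<close>, valid once \<open>H\<^sup>i(R/J) = 0\<close>.\<close>

lemma shift:
  assumes J: "idealof R J" and x: "x \<in> m" and nzd: "\<And>f. f \<in> R \<Longrightarrow> x * f \<in> J \<Longrightarrow> f \<in> J"
    and van: "cyc i J \<subseteq> bnd i J" and K: "K = {a + x * r | a r. a \<in> J \<and> r \<in> R}" "idealof R K"
  shows "(\<exists>f. indep n i K f) \<longleftrightarrow> (\<exists>f. indep n (Suc i) J f)"
proof
  note I = idealofD[OF R J] and S = subringD[OF R]
  have xR: "x \<in> R" using x m_sub by simp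
  have JK: "a \<in> J \<Longrightarrow> a \<in> K" for a unfolding K using S(1) by force
  have xK: "r \<in> R \<Longrightarrow> x * r \<in> K" for r unfolding K using I(2) by force
  have nzdv: "f \<in> vals j J" if "f \<in> cochains" "(\<lambda>us. x * f us) \<in> vals j J" for f j
    using that nzd by (auto simp: vals_def cochains_def)
  {
    assume "\<exists>f. indep n i K f"
    then obtain f where f: "indep n i K f" by blast
    have fc: "f k \<in> cochains" if "k < n" for k using f that by (auto simp: indep_def cyc_def)
    \<comment> \<open>The connecting map: modulo \<open>J\<close>, the differential of a cocycle
      over \<open>K\<close> is divisible by \<open>x\<close>, and the quotient is the new cochain.
      Outside the relevant lists 0 serves as default.\<close>
    have "\<exists>r. r \<in> R \<and> (set us \<subseteq> m \<longrightarrow> length us = Suc i \<longrightarrow> kd us (f k) - x * r \<in> J)" if "k < n" for us k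
    proof (cases "set us \<subseteq> m \<and> length us = Suc i")
      case True
      then have "kd us (f k) \<in> K" using f that by (auto simp: indep_def cyc_def vals_def)
      then show ?thesis unfolding K by auto
    next
      case False then show ?thesis using S(1) by auto
    qed
    then obtain g where g: "\<And>k us. k < n \<Longrightarrow> g k us \<in> R"
      "\<And>k us. k < n \<Longrightarrow> set us \<subseteq> m \<Longrightarrow> length us = Suc i \<Longrightarrow> kd us (f k) - x * g k us \<in> J"
      by metis
    have gc: "g k \<in> cochains" if "k < n" for k using g that by (auto simp: cochains_def)
    have gv: "(\<lambda>us. kd us (f k) - x * g k us) \<in> vals (Suc i) J" if "k < n" for k
      using g that by (auto simp: vals_def)
    have "indep n (Suc i) J g"
      unfolding indep_def
    proof (intro conjI allI impI)
      fix k assume k: "k < n"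
      \<comment> \<open>Differentiating \<open>kd us (f k) - x * g k us\<close> kills the first
        term, and \<open>x\<close> cancels modulo \<open>J\<close>.\<close>
      have "(\<lambda>us. x * kd us (g k)) \<in> vals (Suc (Suc i)) J"
        using vals_lin(3)[OF J, of "- 1", OF _ kd_vals[OF J gv[OF k]]] S(2,5)
        by (simp add: kd_diff kd_mult kd_kd)
      then have "(\<lambda>us. kd us (g k)) \<in> vals (Suc (Suc i)) J"
        using nzdv kd_cochain gc k by blast
      then show "g k \<in> cyc (Suc i) J" using gc k by (auto simp: cyc_def)
    next
      fix c :: "nat \<Rightarrow> 'k" and k
      assume b: "(\<lambda>us. \<Sum>k<n. C (c k) * g k us) \<in> bnd (Suc i) J" and k: "k < n"
      let ?F = "\<lambda>us. \<Sum>k<n. C (c k) * f k us" and ?G = "\<lambda>us. \<Sum>k<n. C (c k) * g k us"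
      obtain h where h: "h \<in> cochains" "(\<lambda>us. ?G us - kd us h) \<in> vals (Suc i) J"
        using b by (auto simp: bnd_def)
      have 1: "(\<lambda>us. kd us ?F - x * ?G us) \<in> vals (Suc i) J"
        using vals_lin(4)[OF J gv, where c = c]
        by (simp add: kd_sum kd_mult sum_distrib_left sum_subtractf algebra_simps)
      have "(\<lambda>us. (kd us ?F - x * ?G us) + x * (?G us - kd us h)) \<in> vals (Suc i) J"
        by (intro vals_lin(2)[OF J] 1 vals_lin(3)[OF J] xR h)
      then have "(\<lambda>us. kd us (\<lambda>us. ?F us - x * h us)) \<in> vals (Suc i) J"
        by (simp add: kd_diff kd_mult algebra_simps)
      then have "(\<lambda>us. ?F us - x * h us) \<in> cyc i J"
        using fc h xR by (auto simp: cyc_def intro!: cochains_intros cochains_lin)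
      \<comment> \<open>The vanishing of degree-\<open>i\<close> cohomology modulo \<open>J\<close>
        makes this cocycle a coboundary; modulo \<open>K\<close> the term with \<open>x\<close>
        disappears.\<close>
      then obtain h' where h': "h' \<in> cochains" "(\<lambda>us. ?F us - x * h us - kd us h') \<in> vals i J"
        using van by (auto simp: bnd_def)
      have "?F us - kd us h' \<in> K" if "set us \<subseteq> m" "length us = i" for us
      proof -
        have "?F us - kd us h' = (?F us - x * h us - kd us h') + x * h us" by simp
        moreover have "?F us - x * h us - kd us h' \<in> J" "h us \<in> R"
          using that h h' by (auto simp: vals_def cochains_def)
        ultimately show ?thesis unfolding K by blast
      qed
      then have "?F \<in> bnd i K" using h' unfolding bnd_def vals_def by blast
      then show "c k = 0" using f k by (auto simp: indep_def)
    qed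
    then show "\<exists>f. indep n (Suc i) J f" by blast
  next
    assume "\<exists>f. indep n (Suc i) J f"
    then obtain g where g: "indep n (Suc i) J g" by blast
    have gc: "g k \<in> cochains" if "k < n" for k using g that by (auto simp: indep_def cyc_def)
    \<comment> \<open>The inverse of the connecting map is contraction with \<open>x\<close>: by the
      recursion for \<open>kd\<close>, a cocycle \<open>g k\<close> satisfies that
      \<open>x * g k\<close> is congruent to the differential of this \<open>f k\<close>.\<close>
    define f where "f k us = g k (x # us)" for k us
    have fc: "f k \<in> cochains" if "k < n" for k using gc[OF that] x by (auto simp: cochains_def f_def)
    have df: "x * g k us - kd us (f k) = kd (x # us) (g k)" for k us
      by (simp add: f_def[abs_def])
    have gv: "(\<lambda>us. x * g k us - kd us (f k)) \<in> vals (Suc i) J" if "k < n" for k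
    proof -
      have "(\<lambda>us. kd us (g k)) \<in> vals (Suc (Suc i)) J"
        using g that by (auto simp: indep_def cyc_def)
      then show ?thesis unfolding df using x by (auto simp: vals_def simp del: kd.simps)
    qed
    have "indep n i K f"
      unfolding indep_def
    proof (intro conjI allI impI)
      fix k assume k: "k < n"
      have "kd us (f k) \<in> K" if "set us \<subseteq> m" "length us = Suc i" for us
      proof -
        have "kd us (f k) = - (x * g k us - kd us (f k)) + x * g k us" by simp
        moreover have "- (x * g k us - kd us (f k)) \<in> J" "g k us \<in> R"
          using gv[OF k] gc[OF k] that I(6) unfolding vals_def cochains_def by blast+
        ultimately show ?thesis unfolding K by blast
      qed
      then show "f k \<in> cyc i K" using fc[OF k] by (auto simp: cyc_def vals_def)
    next
      fix c :: "nat \<Rightarrow> 'k" and k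
      assume b: "(\<lambda>us. \<Sum>k<n. C (c k) * f k us) \<in> bnd i K" and k: "k < n"
      let ?F = "\<lambda>us. \<Sum>k<n. C (c k) * f k us" and ?G = "\<lambda>us. \<Sum>k<n. C (c k) * g k us"
      obtain h where h: "h \<in> cochains" "(\<lambda>us. ?F us - kd us h) \<in> vals i K"
        using b by (auto simp: bnd_def)
      have "\<exists>r. r \<in> R \<and> (set us \<subseteq> m \<longrightarrow> length us = i \<longrightarrow> ?F us - kd us h - x * r \<in> J)" for us
      proof (cases "set us \<subseteq> m \<and> length us = i")
        case True
        then have "?F us - kd us h \<in> K" using h by (auto simp: vals_def)
        then obtain a r where "?F us - kd us h = a + x * r" "a \<in> J" "r \<in> R" unfolding K by blast
        then show ?thesis by (intro exI[of _ r]) auto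
      next
        case False then show ?thesis using S(1) by auto
      qed
      then obtain t where t: "\<And>us. t us \<in> R"
        "\<And>us. set us \<subseteq> m \<Longrightarrow> length us = i \<Longrightarrow> ?F us - kd us h - x * t us \<in> J"
        by metis
      have tc: "t \<in> cochains" using t by (auto simp: cochains_def)
      have "(\<lambda>us. ?F us - kd us h - x * t us) \<in> vals i J" using t by (auto simp: vals_def)
      \<comment> \<open>Write ?F as \<open>kd h + x * t\<close> modulo \<open>J\<close> and
        differentiate. Together with the congruence of \<open>kd ?F\<close> and
        \<open>x * ?G\<close>, this lets \<open>x\<close> be cancelled, leaving ?G as the coboundary
        of \<open>t\<close>.\<close>
      from kd_vals[OF J this] have 1: "(\<lambda>us. kd us ?F - x * kd us t) \<in> vals (Suc i) J"
        by (simp add: kd_diff kd_mult kd_kd)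
      have 2: "(\<lambda>us. x * ?G us - kd us ?F) \<in> vals (Suc i) J"
        using vals_lin(4)[OF J gv, where c = c]
        by (simp add: kd_sum kd_mult sum_distrib_left sum_subtractf algebra_simps)
      have "(\<lambda>us. (x * ?G us - kd us ?F) + (kd us ?F - x * kd us t)) \<in> vals (Suc i) J"
        by (intro vals_lin(2)[OF J] 1 2)
      then have "(\<lambda>us. x * (?G us - kd us t)) \<in> vals (Suc i) J" by (simp add: algebra_simps)
      then have "(\<lambda>us. ?G us - kd us t) \<in> vals (Suc i) J"
        by (rule nzdv[rotated]) (use gc tc in \<open>auto intro!: cochains_intros cochains_lin kd_cochain\<close>)
      then have "?G \<in> bnd (Suc i) J" using tc unfolding bnd_def by blast
      then show "c k = 0" using g k by (auto simp: indep_def)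
    qed
    then show "\<exists>f. indep n i K f" by blast
  }
qed

text \<open>In degree 0 the only list is empty and \<open>kd [] g = 0\<close>, so coboundaries are
  trivial modulo \<open>J\<close>. Cocycles are the elements killed by \<open>m\<close>: degree-0
  cohomology is the socle.\<close>

lemma indep_0_iff:
  "(\<exists>f. indep n 0 J f) \<longleftrightarrow>
     (\<exists>f. (\<forall>k<n. f k \<in> R \<and> (\<forall>x\<in>m. x * f k \<in> J)) \<and>
        (\<forall>c. (\<Sum>k<n. C (c k) * f k) \<in> J \<longrightarrow> (\<forall>k<n. c k = 0)))" (is "?L \<longleftrightarrow> ?RR")
proof
  assume ?L
  then obtain f where f: "indep n 0 J f" by blast
  have "x * f k [] \<in> J" if "x \<in> m" "k < n" for x k
  proof -
    have "\<forall>us. set us \<subseteq> m \<longrightarrow> length us = Suc 0 \<longrightarrow> kd us (f k) \<in> J"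
      using f that unfolding indep_def cyc_def vals_def by blast
    from this[rule_format, of "[x]"] have "kd [x] (f k) \<in> J" using that by simp
    then show ?thesis by simp
  qed
  moreover have "f k [] \<in> R" if "k < n" for k
    using f that by (auto simp: indep_def cyc_def cochains_def)
  moreover have "\<forall>k<n. c k = 0" if "(\<Sum>k<n. C (c k) * f k []) \<in> J" for c
  proof -
    have "(\<lambda>us. \<Sum>k<n. C (c k) * f k us) \<in> bnd 0 J"
      using that subringD(1)[OF R] unfolding bnd_def vals_def cochains_def
      by (auto intro!: exI[of _ "\<lambda>_. 0"])
    then show ?thesis using f by (auto simp: indep_def)
  qed
  ultimately show ?RR by (intro exI[of _ "\<lambda>k. f k []"]) auto
next
  assume ?RR
  then obtain f where f: "\<forall>k<n. f k \<in> R \<and> (\<forall>x\<in>m. x * f k \<in> J)"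
    "\<forall>c. (\<Sum>k<n. C (c k) * f k) \<in> J \<longrightarrow> (\<forall>k<n. c k = 0)" by blast
  have "kd us (\<lambda>us. f k) \<in> J" if "k < n" "set us \<subseteq> m" "length us = Suc 0" for us k
    using that f by (auto simp: length_Suc_conv)
  moreover have "(\<Sum>k<n. C (c k) * f k) \<in> J" if "(\<lambda>us. \<Sum>k<n. C (c k) * f k) \<in> bnd 0 J" for c
    using that by (auto simp: bnd_def vals_def)
  ultimately have "indep n 0 J (\<lambda>k us. f k)"
    unfolding indep_def using f by (auto simp: cyc_def vals_def cochains_def)
  then show ?L by blast
qed

end

section \<open>Regular sequences and the socle\<close>

lemma regular_seq_Cons:
  assumes R: "subring R" and I: "idealof R I" and reg: "regular_seq R I (z # zs)"
  shows "z \<in> R" "nzd_mod R I z" "regular_seq R (ideal_gen R (I \<union> {z})) zs"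
proof -
  have sub: "set (z # zs) \<subseteq> R" and nz: "\<And>j. j < length (z # zs) \<Longrightarrow>
      nzd_mod R (ideal_gen R (I \<union> set (take j (z # zs)))) ((z # zs) ! j)"
    and one: "1 \<notin> ideal_gen R (I \<union> set (z # zs))"
    using reg unfolding regular_seq_def by auto
  show zR: "z \<in> R" using sub by simp
  show "nzd_mod R I z" using nz[of 0] ideal_gen_ideal[OF R I] by simp
  have eq: "ideal_gen R (ideal_gen R (I \<union> {z}) \<union> T) = ideal_gen R (I \<union> insert z T)" if "T \<subseteq> R" for T
    using ideal_gen_gen[OF R _ that, of "I \<union> {z}"] I zR by (auto simp: idealof_def)
  have "nzd_mod R (ideal_gen R (ideal_gen R (I \<union> {z}) \<union> set (take j zs))) (zs ! j)" if "j < length zs" for j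
  proof -
    have "set (take j zs) \<subseteq> R" using sub set_take_subset[of j zs] by auto
    from eq[OF this] nz[of "Suc j"] that show ?thesis by simp
  qed
  then show "regular_seq R (ideal_gen R (I \<union> {z})) zs"
    unfolding regular_seq_def using sub one eq[of "set zs"] by auto
qed

text \<open>Each element of the sequence raises the cohomological degree by one through
  \<open>shift\<close>. Vanishing and transfer are proved together because \<open>shift\<close>
  requires vanishing in the degree it starts from.\<close>

lemma koszul_regular:
  fixes R m :: "('v, 'k::field) mpoly set"
  assumes k: "koszul R m C" and I: "idealof R I" and reg: "regular_seq R I zs" and zm: "set zs \<subseteq> m"
  shows "(\<forall>i<length zs. koszul.cyc R m i I \<subseteq> koszul.bnd R m i I) \<and>
    (\<forall>n. (\<exists>f. koszul.indep R m C n 0 (ideal_gen R (I \<union> set zs)) f) \<longleftrightarrow>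
         (\<exists>f. koszul.indep R m C n (length zs) I f))"
  using I reg zm
proof (induction zs arbitrary: I)
  case Nil
  interpret koszul R m C by (rule k)
  show ?case using ideal_gen_ideal[OF R Nil(1)] by simp
next
  case (Cons z zs)
  interpret koszul R m C by (rule k)
  let ?K = "ideal_gen R (I \<union> {z})"
  note z = regular_seq_Cons[OF R Cons.prems(1,2)]
  have zm: "z \<in> m" using Cons.prems by simp
  have "I \<union> {z} \<subseteq> R" using Cons.prems z by (auto simp: idealof_def)
  then have K: "idealof R ?K" by (rule idealof_ideal_gen[OF R])
  have nzd: "f \<in> R \<Longrightarrow> z * f \<in> I \<Longrightarrow> f \<in> I" for f using z(2) by (auto simp: nzd_mod_def)
  note sh = shift[OF Cons.prems(1) zm nzd _ ideal_gen_insert[OF R Cons.prems(1) z(1)] K, simplified]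
  have IH: "\<forall>i<length zs. cyc i ?K \<subseteq> bnd i ?K"
    "\<And>n. (\<exists>f. indep n 0 (ideal_gen R (?K \<union> set zs)) f) \<longleftrightarrow> (\<exists>f. indep n (length zs) ?K f)"
    using Cons.IH[OF K z(3)] Cons.prems by auto
  \<comment> \<open>A degree-0 cocycle is killed by \<open>z\<close> modulo \<open>I\<close>, and
    \<open>z\<close> is a nonzerodivisor.\<close>
  have van0: "cyc 0 I \<subseteq> bnd 0 I"
  proof
    fix f assume f: "f \<in> cyc 0 I"
    then have "\<forall>us. set us \<subseteq> m \<longrightarrow> length us = Suc 0 \<longrightarrow> kd us f \<in> I" "f [] \<in> R"
      by (auto simp: cyc_def vals_def cochains_def)
    from this(1)[rule_format, of "[z]"] this(2) have "f [] \<in> I" using zm nzd by auto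
    then show "f \<in> bnd 0 I" using subringD(1)[OF R]
      by (auto simp: bnd_def vals_def cochains_def intro!: exI[of _ "\<lambda>_. 0"])
  qed
  \<comment> \<open>Vanishing in degree j for the quotient by \<open>z\<close> yields vanishing in
    degree j + 1 for \<open>I\<close>, by \<open>shift\<close> with one class; that application
    itself uses vanishing for \<open>I\<close> in degree j.\<close>
  have van: "cyc j I \<subseteq> bnd j I" if "j \<le> length zs" for j
    using that
  proof (induction j)
    case 0 show ?case by (rule van0)
  next
    case (Suc j)
    then have v: "cyc j I \<subseteq> bnd j I" by simp
    have "cyc j ?K \<subseteq> bnd j ?K" using IH(1) Suc.prems by simp
    then show ?case using sh[OF v, of 1] vanish_iff[OF K] vanish_iff[OF Cons.prems(1)] by (simp add: less_Suc_eq_le)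
  qed
  have "ideal_gen R (?K \<union> set zs) = ideal_gen R (I \<union> set (z # zs))"
    using ideal_gen_gen[OF R, of "I \<union> {z}" "set zs"] \<open>I \<union> {z} \<subseteq> R\<close> Cons.prems(3) m_sub by auto
  then show ?case using van IH(2) sh[OF van[OF order_refl]] by (auto simp: less_Suc_eq_le)
qed

text \<open>\<open>socle_dim\<close> counts independent sets, \<open>indep\<close> independent
  indexed families; a family that is independent modulo \<open>J\<close> is automatically
  injective.\<close>

lemma socle_dim_indep:
  fixes R m :: "('v, 'k::field) mpoly set"
  assumes "koszul R m (Const :: 'k \<Rightarrow> _)" and J: "idealof R J"
  shows "socle_dim R m J = (GREATEST n. \<exists>f. koszul.indep R m (Const :: 'k \<Rightarrow> _) n 0 J f)"
proof -
  interpret koszul R m "Const :: 'k \<Rightarrow> _" by (rule assms(1))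
  have "(\<exists>F. finite F \<and> card F = n \<and> F \<subseteq> {f \<in> R. \<forall>x\<in>m. x * f \<in> J} \<and>
       (\<forall>c. (\<Sum>f\<in>F. Const (c f) * f) \<in> J \<longrightarrow> (\<forall>f\<in>F. c f = 0))) \<longleftrightarrow> (\<exists>f. indep n 0 J f)"
    (is "?L \<longleftrightarrow> _") for n
    unfolding indep_0_iff
  proof
    assume ?L
    then obtain F where F: "finite F" "card F = n" "F \<subseteq> {f \<in> R. \<forall>x\<in>m. x * f \<in> J}"
      "\<And>c. (\<Sum>f\<in>F. Const (c f) * f) \<in> J \<Longrightarrow> (\<forall>f\<in>F. c f = 0)" by blast
    obtain h where h: "bij_betw h {..<n} F"
      using ex_bij_betw_nat_finite[OF F(1)] F(2) by (auto simp: atLeast0LessThan)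
    have hF: "h k \<in> F" if "k < n" for k using h that by (auto simp: bij_betw_def)
    show "\<exists>f. (\<forall>k<n. f k \<in> R \<and> (\<forall>x\<in>m. x * f k \<in> J)) \<and>
        (\<forall>c. (\<Sum>k<n. Const (c k) * f k) \<in> J \<longrightarrow> (\<forall>k<n. c k = (0::'k)))"
    proof (intro exI[of _ h] conjI allI impI ballI)
      fix c :: "nat \<Rightarrow> 'k" and k
      assume c: "(\<Sum>k<n. Const (c k) * h k) \<in> J" and k: "k < n"
      let ?g = "inv_into {..<n} h"
      have "(\<Sum>f\<in>F. Const (c (?g f)) * f) = (\<Sum>k<n. Const (c (?g (h k))) * h k)"
        by (rule sum.reindex_bij_betw[OF h, symmetric])
      also have "\<dots> = (\<Sum>k<n. Const (c k) * h k)"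
        using h by (intro sum.cong) (auto simp: bij_betw_def)
      finally have "\<forall>f\<in>F. c (?g f) = 0" using c F(4)[of "\<lambda>f. c (?g f)"] by simp
      then have "c (?g (h k)) = 0" using hF[OF k] by blast
      then show "c k = 0" using h k by (simp add: bij_betw_def)
    qed (use hF F(3) in auto)
  next
    assume "\<exists>f. (\<forall>k<n. f k \<in> R \<and> (\<forall>x\<in>m. x * f k \<in> J)) \<and>
        (\<forall>c. (\<Sum>k<n. Const (c k) * f k) \<in> J \<longrightarrow> (\<forall>k<n. c k = (0::'k)))"
    then obtain f where f: "\<And>k. k < n \<Longrightarrow> f k \<in> R \<and> (\<forall>x\<in>m. x * f k \<in> J)"
      "\<And>c k. (\<Sum>k<n. Const (c k) * f k) \<in> J \<Longrightarrow> k < n \<Longrightarrow> c k = (0::'k)" by blast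
    have inj: "inj_on f {..<n}"
    proof (rule inj_onI, rule ccontr)
      fix a b assume ab: "a \<in> {..<n}" "b \<in> {..<n}" "f a = f b" "a \<noteq> b"
      \<comment> \<open>A repeated member would give the nontrivial relation with coefficients 1 and
        -1.\<close>
      define c :: "nat \<Rightarrow> 'k" where "c k = (if k = a then 1 else if k = b then - 1 else 0)" for k
      have z: "Const (0::'k) = 0" by (simp add: Const_def)
      have "(\<Sum>k<n. Const (c k) * f k) = (\<Sum>k\<in>{a, b}. Const (c k) * f k)"
        using ab by (intro sum.mono_neutral_right) (auto simp: c_def z)
      also have "\<dots> = Const 1 * f a + Const (- 1) * f b"
        using ab by (simp add: c_def)
      also have "\<dots> = 0" using ab(3) by (simp add: Const_def single_uminus)
      finally have "c a = 0" using f(2)[of c a] ab idealofD(2)[OF R J] by simp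
      then show False by (simp add: c_def)
    qed
    show ?L
    proof (intro exI[of _ "f ` {..<n}"] conjI allI impI ballI)
      fix c :: "_ \<Rightarrow> 'k" and g
      assume c: "(\<Sum>g\<in>f ` {..<n}. Const (c g) * g) \<in> J" and g: "g \<in> f ` {..<n}"
      have "(\<Sum>k<n. Const (c (f k)) * f k) \<in> J"
        using c by (simp add: sum.reindex[OF inj])
      then show "c g = 0" using f(2)[of "\<lambda>k. c (f k)"] g by auto
    qed (use f inj in \<open>auto simp: card_image\<close>)
  qed
  then show ?thesis unfolding socle_dim_def by simp
qed

section \<open>Noetherian rings: an ideal of zero-divisors annihilates an element\<close>

definition noeth :: "('v, 'k::field) mpoly set \<Rightarrow> bool" where
  "noeth R \<longleftrightarrow> (\<forall>J. idealof R J \<longrightarrow> (\<exists>S. finite S \<and> S \<subseteq> J \<and> J = ideal_gen R S))"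

text \<open>Each of the finitely many generators supplied by \<open>noeth\<close> is a combination
  of finitely many elements of \<open>F\<close>; collecting these elements gives the required
  subset.\<close>

lemma noeth_finite_subset:
  assumes R: "subring R" and n: "noeth R" and F: "F \<subseteq> R"
  obtains F0 where "finite F0" "F0 \<subseteq> F" "ideal_gen R F0 = ideal_gen R F"
proof -
  obtain S where S: "finite S" "S \<subseteq> ideal_gen R F" "ideal_gen R F = ideal_gen R S"
    using n idealof_ideal_gen[OF R F] unfolding noeth_def by blast
  have "\<exists>A. finite A \<and> A \<subseteq> F \<and> s \<in> ideal_gen R A" if "s \<in> S" for s
  proof -
    have "s \<in> ideal_gen R F" using S(2) that by blast
    then obtain A f where "finite A" "A \<subseteq> F" "\<forall>a\<in>A. f a \<in> R" "s = (\<Sum>a\<in>A. f a * a)"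
      unfolding ideal_gen_def by (elim CollectE exE conjE)
    then show ?thesis unfolding ideal_gen_def by blast
  qed
  then obtain A where A: "\<And>s. s \<in> S \<Longrightarrow> finite (A s) \<and> A s \<subseteq> F \<and> s \<in> ideal_gen R (A s)"
    by metis
  let ?F0 = "\<Union>s\<in>S. A s"
  have sub: "?F0 \<subseteq> F" using A by blast
  have "S \<subseteq> ideal_gen R ?F0"
  proof
    fix s assume s: "s \<in> S"
    then have "ideal_gen R (A s) \<subseteq> ideal_gen R ?F0"
      using sub F by (intro ideal_gen_mono[OF R]) auto
    then show "s \<in> ideal_gen R ?F0" using A s by auto
  qed
  then have "ideal_gen R F \<subseteq> ideal_gen R ?F0"
    unfolding S(3) using sub F by (intro ideal_gen_least idealof_ideal_gen[OF R]) auto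
  moreover have "ideal_gen R ?F0 \<subseteq> ideal_gen R F" by (rule ideal_gen_mono[OF R sub F])
  ultimately show ?thesis using that[of ?F0] S(1) A sub by auto
qed

text \<open>Zorn's lemma supplies the maximal member: the union of a chain of ideals is finitely
  generated, its generators lie in one link, and this link is the union.\<close>

lemma noeth_max:
  assumes R: "subring R" and n: "noeth R" and A: "\<And>J. J \<in> \<A> \<Longrightarrow> idealof R J" and P: "P \<in> \<A>"
  shows "\<exists>M\<in>\<A>. P \<subseteq> M \<and> (\<forall>X\<in>\<A>. M \<subseteq> X \<longrightarrow> X = M)"
proof -
  let ?B = "{X \<in> \<A>. P \<subseteq> X}"
  have "\<exists>M\<in>?B. \<forall>X\<in>?B. M \<subseteq> X \<longrightarrow> X = M"
  proof (rule subset_Zorn)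
    fix CC assume chain: "subset.chain ?B CC"
    show "\<exists>U\<in>?B. \<forall>X\<in>CC. X \<subseteq> U"
    proof (cases "CC = {}")
      case True then show ?thesis using P by blast
    next
      case False
      have CB: "CC \<subseteq> ?B" and lin: "\<And>X Y. X \<in> CC \<Longrightarrow> Y \<in> CC \<Longrightarrow> X \<subseteq> Y \<or> Y \<subseteq> X"
        using chain unfolding subset.chain_def by blast+
      have id: "idealof R X" if "X \<in> CC" for X using A CB that by blast
      have U: "idealof R (\<Union>CC)"
        unfolding idealof_def
      proof (intro conjI ballI)
        show "\<Union>CC \<subseteq> R" "0 \<in> \<Union>CC" using id False unfolding idealof_def by blast+
        fix a b assume "a \<in> \<Union>CC" "b \<in> \<Union>CC"
        then obtain X Y where "X \<in> CC" "Y \<in> CC" "a \<in> X" "b \<in> Y" by blast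
        then obtain Z where "Z \<in> CC" "a \<in> Z" "b \<in> Z" using lin by blast
        then show "a + b \<in> \<Union>CC" using id by (auto simp: idealof_def)
      next
        fix r a assume "r \<in> R" "a \<in> \<Union>CC"
        then show "r * a \<in> \<Union>CC" using id unfolding idealof_def by blast
      qed
      from n[unfolded noeth_def, rule_format, OF this]
      obtain S where S: "finite S" "S \<subseteq> \<Union>CC" "\<Union>CC = ideal_gen R S"
        by (elim exE conjE)
      have "subset.chain UNIV CC" using lin unfolding subset.chain_def by blast
      then obtain X where X: "X \<in> CC" "S \<subseteq> X"
        by (rule finite_subset_Union_chain[OF S(1,2) False])
      have "\<Union>CC \<subseteq> X" unfolding S(3) by (rule ideal_gen_least[OF id[OF X(1)] X(2)])
      then show ?thesis using X(1) CB by (intro bexI[of _ X]) auto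
    qed
  qed
  then obtain M where "M \<in> \<A>" "P \<subseteq> M" "\<forall>X\<in>?B. M \<subseteq> X \<longrightarrow> X = M" by blast
  then show ?thesis by (intro bexI[of _ M] conjI ballI impI) auto
qed

definition prime_in :: "'a::comm_ring_1 set \<Rightarrow> 'a set \<Rightarrow> bool" where
  "prime_in R P \<longleftrightarrow> idealof R P \<and> 1 \<notin> P \<and> (\<forall>a\<in>R. \<forall>b\<in>R. a * b \<in> P \<longrightarrow> a \<in> P \<or> b \<in> P)"

lemma prime_in_prod:
  assumes R: "subring R" and P: "prime_in R P" and "finite A" "\<And>i. i \<in> A \<Longrightarrow> f i \<in> R" "prod f A \<in> P"
  shows "\<exists>i\<in>A. f i \<in> P"
  using assms(3-)
proof (induction A rule: finite_induct)
  case empty then show ?case using P by (auto simp: prime_in_def)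
next
  case (insert x F)
  have "prod f F \<in> R" using insert by (intro subring_prod[OF R]) auto
  then have "f x \<in> P \<or> prod f F \<in> P" using insert P by (auto simp: prime_in_def)
  then show ?case using insert by auto
qed

text \<open>After discarding redundant primes, each remaining \<open>P\<close> contains some
  \<open>x P\<close> in \<open>m\<close> that no other prime contains. If there are several primes,
  adding to one of these elements the product of the others gives an element of \<open>m\<close>
  outside all of them.\<close>

lemma prime_avoidance:
  assumes R: "subring R" and m: "idealof R m"
    and "finite \<P>" "\<And>P. P \<in> \<P> \<Longrightarrow> prime_in R P" "m \<subseteq> \<Union>\<P>"
  shows "\<exists>P\<in>\<P>. m \<subseteq> P"
  using assms(3-)
proof (induction "card \<P>" arbitrary: \<P> rule: less_induct)
  case less
  note M = idealofD[OF R m]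
  show ?case
  proof (cases "\<exists>P\<in>\<P>. m \<subseteq> \<Union>(\<P> - {P})")
    case True
    then obtain P where P: "P \<in> \<P>" "m \<subseteq> \<Union>(\<P> - {P})" by blast
    have "card (\<P> - {P}) < card \<P>" using P less.prems by (meson card_Diff1_less)
    from less.hyps[OF this _ _ P(2)] less.prems show ?thesis by auto
  next
    case False
    then have "\<forall>P\<in>\<P>. \<exists>x. x \<in> m \<and> x \<notin> \<Union>(\<P> - {P})" by blast
    then obtain x where x: "\<And>P. P \<in> \<P> \<Longrightarrow> x P \<in> m" "\<And>P. P \<in> \<P> \<Longrightarrow> x P \<notin> \<Union>(\<P> - {P})"
      by metis
    have xP: "x P \<in> P" if "P \<in> \<P>" for P using x[OF that] less.prems(3) by blast
    have xQ: "x P \<notin> Q" if "P \<in> \<P>" "Q \<in> \<P>" "P \<noteq> Q" for P Q using x(2)[OF that(1)] that by blast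
    obtain P0 where P0: "P0 \<in> \<P>" using less.prems(3) M(2) by blast
    show ?thesis
    proof (cases "\<P> = {P0}")
      case True then show ?thesis using less.prems by auto
    next
      case False
      let ?q = "prod x (\<P> - {P0})"
      have xR: "P \<in> \<P> \<Longrightarrow> x P \<in> R" for P using x M(1) by blast
      obtain P1 where P1: "P1 \<in> \<P> - {P0}" using False P0 by blast
      have q_in: "?q \<in> J" if "idealof R J" "P \<in> \<P> - {P0}" "x P \<in> J" for J P
      proof -
        have "?q = prod x (\<P> - {P0} - {P}) * x P"
          using prod.remove[of "\<P> - {P0}" P x] that less.prems(1) by (simp add: mult.commute)
        moreover have "prod x (\<P> - {P0} - {P}) \<in> R" using xR by (intro subring_prod[OF R]) auto
        ultimately show ?thesis using idealofD(4)[OF R that(1)] that(3) by simp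
      qed
      have "?q \<in> m" using q_in[OF m P1] x P1 by blast
      then have "x P0 + ?q \<in> m" using M(3) x P0 by blast
      then obtain P where P: "P \<in> \<P>" "x P0 + ?q \<in> P" using less.prems(3) by blast
      have prP: "prime_in R P" and idP: "idealof R P" using less.prems(2)[OF P(1)] by (auto simp: prime_in_def)
      note D = idealofD[OF R idP]
      show ?thesis
      proof (cases "P = P0")
        case True
        then have "?q \<in> P" using D(7)[OF P(2), of "x P0"] xP[OF P0] by simp
        then obtain Q where "Q \<in> \<P> - {P0}" "x Q \<in> P"
          using prime_in_prod[OF R prP, of "\<P> - {P0}" x] xR less.prems(1) by auto
        then show ?thesis using xQ[of Q P] True P0 by auto
      next
        case False
        then have "?q \<in> P" using q_in[OF idP, of P] P xP by blast
        then have "x P0 \<in> P" using D(7)[OF P(2), of ?q] by simp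
        then show ?thesis using xQ[of P0 P] P P0 False by auto
      qed
    qed
  qed
qed

text \<open>Maximal annihilators are prime, and finitely many of them cover all zero-divisors.\<close>

lemma noeth_zero_divisors:
  assumes R: "subring R" and n: "noeth R" and J: "idealof R J" and m: "idealof R m"
    and zd: "\<And>x. x \<in> m \<Longrightarrow> \<exists>f\<in>R. f \<notin> J \<and> x * f \<in> J"
  shows "\<exists>f\<in>R. f \<notin> J \<and> (\<forall>x\<in>m. x * f \<in> J)"
proof -
  note S = subringD[OF R] and I = idealofD[OF R J]
  define ann where "ann f = {x \<in> R. x * f \<in> J}" for f
  have ann_id: "idealof R (ann f)" if "f \<in> R" for f
    unfolding idealof_def ann_def using S I that by (auto simp: distrib_right mult.assoc)
  \<comment> \<open>The elements outside \<open>J\<close> whose annihilators modulo \<open>J\<close>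
    are maximal.\<close>
  define F where "F = {f \<in> R. f \<notin> J \<and> (\<forall>g\<in>R. g \<notin> J \<longrightarrow> ann f \<subseteq> ann g \<longrightarrow> ann g = ann f)}"
  have FR: "F \<subseteq> R" by (auto simp: F_def)
  have toF: "\<exists>f\<in>F. ann g \<subseteq> ann f" if g: "g \<in> R" "g \<notin> J" for g
  proof -
    have "\<exists>M\<in>ann ` {f \<in> R. f \<notin> J}. ann g \<subseteq> M \<and> (\<forall>X\<in>ann ` {f \<in> R. f \<notin> J}. M \<subseteq> X \<longrightarrow> X = M)"
      using ann_id g by (intro noeth_max[OF R n]) auto
    then obtain f where "f \<in> R" "f \<notin> J" "ann g \<subseteq> ann f"
      "\<forall>X\<in>ann ` {f \<in> R. f \<notin> J}. ann f \<subseteq> X \<longrightarrow> X = ann f" by blast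
    then show ?thesis unfolding F_def by blast
  qed
  have prime: "prime_in R (ann f)" if f: "f \<in> F" for f
    unfolding prime_in_def
  proof (intro conjI ballI impI)
    have fR: "f \<in> R" "f \<notin> J" using f by (auto simp: F_def)
    show "idealof R (ann f)" "1 \<notin> ann f" using ann_id fR by (auto simp: ann_def)
    fix a b assume ab: "a \<in> R" "b \<in> R" "a * b \<in> ann f"
    show "a \<in> ann f \<or> b \<in> ann f"
    proof (rule disjCI)
      assume "b \<notin> ann f"
      then have b: "b * f \<in> R" "b * f \<notin> J" using ab S fR by (auto simp: ann_def)
      have "ann f \<subseteq> ann (b * f)"
      proof
        fix x assume "x \<in> ann f"
        then have "b * (x * f) \<in> J" "x \<in> R" using I(4) ab by (auto simp: ann_def)
        then show "x \<in> ann (b * f)" by (simp add: ann_def mult.left_commute)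
      qed
      then have "ann (b * f) = ann f" using f b by (auto simp: F_def)
      moreover have "a \<in> ann (b * f)" using ab by (auto simp: ann_def mult.assoc)
      ultimately show "a \<in> ann f" by simp
    qed
  qed
  obtain F0 where F0: "finite F0" "F0 \<subseteq> F" "ideal_gen R F0 = ideal_gen R F"
    using noeth_finite_subset[OF R n FR] .
  have "m \<subseteq> \<Union>(ann ` F0)"
  proof
    fix x assume x: "x \<in> m"
    then obtain g where g: "g \<in> R" "g \<notin> J" "x * g \<in> J" using zd by blast
    obtain f where f: "f \<in> F" "ann g \<subseteq> ann f" using toF g by blast
    have xf: "x \<in> ann f" using f g idealofD(1)[OF R m x] by (auto simp: ann_def)
    \<comment> \<open>Otherwise choose for each \<open>a\<close> in \<open>F0\<close> an element
      killing \<open>a\<close> but not \<open>f\<close>. Their product kills the whole ideal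
      generated by \<open>F0\<close>, hence \<open>f\<close>, contrary to the primality of
      \<open>ann f\<close>.\<close>
    have "\<exists>a\<in>F0. ann a \<subseteq> ann f"
    proof (rule ccontr)
      assume "\<not> ?thesis"
      then have "\<forall>a\<in>F0. \<exists>y. y \<in> ann a \<and> y \<notin> ann f" by blast
      then obtain y where y: "\<And>a. a \<in> F0 \<Longrightarrow> y a \<in> ann a" "\<And>a. a \<in> F0 \<Longrightarrow> y a \<notin> ann f" by metis
      have yR: "y a \<in> R" if "a \<in> F0" for a using y(1)[OF that] by (auto simp: ann_def)
      let ?q = "prod y F0"
      have qR: "?q \<in> R" using yR by (intro subring_prod[OF R])
      have "idealof R {g \<in> R. ?q * g \<in> J}"
        unfolding idealof_def using S I qR by (auto simp: distrib_left mult.left_commute)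
      moreover have "F0 \<subseteq> {g \<in> R. ?q * g \<in> J}"
      proof
        fix a assume a: "a \<in> F0"
        have "?q = prod y (F0 - {a}) * y a"
          using prod.remove[OF F0(1) a, of y] by (simp add: mult.commute)
        then have "?q * a = prod y (F0 - {a}) * (y a * a)" by (simp add: mult.assoc)
        moreover have "prod y (F0 - {a}) \<in> R" using yR by (intro subring_prod[OF R]) auto
        moreover have "y a * a \<in> J" using y(1)[OF a] by (auto simp: ann_def)
        ultimately show "a \<in> {g \<in> R. ?q * g \<in> J}" using I(4) a F0(2) FR by auto
      qed
      ultimately have "ideal_gen R F0 \<subseteq> {g \<in> R. ?q * g \<in> J}" by (rule ideal_gen_least)
      then have "?q \<in> ann f" using F0(3) ideal_gen_superset[OF R, of F] f qR by (auto simp: ann_def)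
      then show False using prime_in_prod[OF R prime[OF f(1)] F0(1), of y] yR y(2) by blast
    qed
    then obtain a where a: "a \<in> F0" "ann a \<subseteq> ann f" by blast
    \<comment> \<open>The inclusion is an equality because \<open>ann a\<close> is itself
      maximal.\<close>
    then have "ann f = ann a" using F0(2) f(1) by (auto simp: F_def)
    then show "x \<in> \<Union>(ann ` F0)" using xf a by blast
  qed
  then obtain P where "P \<in> ann ` F0" "m \<subseteq> P"
    using prime_avoidance[OF R m, of "ann ` F0"] F0(1,2) prime by blast
  then obtain f where "f \<in> F" "m \<subseteq> ann f" using F0 by auto
  then show ?thesis by (auto simp: F_def ann_def)
qed

text \<open>Maximality says that every element of \<open>m\<close> is a zero-divisor modulo the
  sequence; the Noetherian property replaces the many annihilated elements by a single socle
  element.\<close>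

lemma maximal_regular_seq_socle:
  fixes R m :: "('v, 'k::field) mpoly set"
  assumes k: "koszul R m (Const :: 'k \<Rightarrow> _)" and n: "noeth R" and I: "idealof R I" "I \<subseteq> m"
    and one: "1 \<notin> m" and reg: "regular_seq R I zs" and zm: "set zs \<subseteq> m"
  shows "maximal_regular_seq_in R I m zs \<longleftrightarrow>
    (\<exists>f\<in>R. f \<notin> ideal_gen R (I \<union> set zs) \<and> (\<forall>x\<in>m. x * f \<in> ideal_gen R (I \<union> set zs)))"
    (is "_ \<longleftrightarrow> ?soc")
proof -
  interpret koszul R m "Const :: 'k \<Rightarrow> _" by (rule k)
  let ?J = "ideal_gen R (I \<union> set zs)"
  have "I \<union> set zs \<subseteq> R" using I(2) zm m_sub by auto
  then have J: "idealof R ?J" by (rule idealof_ideal_gen[OF R])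
  have app: "regular_seq R I (zs @ [x]) \<longleftrightarrow> nzd_mod R ?J x" if x: "x \<in> m" for x
  proof -
    \<comment> \<open>All generators lie in the proper ideal \<open>m\<close>, so the properness
      clause of \<open>regular_seq\<close> survives the extension and only the nonzerodivisor
      condition can fail.\<close>
    have "ideal_gen R (I \<union> set (zs @ [x])) \<subseteq> m" using I zm x by (intro ideal_gen_least[OF m]) auto
    then have 1: "1 \<notin> ideal_gen R (I \<union> set (zs @ [x]))" using one by blast
    have 2: "set (zs @ [x]) \<subseteq> R" using zm x m_sub by auto
    have "(\<forall>j<length (zs @ [x]). nzd_mod R (ideal_gen R (I \<union> set (take j (zs @ [x])))) ((zs @ [x]) ! j))
      \<longleftrightarrow> nzd_mod R ?J x"
      using reg by (auto simp: regular_seq_def nth_append less_Suc_eq)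
    then show ?thesis unfolding regular_seq_def using 1 2 by blast
  qed
  have max: "maximal_regular_seq_in R I m zs \<longleftrightarrow> (\<forall>x\<in>m. \<exists>f\<in>R. f \<notin> ?J \<and> x * f \<in> ?J)"
    unfolding maximal_regular_seq_in_def using app reg zm by (auto simp: nzd_mod_def)
  show ?thesis unfolding max
    using noeth_zero_divisors[OF R n J m] by blast
qed

theorem cm_type_eq_socle_dim:
  fixes R m :: "('v, 'k::field) mpoly set"
  assumes k: "koszul R m (Const :: 'k \<Rightarrow> _)" and n: "noeth R" and I: "idealof R I" "I \<subseteq> m"
    and one: "1 \<notin> m" and max: "maximal_regular_seq_in R I m zs"
  shows "cm_type R m I = socle_dim R m (ideal_gen R (I \<union> set zs))"
proof -
  interpret koszul R m "Const :: 'k \<Rightarrow> _" by (rule k)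
  have props: "regular_seq R I ys" "set ys \<subseteq> m" "idealof R (ideal_gen R (I \<union> set ys))"
    if "maximal_regular_seq_in R I m ys" for ys
    using that I m_sub unfolding maximal_regular_seq_in_def by (auto intro!: idealof_ideal_gen[OF R])
  \<comment> \<open>The socle element certifying maximality is a nonzero degree-0 class modulo the
    sequence, which moves to degree \<open>length ys\<close> for \<open>I\<close>.\<close>
  have top: "(\<exists>f. indep 1 (length ys) I f)" if mx: "maximal_regular_seq_in R I m ys" for ys
  proof -
    let ?J = "ideal_gen R (I \<union> set ys)"
    note p = props[OF mx]
    obtain g where g: "g \<in> R" "g \<notin> ?J" "\<forall>x\<in>m. x * g \<in> ?J"
      using maximal_regular_seq_socle[OF k n I one p(1,2)] mx by blast
    have "\<exists>f. indep 1 0 ?J f"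
      unfolding vanish_iff[OF p(3)]
    proof
      assume "cyc 0 ?J \<subseteq> bnd 0 ?J"
      moreover have "(\<lambda>us. g) \<in> cyc 0 ?J"
        using g by (auto simp: cyc_def cochains_def vals_def length_Suc_conv)
      ultimately show False using g by (auto simp: bnd_def vals_def)
    qed
    then show ?thesis using koszul_regular[OF k I(1) p(1,2)] by blast
  qed
  \<comment> \<open>A longer sequence forces vanishing in the very degree where a shorter maximal
    one has a nonzero class.\<close>
  have le: "length ys \<le> length ws" if "maximal_regular_seq_in R I m ys" "maximal_regular_seq_in R I m ws" for ys ws
  proof (rule ccontr)
    assume "\<not> length ys \<le> length ws"
    then have "cyc (length ws) I \<subseteq> bnd (length ws) I"
      using koszul_regular[OF k I(1) props(1,2)[OF that(1)]] by auto
    then show False using top[OF that(2)] vanish_iff[OF I(1)] by blast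
  qed
  define ys where "ys = (SOME zs. maximal_regular_seq_in R I m zs)"
  have ys: "maximal_regular_seq_in R I m ys" unfolding ys_def using max by (rule someI)
  have "length ys = length zs" using le ys max by (meson order_antisym)
  then have "(\<exists>f. indep n 0 (ideal_gen R (I \<union> set ys)) f) \<longleftrightarrow> (\<exists>f. indep n 0 (ideal_gen R (I \<union> set zs)) f)" for n
    using koszul_regular[OF k I(1) props(1,2)[OF ys]] koszul_regular[OF k I(1) props(1,2)[OF max]] by simp
  then show ?thesis
    unfolding cm_type_def ys_def[symmetric]
    by (simp add: socle_dim_indep[OF k] props[OF ys] props[OF max])
qed

section \<open>Hilbert's basis theorem\<close>

text \<open>The element \<open>v\<close> need not be transcendental over \<open>A\<close>: the coefficients of an element of
  \<open>pol n\<close> are not assumed to be unique.\<close>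

locale adjoin =
  fixes A B :: "('v, 'k::field) mpoly set" and v :: "('v, 'k) mpoly"
  assumes A: "subring A" and B: "subring B" and AB: "A \<subseteq> B" and v: "v \<in> B"
begin

text \<open>The bound on the degree in \<open>v\<close> is strict, so that \<open>pol n\<close> is
  exactly what may stand below a term in \<open>v ^ n\<close>.\<close>

primrec pol :: "nat \<Rightarrow> ('v, 'k) mpoly set" where
  "pol 0 = {0}"
| "pol (Suc n) = {a * v ^ n + q | a q. a \<in> A \<and> q \<in> pol n}"

text \<open>The ideal of leading coefficients of elements of \<open>I\<close> in degree
  \<open>n\<close>; 0 accounts for elements of lower degree.\<close>

definition topcoef :: "nat \<Rightarrow> ('v, 'k) mpoly set \<Rightarrow> ('v, 'k) mpoly set" where
  "topcoef n I = {a \<in> A. \<exists>q\<in>pol n. a * v ^ n + q \<in> I}"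

lemma pol_SucI: "a \<in> A \<Longrightarrow> q \<in> pol n \<Longrightarrow> p = a * v ^ n + q \<Longrightarrow> p \<in> pol (Suc n)"
  by auto

lemma pol_0: "0 \<in> pol n"
  by (induction n) (auto intro!: exI[of _ 0] subringD[OF A])

lemma pol_add: "p \<in> pol n \<Longrightarrow> q \<in> pol n \<Longrightarrow> p + q \<in> pol n"
proof (induction n arbitrary: p q)
  case (Suc n)
  then obtain a b p' q' where "p = a * v ^ n + p'" "q = b * v ^ n + q'" "a \<in> A" "b \<in> A"
    "p' \<in> pol n" "q' \<in> pol n" by auto
  moreover from this have "p + q = (a + b) * v ^ n + (p' + q')" by (simp add: algebra_simps)
  ultimately show ?case by (intro pol_SucI[of "a + b" "p' + q'"] Suc.IH subringD(3)[OF A])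
qed auto

lemma pol_scale: "c \<in> A \<Longrightarrow> p \<in> pol n \<Longrightarrow> c * p \<in> pol n"
proof (induction n arbitrary: p)
  case (Suc n)
  then obtain a p' where "p = a * v ^ n + p'" "a \<in> A" "p' \<in> pol n" by auto
  moreover from this have "c * p = (c * a) * v ^ n + c * p'" by (simp add: algebra_simps)
  ultimately show ?case using Suc.prems by (intro pol_SucI[of "c * a" "c * p'"] Suc.IH subringD(4)[OF A])
qed auto

lemma pol_diff: "p \<in> pol n \<Longrightarrow> q \<in> pol n \<Longrightarrow> p - q \<in> pol n"
  using pol_add[of p n "- 1 * q"] pol_scale[of "- 1" q n] subringD(2,5)[OF A] by simp

lemma pol_Suc: "pol n \<subseteq> pol (Suc n)"
  using pol_SucI[OF subringD(1)[OF A]] by auto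

lemma pol_mono: "n \<le> k \<Longrightarrow> pol n \<subseteq> pol k"
  by (rule lift_Suc_mono_le[of pol, OF pol_Suc])

lemma pol_shift: "p \<in> pol n \<Longrightarrow> v * p \<in> pol (Suc n)"
proof (induction n arbitrary: p)
  case 0 then show ?case using pol_0[of "Suc 0"] by simp
next
  case (Suc n)
  then obtain a p' where "p = a * v ^ n + p'" "a \<in> A" "p' \<in> pol n" by auto
  moreover from this have "v * p = a * v ^ Suc n + v * p'" by (simp add: algebra_simps)
  ultimately show ?case by (intro pol_SucI[of a "v * p'"] Suc.IH)
qed

lemma topcoef_ideal:
  assumes I: "idealof B I"
  shows "idealof A (topcoef n I)"
  unfolding idealof_def
proof (intro conjI ballI)
  note D = idealofD[OF B I]
  show "topcoef n I \<subseteq> A" by (auto simp: topcoef_def)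
  show "0 \<in> topcoef n I" using pol_0 D(2) subringD(1)[OF A] by (auto simp: topcoef_def intro!: bexI[of _ 0])
  fix a assume "a \<in> topcoef n I"
  then obtain p where p: "a \<in> A" "p \<in> pol n" "a * v ^ n + p \<in> I" by (auto simp: topcoef_def)
  {
    fix b assume "b \<in> topcoef n I"
    then obtain q where q: "b \<in> A" "q \<in> pol n" "b * v ^ n + q \<in> I" by (auto simp: topcoef_def)
    have "(a + b) * v ^ n + (p + q) \<in> I" using D(3)[OF p(3) q(3)] by (simp add: algebra_simps)
    then show "a + b \<in> topcoef n I" using p q pol_add subringD(3)[OF A] by (auto simp: topcoef_def)
  }
  {
    fix r assume r: "r \<in> A"
    have "(r * a) * v ^ n + r * p \<in> I" using D(4)[OF _ p(3), of r] r AB by (auto simp: algebra_simps)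
    then show "r * a \<in> topcoef n I" using p r pol_scale subringD(4)[OF A] by (auto simp: topcoef_def)
  }
qed

lemma topcoef_Suc:
  assumes I: "idealof B I"
  shows "topcoef n I \<subseteq> topcoef (Suc n) I"
proof
  fix a assume "a \<in> topcoef n I"
  then obtain p where p: "a \<in> A" "p \<in> pol n" "a * v ^ n + p \<in> I" by (auto simp: topcoef_def)
  have "a * v ^ Suc n + v * p \<in> I" using idealofD(4)[OF B I v p(3)] by (simp add: algebra_simps)
  then show "a \<in> topcoef (Suc n) I" unfolding topcoef_def using p pol_shift by blast
qed

lemma topcoef_mono: "idealof B I \<Longrightarrow> n \<le> k \<Longrightarrow> topcoef n I \<subseteq> topcoef k I"
  by (rule lift_Suc_mono_le[of "\<lambda>n. topcoef n I", OF topcoef_Suc])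

text \<open>Subtracting an element of \<open>J\<close> with the same leading coefficient lowers the
  degree, so induction on the degree puts \<open>I\<close> into \<open>J\<close>.\<close>

lemma topcoef_compare:
  assumes I: "idealof B I" and J: "idealof B J" and JI: "J \<subseteq> I"
    and le: "\<And>n. topcoef n I \<subseteq> topcoef n J" and all: "\<And>b. b \<in> B \<Longrightarrow> \<exists>n. b \<in> pol n"
  shows "I \<subseteq> J"
proof
  have *: "p \<in> pol n \<Longrightarrow> p \<in> I \<Longrightarrow> p \<in> J" for n p
  proof (induction n arbitrary: p)
    case 0 then show ?case using idealofD(2)[OF B J] by simp
  next
    case (Suc n)
    then obtain a q where a: "p = a * v ^ n + q" "a \<in> A" "q \<in> pol n" by auto
    then have "a \<in> topcoef n I" using Suc.prems by (auto simp: topcoef_def)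
    then obtain q' where q': "q' \<in> pol n" "a * v ^ n + q' \<in> J" using le by (auto simp: topcoef_def)
    have "p - (a * v ^ n + q') \<in> I" using idealofD(7)[OF B I] Suc.prems(2) q' JI by blast
    moreover have eq: "p - (a * v ^ n + q') = q - q'" using a by simp
    ultimately have "q - q' \<in> J" using Suc.IH pol_diff[OF a(3) q'(1)] by simp
    then have "(q - q') + (a * v ^ n + q') \<in> J" using idealofD(3)[OF B J _ q'(2)] by blast
    then show ?case using a(1) by (simp add: algebra_simps)
  qed
  fix p assume "p \<in> I"
  then show "p \<in> J" using * all idealofD(1)[OF B I] by blast
qed

text \<open>The leading-coefficient ideals increase with the degree and their union is finitely
  generated, so they are constant from some \<open>N\<close> on. Generators in degrees up to
  \<open>N\<close> then control all degrees.\<close>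

theorem noeth_adjoin:
  assumes n: "noeth A" and all: "\<And>b. b \<in> B \<Longrightarrow> \<exists>n. b \<in> pol n"
  shows "noeth B"
  unfolding noeth_def
proof (intro allI impI)
  fix I assume I: "idealof B I"
  note mono = topcoef_mono[OF I]
  let ?U = "\<Union>n. topcoef n I"
  have "idealof A ?U"
    unfolding idealof_def
  proof (intro conjI ballI)
    note D = idealofD[OF A topcoef_ideal[OF I]]
    show "?U \<subseteq> A" using D(1) by blast
    show "0 \<in> ?U" using D(2) by blast
    show "r * a \<in> ?U" if "r \<in> A" "a \<in> ?U" for r a using D(4) that by blast
    fix a b assume "a \<in> ?U" "b \<in> ?U"
    then obtain k l where "a \<in> topcoef k I" "b \<in> topcoef l I" by blast
    then have "a \<in> topcoef (max k l) I" "b \<in> topcoef (max k l) I"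
      using mono[of k "max k l"] mono[of l "max k l"] by auto
    then show "a + b \<in> ?U" using D(3) by blast
  qed
  then obtain S where S: "finite S" "S \<subseteq> ?U" "?U = ideal_gen A S"
    using n unfolding noeth_def by meson
  have "\<exists>N. S \<subseteq> topcoef N I"
    using S(1,2)
  proof (induction S rule: finite_induct)
    case (insert x S)
    then obtain k N where "x \<in> topcoef k I" "S \<subseteq> topcoef N I" by blast
    then have "insert x S \<subseteq> topcoef (max k N) I"
      using mono[of k "max k N"] mono[of N "max k N"] by auto
    then show ?case by blast
  qed auto
  then obtain N where "S \<subseteq> topcoef N I" by blast
  then have UN: "?U \<subseteq> topcoef N I" unfolding S(3) by (rule ideal_gen_least[OF topcoef_ideal[OF I]])
  have "\<forall>n. \<exists>S. finite S \<and> S \<subseteq> topcoef n I \<and> topcoef n I = ideal_gen A S"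
    using n topcoef_ideal[OF I] unfolding noeth_def by blast
  then obtain G where G: "\<And>n. finite (G n)" "\<And>n. G n \<subseteq> topcoef n I" "\<And>n. topcoef n I = ideal_gen A (G n)"
    by metis
  have "\<forall>n. \<forall>a\<in>topcoef n I. \<exists>b. b \<in> I \<and> (\<exists>q\<in>pol n. b = a * v ^ n + q)"
    by (auto simp: topcoef_def)
  then obtain h where h: "\<And>n a. a \<in> topcoef n I \<Longrightarrow> h n a \<in> I \<and> (\<exists>q\<in>pol n. h n a = a * v ^ n + q)"
    by metis
  \<comment> \<open>Lifts to \<open>I\<close> of generators of the leading-coefficient ideals up to
    degree \<open>N\<close>. In higher degrees the same coefficients are reached by multiplying with
    powers of \<open>v\<close>.\<close>
  let ?T = "\<Union>n\<in>{..N}. h n ` G n"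
  have T: "finite ?T" "?T \<subseteq> I" using G(1,2) h by blast+
  have IB: "I \<subseteq> B" using I by (auto simp: idealof_def)
  have J: "idealof B (ideal_gen B ?T)" using T IB by (intro idealof_ideal_gen[OF B]) auto
  have JI: "ideal_gen B ?T \<subseteq> I" by (rule ideal_gen_least[OF I T(2)])
  have low: "topcoef n I \<subseteq> topcoef n (ideal_gen B ?T)" if "n \<le> N" for n
    unfolding G(3)[of n]
  proof (rule ideal_gen_least[OF topcoef_ideal[OF J]], rule subsetI)
    fix a assume a: "a \<in> G n"
    then have aI: "a \<in> topcoef n I" using G(2) by blast
    have "h n a \<in> ideal_gen B ?T" using ideal_gen_superset[OF B, of ?T] a that by blast
    then show "a \<in> topcoef n (ideal_gen B ?T)" using h[OF aI] aI by (auto simp: topcoef_def)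
  qed
  have "topcoef n I \<subseteq> topcoef n (ideal_gen B ?T)" for n
  proof (cases "n \<le> N")
    case False
    have "topcoef n I \<subseteq> topcoef N I" using UN by blast
    also have "\<dots> \<subseteq> topcoef N (ideal_gen B ?T)" by (rule low) simp
    also have "\<dots> \<subseteq> topcoef n (ideal_gen B ?T)" using False by (intro topcoef_mono[OF J]) simp
    finally show ?thesis .
  qed (rule low)
  then have "I = ideal_gen B ?T" using topcoef_compare[OF I J JI _ all] JI by blast
  then show "\<exists>S. finite S \<and> S \<subseteq> I \<and> I = ideal_gen B S" using T by blast
qed

end

section \<open>Polynomials and monomials\<close>

abbreviation "lookup \<equiv> Poly_Mapping.lookup"
abbreviation "keys \<equiv> Poly_Mapping.keys"
abbreviation "single \<equiv> Poly_Mapping.single"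

lemma keys_nat_add: "keys (a + b) = keys a \<union> keys (b :: 'v \<Rightarrow>\<^sub>0 nat)"
  by (auto simp: in_keys_iff lookup_add)

lemma Const_simps:
  "Const 0 = 0" "Const 1 = 1" "Const (a + b) = Const a + Const b" "Const (a * b) = Const a * Const b"
  by (simp_all add: Const_def single_add mult_single)

lemma single_mult_Const: "single m c = Const c * single m (1 :: 'k::comm_ring_1)"
  by (simp add: Const_def mult_single)

lemma sum_monomials: "(\<Sum>m\<in>keys p. single m (lookup p m)) = p"
proof (rule poly_mapping_eqI)
  fix n
  have "lookup (\<Sum>m\<in>keys p. single m (lookup p m)) n = (\<Sum>m\<in>keys p. if m = n then lookup p m else 0)"
    by (simp add: lookup_sum lookup_single when_def)
  also have "\<dots> = lookup p n" by (simp add: in_keys_iff)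
  finally show "lookup (\<Sum>m\<in>keys p. single m (lookup p m)) n = lookup p n" .
qed

lemma power_single: "(single a (1::'k::comm_ring_1)) ^ n = single (\<Sum>i<n. a) 1"
  by (induction n) (auto simp: mult_single add.commute)

lemma prod_single: "(\<Prod>i\<in>I. single (f i) (1::'k::comm_ring_1)) = single (\<Sum>i\<in>I. f i) 1"
  by (induction I rule: infinite_finite_induct) (auto simp: mult_single)

lemma sum_single_nat: "(\<Sum>i<n. single v (1::nat)) = single v n"
  by (induction n) (simp_all add: single_add[symmetric])

lemma Var_power: "(Var v :: ('v, 'k::comm_ring_1) mpoly) ^ n = single (single v n) 1"
  by (simp add: Var_def power_single sum_single_nat del: One_nat_def)

lemma monomial_eq: "single m (1::'k::comm_ring_1) = (\<Prod>v\<in>keys m. Var v ^ lookup m v)"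
  by (simp add: Var_power prod_single sum_monomials)

section \<open>Polynomial rings on sets of variables and their Noetherian property\<close>

lemma subring_poly_ring: "subring (poly_ring W :: ('v, 'k::comm_ring_1) mpoly set)"
proof -
  have "a * b \<in> poly_ring W" if "a \<in> poly_ring W" "b \<in> poly_ring W" for a b :: "('v, 'k) mpoly"
    unfolding poly_ring_def
  proof (intro CollectI ballI)
    fix k assume "k \<in> keys (a * b)"
    then obtain i j where "k = i + j" "i \<in> keys a" "j \<in> keys b" using keys_mult[of a b] by blast
    then show "keys k \<subseteq> W" using that unfolding poly_ring_def by (simp add: keys_nat_add)
  qed
  moreover have "a + b \<in> poly_ring W" if "a \<in> poly_ring W" "b \<in> poly_ring W" for a b :: "('v, 'k) mpoly"
    using that keys_add[of a b] unfolding poly_ring_def by blast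
  moreover have "- a \<in> poly_ring W" if "a \<in> poly_ring W" for a :: "('v, 'k) mpoly"
    using that by (auto simp: poly_ring_def in_keys_iff)
  moreover have "0 \<in> (poly_ring W :: ('v, 'k) mpoly set)" "1 \<in> (poly_ring W :: ('v, 'k) mpoly set)"
    by (auto simp: poly_ring_def)
  ultimately show ?thesis unfolding subring_def by blast
qed

lemma single_in_poly_ring: "keys m \<subseteq> W \<Longrightarrow> single m c \<in> poly_ring W"
  by (auto simp: poly_ring_def)

lemma Const_in_poly_ring: "Const c \<in> poly_ring W"
  unfolding Const_def by (rule single_in_poly_ring) simp

lemma Var_in_poly_ring: "v \<in> W \<Longrightarrow> Var v \<in> poly_ring W"
  unfolding Var_def by (rule single_in_poly_ring) simp

lemma poly_ring_induct [consumes 1, case_names Const Var add mult]: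
  fixes p :: "('v, 'k::comm_ring_1) mpoly"
  assumes p: "p \<in> poly_ring W" and C: "\<And>c. P (Const c)" and V: "\<And>v. v \<in> W \<Longrightarrow> P (Var v)"
    and add: "\<And>p q. p \<in> poly_ring W \<Longrightarrow> q \<in> poly_ring W \<Longrightarrow> P p \<Longrightarrow> P q \<Longrightarrow> P (p + q)"
    and mult: "\<And>p q. p \<in> poly_ring W \<Longrightarrow> q \<in> poly_ring W \<Longrightarrow> P p \<Longrightarrow> P q \<Longrightarrow> P (p * q)"
  shows "P p"
proof -
  let ?Q = "\<lambda>p. p \<in> poly_ring W \<and> P p"
  have "subring (poly_ring W :: ('v, 'k) mpoly set)" by (rule subring_poly_ring)
  note R = subringD[OF this]
  have Q0: "?Q 0" and Q1: "?Q 1" using C[of 0] C[of 1] R by (auto simp: Const_simps)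
  have sm: "?Q (sum f A)" if "\<And>i. i \<in> A \<Longrightarrow> ?Q (f i)" for f :: "_ \<Rightarrow> ('v, 'k) mpoly" and A
    using that by (induction A rule: infinite_finite_induct) (use Q0 add R in auto)
  have pr: "?Q (prod f A)" if "\<And>i. i \<in> A \<Longrightarrow> ?Q (f i)" for f :: "'v \<Rightarrow> ('v, 'k) mpoly" and A
    using that by (induction A rule: infinite_finite_induct) (use Q1 mult R in auto)
  have pw: "?Q (q ^ n)" if "?Q q" for q n
    using that by (induction n) (use Q1 mult R in auto)
  have "?Q (single m (lookup p m))" if "m \<in> keys p" for m
  proof -
    have "keys m \<subseteq> W" using that p by (auto simp: poly_ring_def)
    then have 1: "?Q (\<Prod>v\<in>keys m. Var v ^ lookup m v)"
    proof (intro pr pw)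
      fix v assume "v \<in> keys m"
      then have "v \<in> W" using \<open>keys m \<subseteq> W\<close> by blast
      then show "?Q (Var v)" using V Var_in_poly_ring by simp
    qed
    have 2: "?Q (Const (lookup p m))" using C Const_in_poly_ring by blast
    have "?Q (Const (lookup p m) * (\<Prod>v\<in>keys m. Var v ^ lookup m v))"
      using mult[OF conjunct1[OF 2] conjunct1[OF 1] conjunct2[OF 2] conjunct2[OF 1]]
        R(4)[OF conjunct1[OF 2] conjunct1[OF 1]] by (rule conjI[rotated])
    then show ?thesis unfolding single_mult_Const[of m "lookup p m"] monomial_eq .
  qed
  then have "?Q (\<Sum>m\<in>keys p. single m (lookup p m))" by (rule sm)
  then show ?thesis by (simp add: sum_monomials)
qed

text \<open>Variables are adjoined one at a time. With no variables the ring consists of constants,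
  and a nonzero ideal contains a unit.\<close>

lemma noeth_poly_ring:
  assumes "finite W"
  shows "noeth (poly_ring W :: ('v, 'k::field) mpoly set)"
  using assms
proof (induction W rule: finite_induct)
  case empty
  show ?case unfolding noeth_def
  proof (intro allI impI)
    fix J :: "('v, 'k) mpoly set" assume J: "idealof (poly_ring {}) J"
    note R = subring_poly_ring[of "{}"]
    note D = idealofD[OF R J]
    have const: "p = Const (lookup p 0)" if "p \<in> poly_ring {}" for p :: "('v, 'k) mpoly"
    proof (rule poly_mapping_eqI)
      fix k show "lookup p k = lookup (Const (lookup p 0)) k"
        using that by (cases "k \<in> keys p") (auto simp: poly_ring_def Const_def lookup_single when_def not_in_keys_iff_lookup_eq_zero)
    qed
    show "\<exists>S. finite S \<and> S \<subseteq> J \<and> J = ideal_gen (poly_ring {}) S"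
    proof (cases "J = {0}")
      case True
      then have "J = ideal_gen (poly_ring {}) J" using ideal_gen_ideal[OF R J] by simp
      then show ?thesis using True by blast
    next
      case False
      then obtain p where p: "p \<in> J" "p \<noteq> 0" using D(2) by blast
      define c where "c = lookup p 0"
      have pc: "p = Const c" using const D(1)[OF p(1)] by (simp add: c_def)
      then have c: "c \<noteq> 0" using p(2) by (auto simp: Const_simps)
      have "J \<subseteq> ideal_gen (poly_ring {}) {p}"
      proof
        fix q assume "q \<in> J"
        then have q: "q \<in> poly_ring {}" by (rule D(1))
        have "Const (inverse c) * p = 1" unfolding pc using c by (simp flip: Const_simps(2,4))
        then have "q = (q * Const (inverse c)) * p" by (simp add: mult.assoc)
        moreover have "q * Const (inverse c) \<in> poly_ring {}"
          using subringD(4)[OF R] q Const_in_poly_ring by blast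
        ultimately show "q \<in> ideal_gen (poly_ring {}) {p}"
          unfolding ideal_gen_def
          by (intro CollectI exI[of _ "{p}"] exI[of _ "\<lambda>_. q * Const (inverse c)"]) auto
      qed
      then show ?thesis using ideal_gen_least[OF J, of "{p}"] p(1) by (intro exI[of _ "{p}"]) auto
    qed
  qed
next
  case (insert x W)
  let ?A = "poly_ring W :: ('v, 'k) mpoly set" and ?B = "poly_ring (insert x W) :: ('v, 'k) mpoly set"
  interpret adjoin ?A ?B "Var x"
    using subring_poly_ring Var_in_poly_ring[of x "insert x W"]
    by unfold_locales (auto simp: poly_ring_def)
  show ?case
  proof (rule noeth_adjoin[OF insert.IH])
    have mon: "\<exists>n. single m c \<in> pol n" if "keys m \<subseteq> insert x W" for m and c :: 'k
    proof -
      \<comment> \<open>Splitting off the full power of \<open>x\<close> leaves a monomial over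
        \<open>W\<close>, the coefficient in the adjoined variable.\<close>
      define m' where "m' = m - single x (lookup m x)"
      have m: "m = m' + single x (lookup m x)"
        by (rule poly_mapping_eqI) (auto simp: m'_def lookup_add lookup_minus lookup_single when_def)
      have "keys m' \<subseteq> W"
        using that by (auto simp: m'_def lookup_minus lookup_single when_def subset_iff in_keys_iff
          split: if_splits)
      then have "single m' c \<in> ?A" by (rule single_in_poly_ring)
      moreover have "single m c = single m' c * Var x ^ lookup m x + 0"
        by (subst m) (simp add: Var_power mult_single)
      ultimately have "single m c \<in> pol (Suc (lookup m x))" by (intro pol_SucI[OF _ pol_0])
      then show ?thesis by blast
    qed
    fix b :: "('v, 'k) mpoly" assume b: "b \<in> ?B"
    have "\<exists>n. (\<Sum>m\<in>M. single m (lookup b m)) \<in> pol n" if "M \<subseteq> keys b" for M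
    proof -
      have "finite M" by (rule finite_subset[OF that finite_keys])
      then show ?thesis using that
      proof (induction M rule: finite_induct)
        case empty show ?case by (auto intro!: exI[of _ 0])
      next
        case (insert m M)
        have "keys m \<subseteq> insert x W" using insert.prems b by (auto simp: poly_ring_def)
        then obtain k where k: "single m (lookup b m) \<in> pol k" using mon by blast
        obtain l where l: "(\<Sum>m\<in>M. single m (lookup b m)) \<in> pol l" using insert by auto
        have "single m (lookup b m) \<in> pol (max k l)"
          "(\<Sum>m\<in>M. single m (lookup b m)) \<in> pol (max k l)"
          using k l pol_mono[of k "max k l"] pol_mono[of l "max k l"] by auto
        then have "single m (lookup b m) + (\<Sum>m\<in>M. single m (lookup b m)) \<in> pol (max k l)" by (rule pol_add)
        then show ?case using insert by auto
      qed
    qed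
    from this[OF order_refl] show "\<exists>n. b \<in> pol n" by (simp add: sum_monomials)
  qed
qed

lemma koszul_poly_ring:
  assumes "idealof (poly_ring W) m"
  shows "koszul (poly_ring W) m (Const :: 'k::field \<Rightarrow> ('v, 'k) mpoly)"
  by unfold_locales (auto intro: assms subring_poly_ring Const_in_poly_ring simp: Const_simps)

section \<open>Substitution\<close>

definition mon_eval :: "('v \<Rightarrow> ('v, 'k::comm_ring_1) mpoly) \<Rightarrow> ('v \<Rightarrow>\<^sub>0 nat) \<Rightarrow> ('v, 'k) mpoly" where
  "mon_eval g m = (\<Prod>v\<in>keys m. g v ^ lookup m v)"

definition subst :: "('v \<Rightarrow> ('v, 'k::comm_ring_1) mpoly) \<Rightarrow> ('v, 'k) mpoly \<Rightarrow> ('v, 'k) mpoly" where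
  "subst g p = (\<Sum>m\<in>keys p. Const (lookup p m) * mon_eval g m)"

lemma mon_eval_superset: "finite A \<Longrightarrow> keys m \<subseteq> A \<Longrightarrow> mon_eval g m = (\<Prod>v\<in>A. g v ^ lookup m v)"
  unfolding mon_eval_def by (intro prod.mono_neutral_left) (auto simp: in_keys_iff)

lemma mon_eval_add: "mon_eval g (a + b) = mon_eval g a * mon_eval g b"
proof -
  have "mon_eval g (a + b) = (\<Prod>v\<in>keys a \<union> keys b. g v ^ lookup (a + b) v)"
    by (intro mon_eval_superset) (auto simp: keys_nat_add)
  also have "\<dots> = (\<Prod>v\<in>keys a \<union> keys b. g v ^ lookup a v) * (\<Prod>v\<in>keys a \<union> keys b. g v ^ lookup b v)"
    by (simp add: lookup_add power_add prod.distrib)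
  also have "\<dots> = mon_eval g a * mon_eval g b"
    by (simp add: mon_eval_superset[of "keys a \<union> keys b"])
  finally show ?thesis .
qed

lemma subst_superset:
  "finite A \<Longrightarrow> keys p \<subseteq> A \<Longrightarrow> subst g p = (\<Sum>m\<in>A. Const (lookup p m) * mon_eval g m)"
  unfolding subst_def by (intro sum.mono_neutral_left) (auto simp: in_keys_iff Const_simps)

lemma subst_add: "subst g (p + q) = subst g p + subst g q"
proof -
  let ?A = "keys p \<union> keys q"
  have "subst g (p + q) = (\<Sum>m\<in>?A. Const (lookup (p + q) m) * mon_eval g m)"
    using keys_add[of p q] by (intro subst_superset) auto
  then show ?thesis
    by (simp add: subst_superset[of ?A] lookup_add Const_simps distrib_right sum.distrib)
qed

lemma subst_0: "subst g 0 = 0"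
  by (simp add: subst_def)

lemma subst_sum: "subst g (\<Sum>i\<in>A. f i) = (\<Sum>i\<in>A. subst g (f i))"
  by (induction A rule: infinite_finite_induct) (auto simp: subst_add subst_0)

lemma subst_single: "subst g (single m c) = Const c * mon_eval g m"
  by (subst subst_superset[of "{m}"]) auto

lemma subst_mult: "subst g (p * q) = subst g p * subst g q"
proof -
  have "subst g (p * q) = subst g ((\<Sum>a\<in>keys p. single a (lookup p a)) * (\<Sum>b\<in>keys q. single b (lookup q b)))"
    by (simp add: sum_monomials)
  also have "\<dots> = (\<Sum>a\<in>keys p. \<Sum>b\<in>keys q. subst g (single (a + b) (lookup p a * lookup q b)))"
    by (simp add: sum_product subst_sum mult_single)
  also have "\<dots> = (\<Sum>a\<in>keys p. \<Sum>b\<in>keys q.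
      (Const (lookup p a) * mon_eval g a) * (Const (lookup q b) * mon_eval g b))"
    by (simp add: subst_single Const_simps mon_eval_add mult_ac)
  also have "\<dots> = subst g p * subst g q" by (simp add: subst_def sum_product)
  finally show ?thesis .
qed

lemma subst_Const: "subst g (Const c) = Const c"
  by (simp add: Const_def subst_single mon_eval_def)

lemma subst_Var: "subst g (Var v) = g v"
  by (simp add: Var_def subst_single mon_eval_def Const_simps)

lemma subst_1: "subst g 1 = 1"
  using subst_Const[of g 1] by (simp add: Const_simps)

lemma subst_diff: "subst g (p - q) = subst g p - subst g q"
  using subst_add[of g "p - q" q] by (simp add: algebra_simps)

lemma subst_prod: "subst g (\<Prod>i\<in>A. f i) = (\<Prod>i\<in>A. subst g (f i))"
  by (induction A rule: infinite_finite_induct) (auto simp: subst_mult subst_1)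

lemma subst_in_poly_ring:
  assumes "p \<in> poly_ring W" "\<And>v. v \<in> W \<Longrightarrow> g v \<in> poly_ring W'"
  shows "subst g p \<in> poly_ring W'"
  using assms(1)
  by (induction rule: poly_ring_induct)
    (auto simp: subst_Const subst_Var subst_add subst_mult Const_in_poly_ring assms(2)
      intro: subringD[OF subring_poly_ring])

lemma subst_id:
  assumes "p \<in> poly_ring W" "\<And>v. v \<in> W \<Longrightarrow> g v = Var v"
  shows "subst g p = p"
  using assms(1)
  by (induction rule: poly_ring_induct) (auto simp: subst_Const subst_Var subst_add subst_mult assms(2))

text \<open>It suffices that variables are congruent to their images. Writing p' and q' for the
  images, products follow from pq - p'q' = p(q - q') + q'(p - p').\<close>

lemma diff_subst_in_ideal:
  assumes J: "idealof (poly_ring W) J" and p: "p \<in> poly_ring W"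
    and g: "\<And>v. v \<in> W \<Longrightarrow> g v \<in> poly_ring W \<and> Var v - g v \<in> J"
  shows "p - subst g p \<in> J"
  using p
proof (induction rule: poly_ring_induct)
  note D = idealofD[OF subring_poly_ring J]
  case (Const c) then show ?case using D by (simp add: subst_Const)
next
  case (Var v) then show ?case using g by (simp add: subst_Var)
next
  note D = idealofD[OF subring_poly_ring J]
  case (add p q)
  then have "(p - subst g p) + (q - subst g q) \<in> J" using D by blast
  then show ?case by (simp add: subst_add algebra_simps)
next
  note D = idealofD[OF subring_poly_ring J]
  case (mult p q)
  have "p * (q - subst g q) \<in> J" "subst g q * (p - subst g p) \<in> J"
    using mult g D(4) subst_in_poly_ring[of q W g W] by simp_all
  then have "p * (q - subst g q) + subst g q * (p - subst g p) \<in> J" using D by blast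
  then show ?case by (simp add: subst_mult algebra_simps)
qed

section \<open>Monomial ideals\<close>

text \<open>The exponents of all monomials divisible by a monomial with exponent in
  \<open>G\<close>.\<close>

definition upset :: "('v \<Rightarrow>\<^sub>0 nat) set \<Rightarrow> ('v \<Rightarrow>\<^sub>0 nat) set" where
  "upset G = {m. \<exists>g\<in>G. \<forall>x. lookup g x \<le> lookup m x}"

lemma upset_add: "m \<in> upset G \<Longrightarrow> h + m \<in> upset G"
  by (fastforce simp: upset_def lookup_add intro: trans_le_add2)

lemma le_diff_split:
  assumes "\<forall>x. lookup g x \<le> lookup (m :: 'v \<Rightarrow>\<^sub>0 nat) x" shows "m = (m - g) + g"
  using assms by (intro poly_mapping_eqI) (simp add: lookup_add lookup_minus)

lemma lookup_single_mult:
  fixes p :: "('v, 'k::comm_ring_1) mpoly"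
  shows "lookup (single k c * p) (k + n) = c * lookup p n"
  by (simp add: lookup_mult lookup_single when_mult)

lemma lookup_single_mult_0:
  fixes p :: "('v, 'k::comm_ring_1) mpoly"
  assumes "\<And>h. n \<noteq> k + h"
  shows "lookup (single k c * p) n = 0"
proof -
  have "n \<notin> keys (single k c * p)" using keys_mult[of "single k c" p] assms by (auto split: if_splits)
  then show ?thesis by (simp add: in_keys_iff)
qed

lemma ideal_gen_monomials:
  fixes G :: "('v \<Rightarrow>\<^sub>0 nat) set"
  assumes G: "\<And>g. g \<in> G \<Longrightarrow> keys g \<subseteq> W"
  shows "ideal_gen (poly_ring W) ((\<lambda>g. single g (1::'k::comm_ring_1)) ` G)
       = {p \<in> poly_ring W. keys p \<subseteq> upset G}" (is "?L = ?RR")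
proof
  note R = subring_poly_ring[of W]
  have sub: "(\<lambda>g. single g (1::'k)) ` G \<subseteq> poly_ring W" using G by (auto intro!: single_in_poly_ring)
  have RR: "idealof (poly_ring W) ?RR"
    unfolding idealof_def
  proof (intro conjI ballI)
    show "a + b \<in> ?RR" if "a \<in> ?RR" "b \<in> ?RR" for a b
      using that keys_add[of a b] subringD(3)[OF R, of a b] by auto
    show "r * a \<in> ?RR" if "r \<in> poly_ring W" "a \<in> ?RR" for r a
    proof -
      have "k \<in> upset G" if k: "k \<in> keys (r * a)" for k
      proof -
        obtain i j where "k = i + j" "j \<in> keys a" using keys_mult[of r a] k by blast
        then show ?thesis using \<open>a \<in> ?RR\<close> upset_add by blast
      qed
      then show ?thesis using that subringD(4)[OF R, of r a] by blast
    qed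
  qed (use subringD[OF R] in auto)
  show "?L \<subseteq> ?RR"
    using sub by (intro ideal_gen_least[OF RR]) (auto simp: upset_def)
  show "?RR \<subseteq> ?L"
  proof
    fix p assume p: "p \<in> ?RR"
    note I = idealof_ideal_gen[OF R sub]
    have "single m (lookup p m) \<in> ?L" if m: "m \<in> keys p" for m
    proof -
      obtain g where g: "g \<in> G" "\<forall>x. lookup g x \<le> lookup m x" using m p by (auto simp: upset_def)
      have eq: "m = (m - g) + g" using le_diff_split[OF g(2)] .
      have "keys m \<subseteq> W" using m p by (auto simp: poly_ring_def)
      then have "keys (m - g) \<subseteq> W" by (auto simp: in_keys_iff lookup_minus)
      then have "single (m - g) (lookup p m) \<in> poly_ring W" by (rule single_in_poly_ring)
      moreover have "single g 1 \<in> ?L" using g(1) by (intro subsetD[OF ideal_gen_superset[OF R]]) simp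
      ultimately have "single (m - g) (lookup p m) * single g 1 \<in> ?L" by (rule idealofD(4)[OF R I])
      then show ?thesis using eq by (simp add: mult_single)
    qed
    then have "(\<Sum>m\<in>keys p. single m (lookup p m)) \<in> ?L" by (intro idealof_sum[OF I])
    then show "p \<in> ?L" by (simp add: sum_monomials)
  qed
qed

text \<open>The coefficients of \<open>p\<close> outside \<open>upset G\<close> are constant along the moves that trade an \<open>x\<close>
  for a \<open>y\<close>; following these moves in one direction leads to a monomial in which the other
  direction cannot be blocked, hence to a contradiction.\<close>

lemma nzd_diff_monomial:
  fixes p :: "('v, 'k::comm_ring_1) mpoly"
  assumes xy: "x \<noteq> y"
    and G: "\<And>g g'. g \<in> G \<Longrightarrow> g' \<in> G \<Longrightarrow> lookup g' y > 0 \<Longrightarrow> lookup g x \<le> lookup g' x"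
    and p: "keys ((Var x - Var y) * p) \<subseteq> upset G"
  shows "keys p \<subseteq> upset G"
proof (rule ccontr)
  let ?x = "single x (1::nat)" and ?y = "single y (1::nat)"
  have split: "\<exists>h. m = single z 1 + h" if "lookup m z > 0" for m :: "'v \<Rightarrow>\<^sub>0 nat" and z
  proof -
    have "\<forall>t. lookup (single z 1) t \<le> lookup m t" using that by (auto simp: lookup_single when_def)
    from le_diff_split[OF this] show ?thesis by (metis add.commute)
  qed
  have co: "lookup (Var x * p) n = lookup (Var y * p) n" if "n \<notin> upset G" for n
  proof -
    have "lookup ((Var x - Var y) * p) n = 0" using p that by (auto simp: in_keys_iff)
    then show ?thesis by (simp add: left_diff_distrib lookup_minus)
  qed
  \<comment> \<open>The coefficient of the product at \<open>single a 1 + m\<close> vanishes, so the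
    contributions of \<open>Var x\<close> and \<open>Var y\<close> there agree; a nonzero
    coefficient of \<open>p\<close> at \<open>m\<close> forces one after trading a \<open>b\<close>
    for an \<open>a\<close>.\<close>
  have move: "\<exists>h. m = single b 1 + h \<and> single a 1 + h \<in> keys p"
    if m: "m \<in> keys p" "single a 1 + m \<notin> upset G" and ab: "(a = x \<and> b = y) \<or> (a = y \<and> b = x)" for m a b
  proof -
    have "lookup (Var a * p) (single a 1 + m) = lookup p m"
      by (simp add: Var_def lookup_single_mult)
    moreover have "lookup (Var a * p) (single a 1 + m) = lookup (Var b * p) (single a 1 + m)"
      using co[OF m(2)] ab by auto
    ultimately have nz: "lookup (Var b * p) (single a 1 + m) \<noteq> 0" using m(1) by (simp add: in_keys_iff)
    then obtain h' where h': "single a 1 + m = single b 1 + h'"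
      using lookup_single_mult_0[of "single a 1 + m" "single b 1" 1 p] unfolding Var_def by blast
    have "a \<noteq> b" using ab xy by auto
    then have "lookup m b > 0"
      using arg_cong[OF h', of "\<lambda>t. lookup t b"] by (simp add: lookup_add lookup_single)
    then obtain h where h: "m = single b 1 + h" using split by blast
    have "h' = single a 1 + h" using h' unfolding h by (metis add.left_commute add_left_cancel)
    then have "lookup p (single a 1 + h) \<noteq> 0"
      using nz unfolding h' by (simp add: Var_def lookup_single_mult)
    then show ?thesis using h by (auto simp: in_keys_iff)
  qed
  assume "\<not> keys p \<subseteq> upset G"
  then obtain m0 where m0: "m0 \<in> keys p" "m0 \<notin> upset G" by blast
  \<comment> \<open>Trading \<open>y\<close> for \<open>x\<close> lowers the exponent of
    \<open>y\<close> and must stop, which happens only when one more \<open>x\<close> enters the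
    ideal.\<close>
  have "\<exists>m\<in>keys p. m \<notin> upset G \<and> ?x + m \<in> upset G"
    using m0
  proof (induction "lookup m0 y" arbitrary: m0 rule: less_induct)
    case less
    show ?case
    proof (cases "?x + m0 \<in> upset G")
      case False
      then obtain h where h: "m0 = ?y + h" "?x + h \<in> keys p" using move[of m0 x y] less.prems by blast
      have "?x + h \<notin> upset G" using False upset_add[of "?x + h" G ?y] h by (metis add.left_commute)
      moreover have "lookup (?x + h) y < lookup m0 y" using h xy by (simp add: lookup_add lookup_single when_def)
      ultimately show ?thesis using less.hyps h by blast
    qed (use less.prems in blast)
  qed
  then obtain m where m: "m \<in> keys p" "m \<notin> upset G" "?x + m \<in> upset G" by blast
  obtain g where g: "g \<in> G" "\<forall>z. lookup g z \<le> lookup (?x + m) z" using m(3) by (auto simp: upset_def)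
  have gx: "lookup g x > lookup m x"
  proof (rule ccontr)
    assume a: "\<not> ?thesis"
    have "lookup g z \<le> lookup m z" for z
      using g(2)[rule_format, of z] a by (cases "z = x") (auto simp: lookup_add lookup_single)
    then show False using m(2) g(1) by (auto simp: upset_def)
  qed
  \<comment> \<open>A generator entered by adding powers of \<open>y\<close> involves
    \<open>y\<close>; by hypothesis its exponent at \<open>x\<close> is at least that of
    \<open>g\<close>, which already exceeds the exponent in \<open>m\<close>.\<close>
  have free: "single y t + m \<notin> upset G" for t
  proof
    assume "single y t + m \<in> upset G"
    then obtain g' where g': "g' \<in> G" "\<forall>z. lookup g' z \<le> lookup (single y t + m) z" by (auto simp: upset_def)
    have "lookup g' y > 0"
    proof (rule ccontr)
      assume a: "\<not> ?thesis"
      have "lookup g' z \<le> lookup m z" for z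
        using g'(2)[rule_format, of z] a by (cases "z = y") (auto simp: lookup_add lookup_single)
      then show False using m(2) g'(1) by (auto simp: upset_def)
    qed
    then have "lookup g x \<le> lookup g' x" using G g g' by blast
    also have "\<dots> \<le> lookup m x" using g'(2)[rule_format, of x] xy by (simp add: lookup_add lookup_single when_def)
    finally show False using gx by simp
  qed
  \<comment> \<open>In the opposite direction nothing blocks, so the exponent of \<open>x\<close>
    would decrease forever.\<close>
  have "False" if "n \<in> keys p" "\<And>t. single y t + n \<notin> upset G" for n
    using that
  proof (induction "lookup n x" arbitrary: n rule: less_induct)
    case less
    obtain h where h: "n = ?x + h" "?y + h \<in> keys p"
      using move[of n y x] less.prems(1) less.prems(2)[of 1] by blast
    have "single y t + (?y + h) \<notin> upset G" for t
    proof
      assume "single y t + (?y + h) \<in> upset G"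
      then have "?x + (single y t + (?y + h)) \<in> upset G" by (rule upset_add)
      moreover have "?x + (single y t + (?y + h)) = single y (Suc t) + n"
      proof -
        have "single y (Suc t) = single y t + ?y" by (simp add: single_add[symmetric])
        then show ?thesis unfolding h(1) by (simp only: add_ac)
      qed
      ultimately show False using less.prems(2)[of "Suc t"] by metis
    qed
    moreover have "lookup (?y + h) x < lookup n x" using h xy by (simp add: lookup_add lookup_single when_def)
    ultimately show False using less.hyps h(2) by blast
  qed
  then show False using m(1) free by blast
qed

section \<open>Socles of monomial ideals attached to blocks and transversals\<close>

text \<open>Gaussian elimination by induction on the equations: a nonzero entry of equation
  \<open>x\<close> serves as pivot and removes one unknown. It supplies the upper bound on the
  dimension of the socle.\<close>

lemma homogeneous_system_nontrivial:
  fixes a :: "'f \<Rightarrow> 'm \<Rightarrow> 'k::field"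
  assumes "finite M" "finite F" "card M < card F"
  shows "\<exists>c. (\<exists>f\<in>F. c f \<noteq> 0) \<and> (\<forall>m\<in>M. (\<Sum>f\<in>F. c f * a f m) = 0)"
  using assms
proof (induction M arbitrary: F a rule: finite_induct)
  case empty
  then obtain f where "f \<in> F" by fastforce
  then show ?case by (intro exI[of _ "\<lambda>_. 1"]) auto
next
  case (insert x M)
  show ?case
  proof (cases "\<forall>f\<in>F. a f x = 0")
    case True
    obtain c where "\<exists>f\<in>F. c f \<noteq> 0" "\<forall>m\<in>M. (\<Sum>f\<in>F. c f * a f m) = 0"
      using insert.IH[of F a] insert.prems insert.hyps by auto
    then show ?thesis using True by (intro exI[of _ c]) auto
  next
    case False
    then obtain f0 where f0: "f0 \<in> F" "a f0 x \<noteq> 0" by blast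
    define b where "b f m = a f m - a f x / a f0 x * a f0 m" for f m
    have "card M < card (F - {f0})" using insert f0 by simp
    then obtain c where c: "\<exists>f\<in>F - {f0}. c f \<noteq> 0" "\<forall>m\<in>M. (\<Sum>f\<in>F - {f0}. c f * b f m) = 0"
      using insert.IH[of "F - {f0}" b] insert.prems by auto
    define s where "s = (\<Sum>f\<in>F - {f0}. c f * (a f x / a f0 x))"
    define d where "d f = (if f = f0 then - s else c f)" for f
    have sum: "(\<Sum>f\<in>F. d f * a f m) = (\<Sum>f\<in>F - {f0}. c f * a f m) - s * a f0 m" for m
      using insert.prems f0 by (subst sum.remove[of F f0]) (auto simp: d_def intro!: sum.cong)
    have "(\<Sum>f\<in>F. d f * a f m) = (\<Sum>f\<in>F - {f0}. c f * b f m)" for m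
      unfolding sum by (simp add: s_def b_def sum_distrib_right sum_distrib_left right_diff_distrib sum_subtractf mult_ac)
    moreover have "b f x = 0" for f using f0 by (simp add: b_def)
    ultimately have "\<forall>m\<in>insert x M. (\<Sum>f\<in>F. d f * a f m) = 0" using c(2) by simp
    moreover have "\<exists>f\<in>F. d f \<noteq> 0" using c(1) by (auto simp: d_def)
    ultimately show ?thesis by blast
  qed
qed

definition min_transversal :: "'v set set \<Rightarrow> 'v set \<Rightarrow> bool" where
  "min_transversal NN D \<longleftrightarrow> (\<forall>N\<in>NN. N \<inter> D \<noteq> {}) \<and> (\<forall>D'. D' \<subset> D \<longrightarrow> (\<exists>N\<in>NN. N \<inter> D' = {}))"

text \<open>\<open>W\<close> are the even vertices, \<open>I0\<close> the isolated ones, \<open>\<rho>\<close> maps a vertex to the representative of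
  its block (the neighbourhood of a height-1 vertex), and \<open>NN\<close> are the neighbourhoods of the height-3
  vertices. The dummy \<open>ty\<close> fixes the coefficient field.\<close>

locale blocks =
  fixes W I0 :: "'v set" and \<rho> :: "'v \<Rightarrow> 'v" and NN :: "'v set set" and ty :: "'k::field itself"
  assumes fin: "finite W" and I0: "I0 \<subseteq> W"
    and rho_in: "l \<in> W - I0 \<Longrightarrow> \<rho> l \<in> W - I0"
    and rho_rho: "l \<in> W - I0 \<Longrightarrow> \<rho> (\<rho> l) = \<rho> l"
    and two: "r \<in> W - I0 \<Longrightarrow> \<rho> r = r \<Longrightarrow> \<exists>l\<in>W - I0. \<rho> l = r \<and> l \<noteq> r"
    and NN: "N \<in> NN \<Longrightarrow> N \<noteq> {} \<and> N \<subseteq> {l \<in> W - I0. \<rho> l = l}"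
begin

abbreviation "RR \<equiv> poly_ring W :: ('v, 'k) mpoly set"
definition "reps = {l \<in> W - I0. \<rho> l = l}"
definition "block r = {l \<in> W - I0. \<rho> l = r}"
definition "edges = block ` reps \<union> NN"
definition "II = ideal_gen RR (monomial_of_set ` edges)"
definition "mm = ideal_gen RR (Var ` W)"
text \<open>The vertices to be eliminated: isolated ones and non-representatives. They index the
  elements of \<open>Z\<close>.\<close>

definition "kill = W - reps"
definition zvar :: "'v \<Rightarrow> ('v, 'k) mpoly" where
  "zvar l = (if l \<in> I0 then Var l else Var (\<rho> l) - Var l)"
text \<open>Solves the equations \<open>zvar l = 0\<close>, for \<open>l\<close> in
  \<open>L\<close>, for the variables in \<open>L\<close>.\<close>

definition sub :: "'v set \<Rightarrow> 'v \<Rightarrow> ('v, 'k) mpoly" where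
  "sub L v = (if v \<in> L then if v \<in> I0 then 0 else Var (\<rho> v) else Var v)"
definition ren :: "'v set \<Rightarrow> 'v \<Rightarrow> 'v" where
  "ren L v = (if v \<in> L then \<rho> v else v)"
text \<open>The exponent of the image of X_U under \<open>sub L\<close>; multiplicities record how
  many vertices of \<open>U\<close> are sent to the same representative.\<close>

definition img :: "'v set \<Rightarrow> 'v set \<Rightarrow> 'v \<Rightarrow>\<^sub>0 nat" where
  "img L U = (\<Sum>u\<in>U. single (ren L u) 1)"
definition "gens L = img L ` edges"
definition "JJ L = ideal_gen RR (II \<union> zvar ` L)"

lemma RR: "subring RR" by (rule subring_poly_ring)

lemma reps_sub: "reps \<subseteq> W - I0" by (auto simp: reps_def)

lemma rho_reps: "l \<in> W - I0 \<Longrightarrow> \<rho> l \<in> reps"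
  using rho_in rho_rho by (auto simp: reps_def)

lemma edge_sub: "U \<in> edges \<Longrightarrow> U \<subseteq> W - I0 \<and> U \<noteq> {}"
  using NN by (auto simp: edges_def block_def reps_def)

lemma edge_finite: "U \<in> edges \<Longrightarrow> finite U"
  using edge_sub fin finite_subset by (metis Diff_subset subset_trans)

lemma Var_in: "v \<in> W \<Longrightarrow> Var v \<in> RR" by (rule Var_in_poly_ring)

lemma monomial_in: "U \<in> edges \<Longrightarrow> monomial_of_set U \<in> RR"
  using edge_sub unfolding monomial_of_set_def by (intro subring_prod[OF RR] Var_in) blast

lemma II_ideal: "idealof RR II"
  unfolding II_def using monomial_in by (intro idealof_ideal_gen[OF RR]) blast

lemma mm_ideal: "idealof RR mm"
  unfolding mm_def using Var_in by (intro idealof_ideal_gen[OF RR]) blast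

lemma Var_mm: "v \<in> W \<Longrightarrow> Var v \<in> mm"
  unfolding mm_def by (intro subsetD[OF ideal_gen_superset[OF RR]]) simp

lemma zvar_in: "l \<in> W \<Longrightarrow> zvar l \<in> RR"
  using Var_in rho_in[of l] subringD(6)[OF RR] by (auto simp: zvar_def)

lemma zvar_mm: "l \<in> W \<Longrightarrow> zvar l \<in> mm"
  using Var_mm rho_in[of l] idealofD(7)[OF RR mm_ideal] by (auto simp: zvar_def)

lemma II_mm: "II \<subseteq> mm"
  unfolding II_def
proof (rule ideal_gen_least[OF mm_ideal], rule subsetI)
  fix p :: "('v, 'k) mpoly" assume "p \<in> monomial_of_set ` edges"
  then obtain U where U: "U \<in> edges" "p = monomial_of_set U" by blast
  then obtain u where u: "u \<in> U" "u \<in> W" using edge_sub by blast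
  have "p = Var u * (\<Prod>u\<in>U - {u}. Var u)"
    unfolding U(2) monomial_of_set_def by (rule prod.remove[OF edge_finite[OF U(1)] u(1)])
  moreover have "(\<Prod>u\<in>U - {u}. Var u) \<in> RR"
    using edge_sub[OF U(1)] Var_in by (intro subring_prod[OF RR]) auto
  ultimately show "p \<in> mm" using idealofD(5)[OF RR mm_ideal] Var_mm[OF u(2)] by simp
qed

lemma one_mm: "1 \<notin> mm"
proof
  have "mm = ideal_gen RR ((\<lambda>g. single g 1) ` (\<lambda>v. single v 1) ` W)"
    unfolding mm_def Var_def by (simp add: image_image)
  also have "\<dots> = {p \<in> RR. keys p \<subseteq> upset ((\<lambda>v. single v 1) ` W)}"
    by (rule ideal_gen_monomials) auto
  finally have eq: "mm = {p \<in> RR. keys p \<subseteq> upset ((\<lambda>v. single v 1) ` W)}" .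
  assume "1 \<in> mm"
  then have "0 \<in> upset ((\<lambda>v. single v (1::nat)) ` W)" unfolding eq by simp
  then obtain v :: 'v where "\<forall>x. lookup (single v (1::nat)) x \<le> lookup 0 x"
    unfolding upset_def by (auto simp del: One_nat_def lookup_zero)
  from this[rule_format, of v] show False by simp
qed

lemma JJ_ideal: "L \<subseteq> W \<Longrightarrow> idealof RR (JJ L)"
  unfolding JJ_def using zvar_in II_ideal by (intro idealof_ideal_gen[OF RR]) (auto simp: idealof_def)

lemma sub_in: "v \<in> W \<Longrightarrow> sub L v \<in> RR"
  using Var_in rho_in[of v] subringD(1)[OF RR] by (auto simp: sub_def)

lemma lookup_img: "finite U \<Longrightarrow> lookup (img L U) x = card {u \<in> U. ren L u = x}"
proof -
  assume U: "finite U"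
  have "lookup (img L U) x = (\<Sum>u\<in>U. if ren L u = x then 1 else 0)"
    by (simp add: img_def lookup_sum lookup_single when_def del: One_nat_def)
  also have "\<dots> = card {u \<in> U. ren L u = x}"
    using U by (simp add: sum.If_cases Int_def)
  finally show ?thesis .
qed

lemma ren_in: "v \<in> W - I0 \<Longrightarrow> ren L v \<in> W - I0"
  using rho_in by (auto simp: ren_def)

lemma keys_gens: "g \<in> gens L \<Longrightarrow> keys g \<subseteq> W - I0"
proof
  fix x assume "g \<in> gens L" "x \<in> keys g"
  then obtain U where U: "U \<in> edges" "lookup (img L U) x \<noteq> 0" by (auto simp: gens_def in_keys_iff)
  then have "{u \<in> U. ren L u = x} \<noteq> {}" unfolding lookup_img[OF edge_finite[OF U(1)]] by force
  then show "x \<in> W - I0" using edge_sub[OF U(1)] ren_in by blast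
qed

lemma subst_monomial:
  assumes U: "U \<in> edges"
  shows "subst (sub L) (monomial_of_set U) = single (img L U) 1"
proof -
  have "subst (sub L) (monomial_of_set U) = (\<Prod>u\<in>U. sub L u)"
    by (simp add: monomial_of_set_def subst_prod subst_Var)
  also have "\<dots> = (\<Prod>u\<in>U. single (single (ren L u) 1) 1)"
    using edge_sub[OF U] by (intro prod.cong) (auto simp: sub_def ren_def Var_def)
  finally show ?thesis by (simp add: prod_single img_def)
qed

lemma rho_kill: "l \<in> kill \<Longrightarrow> l \<notin> I0 \<Longrightarrow> \<rho> l \<noteq> l \<and> \<rho> l \<in> reps"
  using rho_reps[of l] by (auto simp: kill_def reps_def)

text \<open>Modulo the linear forms \<open>zvar l\<close>, \<open>l \<in> L\<close>, the variables in \<open>L\<close> can be eliminated, and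
  the ideal remains monomial.\<close>

lemma in_JJ_iff:
  assumes L: "L \<subseteq> kill" and f: "f \<in> RR"
  shows "f \<in> JJ L \<longleftrightarrow> keys (subst (sub L) f) \<subseteq> upset (gens L)"
proof -
  let ?s = "subst (sub L)"
  let ?M = "{p \<in> RR. keys p \<subseteq> upset (gens L)}"
  have LW: "L \<subseteq> W" using L by (auto simp: kill_def)
  note J = JJ_ideal[OF LW] and D = idealofD[OF RR JJ_ideal[OF LW]]
  have M: "ideal_gen RR ((\<lambda>g. single g 1) ` gens L) = ?M"
    by (rule ideal_gen_monomials) (use keys_gens in blast)
  have Gsub: "(\<lambda>g. single g 1) ` gens L \<subseteq> RR" using keys_gens by (fastforce intro!: single_in_poly_ring)
  have "idealof RR ?M" using idealof_ideal_gen[OF RR Gsub] unfolding M .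
  note MD = idealofD[OF RR this]
  have gM: "single g 1 \<in> ?M" if "g \<in> gens L" for g
    unfolding M[symmetric] using that by (intro subsetD[OF ideal_gen_superset[OF RR]]) simp
  have s_in: "?s p \<in> RR" if "p \<in> RR" for p using that sub_in by (rule subst_in_poly_ring)
  have gen: "II \<union> zvar ` L \<subseteq> JJ L" unfolding JJ_def by (rule ideal_gen_superset[OF RR])
  have mono: "monomial_of_set U \<in> JJ L" if "U \<in> edges" for U
  proof -
    have "monomial_of_set U \<in> II" unfolding II_def
      using that by (intro subsetD[OF ideal_gen_superset[OF RR]]) simp
    then show ?thesis using gen by blast
  qed
  have diff: "p - ?s p \<in> JJ L" if p: "p \<in> RR" for p
  proof (rule diff_subst_in_ideal[OF J p], intro conjI)
    fix v assume v: "v \<in> W"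
    show "sub L v \<in> RR" by (rule sub_in[OF v])
    show "Var v - sub L v \<in> JJ L"
    proof (cases "v \<in> L")
      case True
      then have z: "zvar v \<in> JJ L" using gen by blast
      show ?thesis
      proof (cases "v \<in> I0")
        case True then show ?thesis using z \<open>v \<in> L\<close> by (simp add: sub_def zvar_def)
      next
        case False then show ?thesis using D(6)[OF z] \<open>v \<in> L\<close> by (simp add: sub_def zvar_def)
      qed
    next
      case False then show ?thesis using D(2) by (simp add: sub_def)
    qed
  qed
  show ?thesis
  proof
    have "idealof RR {p \<in> RR. ?s p \<in> ?M}"
      unfolding idealof_def
    proof (intro conjI ballI)
      show "0 \<in> {p \<in> RR. ?s p \<in> ?M}" using MD(2) subringD(1)[OF RR] by (simp add: subst_0)
      show "a + b \<in> {p \<in> RR. ?s p \<in> ?M}" if "a \<in> {p \<in> RR. ?s p \<in> ?M}" "b \<in> {p \<in> RR. ?s p \<in> ?M}" for a b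
      proof -
        have "?s a + ?s b \<in> ?M" using that by (intro MD(3)) auto
        then show ?thesis using that subringD(3)[OF RR] by (simp add: subst_add)
      qed
      show "r * a \<in> {p \<in> RR. ?s p \<in> ?M}" if "r \<in> RR" "a \<in> {p \<in> RR. ?s p \<in> ?M}" for r a
      proof -
        have "?s r * ?s a \<in> ?M" using that s_in by (intro MD(4)) auto
        then show ?thesis using that subringD(4)[OF RR] by (simp add: subst_mult)
      qed
    qed auto
    moreover have "II \<union> zvar ` L \<subseteq> {p \<in> RR. ?s p \<in> ?M}"
    proof (rule Un_least)
      show "II \<subseteq> {p \<in> RR. ?s p \<in> ?M}"
        unfolding II_def
      proof (rule ideal_gen_least[OF calculation], rule subsetI)
        fix p :: "('v, 'k) mpoly" assume "p \<in> monomial_of_set ` edges"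
        then obtain U where U: "U \<in> edges" "p = monomial_of_set U" by blast
        have "?s p \<in> ?M" unfolding U(2) subst_monomial[OF U(1)] using U(1) by (intro gM) (simp add: gens_def)
        then show "p \<in> {p \<in> RR. ?s p \<in> ?M}" using monomial_in[OF U(1)] U(2) by simp
      qed
      show "zvar ` L \<subseteq> {p \<in> RR. ?s p \<in> ?M}"
      proof
        fix p assume "p \<in> zvar ` L"
        then obtain l where l: "l \<in> L" "p = zvar l" by blast
        have "?s p = 0"
        proof (cases "l \<in> I0")
          case True then show ?thesis using l by (simp add: zvar_def subst_Var sub_def)
        next
          case False
          \<comment> \<open>\<open>L\<close> contains no representative, so the substitution fixes
            the variable of \<open>\<rho> l\<close> and both terms of \<open>zvar l\<close>
            coincide.\<close>
          then have "\<rho> l \<in> reps" using l L rho_kill by blast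
          then have "\<rho> l \<notin> L" using L by (auto simp: kill_def)
          then show ?thesis using l False by (simp add: zvar_def subst_diff subst_Var sub_def)
        qed
        then show "p \<in> {p \<in> RR. ?s p \<in> ?M}" using l LW zvar_in subringD(1)[OF RR] by auto
      qed
    qed
    ultimately have "JJ L \<subseteq> {p \<in> RR. ?s p \<in> ?M}" unfolding JJ_def by (rule ideal_gen_least)
    then show "f \<in> JJ L \<Longrightarrow> keys (?s f) \<subseteq> upset (gens L)" by blast
  next
    assume "keys (?s f) \<subseteq> upset (gens L)"
    then have "?s f \<in> ?M" using s_in[OF f] by simp
    moreover have "?M \<subseteq> JJ L"
      unfolding M[symmetric]
    proof (rule ideal_gen_least[OF J], rule subsetI)
      fix p :: "('v, 'k) mpoly" assume "p \<in> (\<lambda>g. single g 1) ` gens L"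
      then obtain U where U: "U \<in> edges" "p = single (img L U) 1" by (auto simp: gens_def)
      have "monomial_of_set U - ?s (monomial_of_set U) \<in> JJ L" by (rule diff[OF monomial_in[OF U(1)]])
      then have "monomial_of_set U - p \<in> JJ L" by (simp only: subst_monomial[OF U(1)] U(2))
      from D(7)[OF mono[OF U(1)] this] show "p \<in> JJ L" by simp
    qed
    ultimately have "?s f \<in> JJ L" by blast
    then have "(f - ?s f) + ?s f \<in> JJ L" using diff[OF f] D(3) by blast
    then show "f \<in> JJ L" by simp
  qed
qed

text \<open>An isolated \<open>l\<close> occurs in no generator. Otherwise the only generator
  involving \<open>l\<close> is the image of its own block, and all vertices sent to
  \<open>\<rho> l\<close> lie in that block; so its exponent at \<open>\<rho> l\<close> is the
  largest, as \<open>nzd_diff_monomial\<close> requires.\<close>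

lemma zvar_nzd:
  assumes L: "L \<subseteq> kill" and l: "l \<in> kill" "l \<notin> L"
  shows "nzd_mod RR (JJ L) (zvar l)"
  unfolding nzd_mod_def
proof (intro ballI impI)
  fix f assume f: "f \<in> RR" and zf: "zvar l * f \<in> JJ L"
  let ?s = "subst (sub L)"
  have lW: "l \<in> W" using l by (auto simp: kill_def)
  have "zvar l * f \<in> RR" using zvar_in[OF lW] f subringD(4)[OF RR] by blast
  then have k: "keys (?s (zvar l) * ?s f) \<subseteq> upset (gens L)"
    using zf in_JJ_iff[OF L] by (simp add: subst_mult)
  have "keys (?s f) \<subseteq> upset (gens L)"
  proof (cases "l \<in> I0")
    case True
    then have sl: "?s (zvar l) = Var l" using l by (simp add: zvar_def subst_Var sub_def)
    show ?thesis
    proof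
      fix m assume "m \<in> keys (?s f)"
      then have "single l 1 + m \<in> keys (Var l * ?s f)"
        by (simp add: in_keys_iff Var_def lookup_single_mult del: One_nat_def)
      then have "single l 1 + m \<in> upset (gens L)" using k sl by auto
      then obtain g where g: "g \<in> gens L" "\<forall>x. lookup g x \<le> lookup (single l 1 + m) x"
        by (auto simp: upset_def)
      have "lookup g l = 0" using keys_gens[OF g(1)] True by (auto simp: in_keys_iff)
      then have "lookup g x \<le> lookup m x" for x
        using g(2)[rule_format, of x] by (cases "x = l") (auto simp: lookup_add lookup_single)
      then show "m \<in> upset (gens L)" using g(1) by (auto simp: upset_def)
    qed
  next
    case False
    then have r: "\<rho> l \<noteq> l" "\<rho> l \<in> reps" using rho_kill l by auto
    then have rL: "\<rho> l \<notin> L" using L by (auto simp: kill_def)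
    have sl: "?s (zvar l) = Var (\<rho> l) - Var l"
      using l False rL by (simp add: zvar_def subst_diff subst_Var sub_def)
    show ?thesis
    proof (rule nzd_diff_monomial[OF r(1) _ k[unfolded sl]])
      fix g g' assume g: "g \<in> gens L" and g': "g' \<in> gens L" and pos: "lookup g' l > 0"
      obtain U where U: "U \<in> edges" "g = img L U" using g by (auto simp: gens_def)
      obtain U' where U': "U' \<in> edges" "g' = img L U'" using g' by (auto simp: gens_def)
      obtain u' where u': "u' \<in> U'" "ren L u' = l"
        using pos unfolding U'(2) lookup_img[OF edge_finite[OF U'(1)]] by (auto simp: card_gt_0_iff)
      have u'W: "u' \<in> W - I0" using u' edge_sub[OF U'(1)] by blast
      have lr: "l \<notin> reps" using l by (auto simp: kill_def)
      have "u' \<notin> L"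
      proof
        assume "u' \<in> L"
        then have "l = \<rho> u'" using u' by (simp add: ren_def)
        then show False using rho_reps[OF u'W] lr by simp
      qed
      then have u'l: "u' = l" using u' by (simp add: ren_def)
      have "U' \<notin> NN" using NN[of U'] u' u'l lr by (auto simp: reps_def)
      then have U'b: "U' = block (\<rho> l)" using U'(1) u' u'l by (auto simp: edges_def block_def)
      have rb: "\<rho> l \<in> {u \<in> U'. ren L u = \<rho> l}"
        unfolding U'b using r rL by (auto simp: block_def reps_def ren_def)
      have fin': "finite {u \<in> U'. ren L u = \<rho> l}" using edge_finite[OF U'(1)] by simp
      have "{u \<in> U. ren L u = \<rho> l} \<subseteq> {u \<in> U'. ren L u = \<rho> l}"
      proof
        fix u assume u: "u \<in> {u \<in> U. ren L u = \<rho> l}"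
        then have uW: "u \<in> W - I0" using edge_sub[OF U(1)] by blast
        show "u \<in> {u \<in> U'. ren L u = \<rho> l}"
        proof (cases "u \<in> L")
          case True then show ?thesis using u uW by (auto simp: U'b block_def ren_def)
        next
          case False then have "u = \<rho> l" using u by (simp add: ren_def)
          then show ?thesis using rb by simp
        qed
      qed
      then show "lookup g (\<rho> l) \<le> lookup g' (\<rho> l)"
        unfolding U(2) U'(2) lookup_img[OF edge_finite[OF U(1)]] lookup_img[OF edge_finite[OF U'(1)]]
        by (rule card_mono[OF fin'])
    qed
  qed
  then show "f \<in> JJ L" using in_JJ_iff[OF L f] by simp
qed

lemma kill_W: "kill \<subseteq> W" by (auto simp: kill_def)

lemma Z_regular:
  assumes zs: "distinct zs" "set zs = zvar ` kill"
  shows "regular_seq RR II zs"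
  unfolding regular_seq_def
proof (intro conjI allI impI)
  show "set zs \<subseteq> RR" using zs zvar_in kill_W by auto
  have "ideal_gen RR (II \<union> set zs) \<subseteq> mm"
    using II_mm zs zvar_mm kill_W by (intro ideal_gen_least[OF mm_ideal]) auto
  then show "1 \<notin> ideal_gen RR (II \<union> set zs)" using one_mm by blast
  fix j assume j: "j < length zs"
  \<comment> \<open>A prefix of the list is read as a set of eliminated vertices; distinctness keeps
    the next vertex outside it.\<close>
  define L where "L = {l \<in> kill. zvar l \<in> set (take j zs)}"
  have "set (take j zs) \<subseteq> zvar ` kill" using zs set_take_subset[of j zs] by simp
  then have eq: "set (take j zs) = zvar ` L" by (auto simp: L_def)
  have "zs ! j \<in> set zs" using j by simp
  then obtain l where l: "l \<in> kill" "zs ! j = zvar l" using zs(2) by auto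
  have "zs ! j \<notin> set (take j zs)"
    using zs(1) j by (auto simp: in_set_conv_nth nth_eq_iff_index_eq)
  then have "l \<notin> L" using l by (simp add: L_def)
  then show "nzd_mod RR (ideal_gen RR (II \<union> set (take j zs))) (zs ! j)"
    using zvar_nzd[of L l] l unfolding eq JJ_def by (auto simp: L_def)
qed

section \<open>The socle modulo all of \<open>Z\<close>\<close>

abbreviation "sig \<equiv> subst (sub kill)"
text \<open>Exponents of the socle monomials: outside the monomial ideal, but moved into it by every
  remaining variable.\<close>

definition "SS = {m. keys m \<subseteq> reps \<and> m \<notin> upset (gens kill) \<and> (\<forall>r\<in>reps. single r 1 + m \<in> upset (gens kill))}"

lemma sub_kill: "v \<in> W \<Longrightarrow> sub kill v = 0 \<or> (\<exists>r\<in>reps. sub kill v = Var r)"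
  using rho_kill by (auto simp: sub_def kill_def)

lemma sig_in: "f \<in> RR \<Longrightarrow> sig f \<in> poly_ring reps"
proof (rule subst_in_poly_ring)
  fix v assume "v \<in> W"
  then show "sub kill v \<in> poly_ring reps"
    using sub_kill subringD(1)[OF subring_poly_ring] Var_in_poly_ring by metis
qed

lemma keys_sig: "f \<in> RR \<Longrightarrow> m \<in> keys (sig f) \<Longrightarrow> keys m \<subseteq> reps"
  using sig_in by (auto simp: poly_ring_def)

text \<open>After the substitution every variable is 0 or a representative, and multiplying by a
  representative shifts exponents injectively. So being killed by \<open>mm\<close> can be tested on
  each monomial separately.\<close>

lemma socle_iff:
  assumes f: "f \<in> RR"
  shows "(\<forall>x\<in>mm. x * f \<in> JJ kill) \<longleftrightarrow> keys (sig f) \<subseteq> upset (gens kill) \<union> SS"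
proof
  have iff: "Var v * f \<in> JJ kill \<longleftrightarrow> keys (sub kill v * sig f) \<subseteq> upset (gens kill)" if "v \<in> W" for v
    using in_JJ_iff[OF order_refl, of "Var v * f"] subringD(4)[OF RR Var_in[OF that] f]
    by (simp add: subst_mult subst_Var)
  {
    assume a: "\<forall>x\<in>mm. x * f \<in> JJ kill"
    show "keys (sig f) \<subseteq> upset (gens kill) \<union> SS"
    proof
      fix m assume m: "m \<in> keys (sig f)"
      have "single r 1 + m \<in> upset (gens kill)" if r: "r \<in> reps" for r
      proof -
        have rW: "r \<in> W" and "r \<notin> kill" using r reps_sub by (auto simp: kill_def)
        then have "sub kill r = Var r" by (simp add: sub_def)
        then have "keys (Var r * sig f) \<subseteq> upset (gens kill)" using iff[OF rW] a Var_mm[OF rW] by simp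
        moreover have "single r 1 + m \<in> keys (Var r * sig f)"
          using m by (simp add: in_keys_iff Var_def lookup_single_mult del: One_nat_def)
        ultimately show ?thesis by blast
      qed
      then show "m \<in> upset (gens kill) \<union> SS" using keys_sig[OF f m] by (auto simp: SS_def)
    qed
  next
    assume a: "keys (sig f) \<subseteq> upset (gens kill) \<union> SS"
    note D = idealofD[OF RR JJ_ideal[OF kill_W]]
    have "idealof RR {x \<in> RR. x * f \<in> JJ kill}"
      unfolding idealof_def using D subringD[OF RR] by (auto simp: distrib_right mult.assoc)
    moreover have "Var ` W \<subseteq> {x \<in> RR. x * f \<in> JJ kill}"
    proof -
      have "Var v * f \<in> JJ kill" if v: "v \<in> W" for v
      proof -
        have "keys (sub kill v * sig f) \<subseteq> upset (gens kill)"
        proof (cases "sub kill v = 0")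
          case False
          then obtain r where r: "r \<in> reps" "sub kill v = Var r" using sub_kill[OF v] by blast
          show ?thesis
          proof
            fix k assume "k \<in> keys (sub kill v * sig f)"
            then obtain i j where ij: "k = i + j" "i \<in> keys (Var r :: ('v, 'k) mpoly)" "j \<in> keys (sig f)"
              using keys_mult[of "Var r" "sig f"] r(2) by auto
            then have "k = single r 1 + j" by (simp add: Var_def)
            moreover have "j \<in> upset (gens kill) \<or> j \<in> SS" using a ij(3) by blast
            ultimately show "k \<in> upset (gens kill)" using r(1) upset_add by (auto simp: SS_def)
          qed
        qed simp
        then show ?thesis using iff[OF v] by simp
      qed
      then show ?thesis using Var_in by auto
    qed
    ultimately have "mm \<subseteq> {x \<in> RR. x * f \<in> JJ kill}" unfolding mm_def by (rule ideal_gen_least)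
    then show "\<forall>x\<in>mm. x * f \<in> JJ kill" by blast
  }
qed

lemma single_SS:
  assumes "m \<in> SS"
  shows "single m c \<in> RR" "sig (single m c) = single m c"
proof -
  have k: "keys m \<subseteq> reps" using assms by (auto simp: SS_def)
  then show "single m c \<in> RR" using reps_sub by (intro single_in_poly_ring) blast
  show "sig (single m c) = single m c"
    by (rule subst_id[OF single_in_poly_ring[OF k]]) (auto simp: sub_def kill_def)
qed

text \<open>The monomials in \<open>SS\<close> are independent modulo the ideal. Conversely, more
  socle elements than \<open>card SS\<close> admit a nontrivial combination whose coefficients on
  \<open>SS\<close> vanish, and this combination lies in the ideal.\<close>

lemma socle_dim_SS:
  assumes finS: "finite SS"
  shows "socle_dim RR mm (JJ kill) = card SS"
  unfolding socle_dim_def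
proof (rule Greatest_equality)
  have inj: "inj_on (\<lambda>m. single m (1::'k)) SS"
  proof (rule inj_onI)
    fix a b :: "'v \<Rightarrow>\<^sub>0 nat" assume "single a (1::'k) = single b 1"
    then have "keys (single a (1::'k)) = keys (single b (1::'k))" by simp
    then show "a = b" by simp
  qed
  show "\<exists>F. finite F \<and> card F = card SS \<and> F \<subseteq> {f \<in> RR. \<forall>x\<in>mm. x * f \<in> JJ kill} \<and>
       (\<forall>c. (\<Sum>f\<in>F. Const (c f) * f) \<in> JJ kill \<longrightarrow> (\<forall>f\<in>F. c f = 0))"
  proof (intro exI[of _ "(\<lambda>m. single m 1) ` SS"] conjI allI impI ballI)
    show "(\<lambda>m. single m 1) ` SS \<subseteq> {f \<in> RR. \<forall>x\<in>mm. x * f \<in> JJ kill}"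
    proof
      fix f :: "('v, 'k) mpoly" assume "f \<in> (\<lambda>m. single m 1) ` SS"
      then obtain m where m: "m \<in> SS" "f = single m 1" by blast
      show "f \<in> {f \<in> RR. \<forall>x\<in>mm. x * f \<in> JJ kill}"
        using socle_iff[OF single_SS(1)[OF m(1)]] single_SS[OF m(1)] m by simp
    qed
    fix c :: "('v, 'k) mpoly \<Rightarrow> 'k" and f :: "('v, 'k) mpoly"
    assume c: "(\<Sum>f\<in>(\<lambda>m. single m 1) ` SS. Const (c f) * f) \<in> JJ kill" and f: "f \<in> (\<lambda>m. single m 1) ` SS"
    let ?p = "\<Sum>m\<in>SS. single m (c (single m 1))"
    have eq: "(\<Sum>f\<in>(\<lambda>m. single m 1) ` SS. Const (c f) * f) = ?p"
      by (simp add: sum.reindex[OF inj] single_mult_Const[symmetric])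
    have "?p \<in> RR" by (intro subring_sum[OF RR] single_SS)
    moreover have "sig ?p = ?p" by (simp add: subst_sum single_SS cong: sum.cong)
    ultimately have k: "keys ?p \<subseteq> upset (gens kill)"
      using c in_JJ_iff[OF order_refl, of ?p] unfolding eq by simp
    obtain m where m: "m \<in> SS" "f = single m 1" using f by blast
    have "lookup ?p m = (\<Sum>n\<in>SS. if n = m then c (single n 1) else 0)"
      by (simp add: lookup_sum lookup_single when_def)
    also have "\<dots> = c f" using m finS by simp
    finally have "lookup ?p m = c f" .
    moreover have "m \<notin> keys ?p" using m(1) k by (auto simp: SS_def)
    ultimately show "c f = 0" by (simp add: in_keys_iff)
  qed (use finS inj in \<open>auto simp: card_image\<close>)
next
  fix n
  assume "\<exists>F. finite F \<and> card F = n \<and> F \<subseteq> {f \<in> RR. \<forall>x\<in>mm. x * f \<in> JJ kill} \<and>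
       (\<forall>c. (\<Sum>f\<in>F. Const (c f) * f) \<in> JJ kill \<longrightarrow> (\<forall>f\<in>F. c f = 0))"
  then obtain F where F: "finite F" "card F = n" "F \<subseteq> {f \<in> RR. \<forall>x\<in>mm. x * f \<in> JJ kill}"
    "\<And>c. (\<Sum>f\<in>F. Const (c f) * f) \<in> JJ kill \<Longrightarrow> (\<forall>f\<in>F. c f = 0)" by blast
  show "n \<le> card SS"
  proof (rule ccontr)
    assume "\<not> n \<le> card SS"
    then obtain c where c: "\<exists>f\<in>F. c f \<noteq> 0" "\<forall>m\<in>SS. (\<Sum>f\<in>F. c f * lookup (sig f) m) = 0"
      using homogeneous_system_nontrivial[OF finS F(1), of "\<lambda>f. lookup (sig f)"] F(2) by auto
    let ?p = "\<Sum>f\<in>F. Const (c f) * f"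
    have p: "?p \<in> RR"
      using F(3) by (intro subring_sum[OF RR] subringD(4)[OF RR] Const_in_poly_ring) blast
    have lk: "lookup (Const a * q) m = a * lookup q m" for a and q :: "('v, 'k) mpoly" and m
      using lookup_single_mult[of 0 a q m] by (simp add: Const_def)
    have co: "lookup (sig ?p) m = (\<Sum>f\<in>F. c f * lookup (sig f) m)" for m
      by (simp add: subst_sum subst_mult subst_Const lookup_sum lk)
    have "keys (sig ?p) \<subseteq> upset (gens kill)"
    proof
      fix m assume m: "m \<in> keys (sig ?p)"
      then have nz: "(\<Sum>f\<in>F. c f * lookup (sig f) m) \<noteq> 0" using co by (simp add: in_keys_iff)
      then obtain f where f: "f \<in> F" "c f * lookup (sig f) m \<noteq> 0" by (meson sum.neutral)
      then have "m \<in> keys (sig f)" by (auto simp: in_keys_iff)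
      then have "m \<in> upset (gens kill) \<union> SS" using F(3) f(1) socle_iff[of f] by blast
      then show "m \<in> upset (gens kill)" using c(2) nz by auto
    qed
    then have "?p \<in> JJ kill" using in_JJ_iff[OF order_refl p] by simp
    then show False using F(4) c(1) by blast
  qed
qed

text \<open>With everything in \<open>kill\<close> eliminated, a block monomial becomes a pure power
  of its representative, while the monomials from \<open>NN\<close> involve only representatives and
  are unchanged.\<close>

lemma upset_gens_iff:
  "m \<in> upset (gens kill) \<longleftrightarrow>
     (\<exists>r\<in>reps. card (block r) \<le> lookup m r) \<or> (\<exists>N\<in>NN. \<forall>u\<in>N. lookup m u > 0)"
proof -
  have b: "lookup (img kill (block r)) x = (if x = r then card (block r) else 0)" if r: "r \<in> reps" for r x
  proof -
    have e: "block r \<in> edges" using r by (simp add: edges_def)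
    have "ren kill u = r" if "u \<in> block r" for u
      using that by (auto simp: ren_def block_def kill_def reps_def)
    then have "{u \<in> block r. ren kill u = x} = (if x = r then block r else {})" by auto
    then show ?thesis by (simp add: lookup_img[OF edge_finite[OF e]])
  qed
  have n: "lookup (img kill N) x = (if x \<in> N then 1 else 0)" if N: "N \<in> NN" for N x
  proof -
    have e: "N \<in> edges" using N by (simp add: edges_def)
    have "ren kill u = u" if "u \<in> N" for u
      using that NN[OF N] by (auto simp: ren_def kill_def reps_def)
    then have "{u \<in> N. ren kill u = x} = (if x \<in> N then {x} else {})" by auto
    then show ?thesis by (simp add: lookup_img[OF edge_finite[OF e]])
  qed
  have "m \<in> upset (gens kill) \<longleftrightarrow> (\<exists>U\<in>edges. \<forall>x. lookup (img kill U) x \<le> lookup m x)"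
    by (auto simp: upset_def gens_def)
  also have "\<dots> \<longleftrightarrow> (\<exists>r\<in>reps. \<forall>x. lookup (img kill (block r)) x \<le> lookup m x)
      \<or> (\<exists>N\<in>NN. \<forall>x. lookup (img kill N) x \<le> lookup m x)"
    by (auto simp: edges_def)
  also have "(\<exists>r\<in>reps. \<forall>x. lookup (img kill (block r)) x \<le> lookup m x) \<longleftrightarrow>
      (\<exists>r\<in>reps. card (block r) \<le> lookup m r)"
    by (rule bex_cong[OF refl]) (auto simp: b)
  also have "(\<exists>N\<in>NN. \<forall>x. lookup (img kill N) x \<le> lookup m x) \<longleftrightarrow> (\<exists>N\<in>NN. \<forall>u\<in>N. lookup m u > 0)"
    by (rule bex_cong[OF refl]) (auto simp: n Suc_le_eq)
  finally show ?thesis .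
qed

text \<open>Keeps the top exponent \<open>card (block r) - 1\<close> apart from 0.\<close>

lemma card_block: "r \<in> reps \<Longrightarrow> 2 \<le> card (block r)"
proof -
  assume r: "r \<in> reps"
  then obtain l where l: "l \<in> W - I0" "\<rho> l = r" "l \<noteq> r" using two by (auto simp: reps_def)
  have "finite (block r)" using fin by (simp add: block_def)
  moreover have "{l, r} \<subseteq> block r" using l r by (auto simp: block_def reps_def)
  ultimately have "card {l, r} \<le> card (block r)" by (rule card_mono)
  then show ?thesis using l by simp
qed

text \<open>Multiplying a socle monomial by a positive-exponent \<open>r\<close> completes no new
  \<open>N\<close>, so it must complete the power of \<open>r\<close>. If the exponent is 0, blocks
  of size at least two exclude the power, so some \<open>N\<close> containing \<open>r\<close> is
  completed.\<close>

lemma SS_D: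
  assumes m: "m \<in> SS"
  shows "r \<in> reps \<Longrightarrow> lookup m r \<noteq> 0 \<Longrightarrow> Suc (lookup m r) = card (block r)"
    and "r \<in> reps \<Longrightarrow> lookup m r = 0 \<Longrightarrow> \<exists>N\<in>NN. r \<in> N \<and> (\<forall>u\<in>N - {r}. lookup m u > 0)"
    and "N \<in> NN \<Longrightarrow> \<exists>u\<in>N. lookup m u = 0"
    and "r \<notin> reps \<Longrightarrow> lookup m r = 0"
proof -
  have k: "keys m \<subseteq> reps" and nu: "m \<notin> upset (gens kill)"
    and up: "\<And>r. r \<in> reps \<Longrightarrow> single r 1 + m \<in> upset (gens kill)" using m by (auto simp: SS_def)
  show 3: "N \<in> NN \<Longrightarrow> \<exists>u\<in>N. lookup m u = 0" for N using nu upset_gens_iff by auto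
  show "r \<notin> reps \<Longrightarrow> lookup m r = 0" for r using k by (auto simp: in_keys_iff)
  have lt: "lookup m r < card (block r)" if "r \<in> reps" for r
    using nu that upset_gens_iff by (meson not_le)
  have alt: "card (block r) \<le> Suc (lookup m r) \<or> (\<exists>N\<in>NN. \<forall>u\<in>N. lookup (single r 1 + m) u > 0)"
    if r: "r \<in> reps" for r
  proof -
    consider r' where "r' \<in> reps" "card (block r') \<le> lookup (single r 1 + m) r'"
      | "\<exists>N\<in>NN. \<forall>u\<in>N. lookup (single r 1 + m) u > 0"
      using up[OF r] upset_gens_iff[of "single r 1 + m"] by blast
    then show ?thesis
    proof cases
      case 1
      then show ?thesis using lt[OF 1(1)] by (cases "r' = r") (auto simp: lookup_add lookup_single)
    qed auto
  qed
  show "Suc (lookup m r) = card (block r)" if r: "r \<in> reps" and nz: "lookup m r \<noteq> 0" for r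
  proof -
    have "\<not> (\<exists>N\<in>NN. \<forall>u\<in>N. lookup (single r 1 + m) u > 0)"
    proof
      assume "\<exists>N\<in>NN. \<forall>u\<in>N. lookup (single r 1 + m) u > 0"
      then obtain N where N: "N \<in> NN" "\<forall>u\<in>N. lookup (single r 1 + m) u > 0" by blast
      obtain u where u: "u \<in> N" "lookup m u = 0" using 3[OF N(1)] by blast
      then have "u \<noteq> r" using nz by auto
      then show False using N(2)[rule_format, OF u(1)] u(2) by (simp add: lookup_add lookup_single)
    qed
    then have "card (block r) \<le> Suc (lookup m r)" using alt[OF r] by blast
    then show ?thesis using lt[OF r] by simp
  qed
  show "\<exists>N\<in>NN. r \<in> N \<and> (\<forall>u\<in>N - {r}. lookup m u > 0)" if r: "r \<in> reps" and z: "lookup m r = 0" for r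
  proof -
    obtain N where N: "N \<in> NN" "\<forall>u\<in>N. lookup (single r 1 + m) u > 0"
      using alt[OF r] card_block[OF r] z by auto
    have pos: "\<forall>u\<in>N - {r}. lookup m u > 0" using N(2) by (auto simp: lookup_add lookup_single when_def split: if_splits)
    obtain u where u: "u \<in> N" "lookup m u = 0" using 3[OF N(1)] by blast
    have "u \<notin> N - {r}"
    proof
      assume "u \<in> N - {r}"
      then have "0 < lookup m u" using pos by blast
      then show False using u(2) by simp
    qed
    then have "r \<in> N" using u(1) by blast
    then show ?thesis using N(1) pos by blast
  qed
qed

text \<open>Every member of \<open>NN\<close> consists of representatives, so
  \<open>D \<inter> reps\<close> is still a transversal.\<close>

lemma min_transversal_sub: "min_transversal NN D \<Longrightarrow> D \<subseteq> reps"
proof (rule ccontr)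
  assume D: "min_transversal NN D" and "\<not> D \<subseteq> reps"
  then have "D \<inter> reps \<subset> D" by blast
  then obtain N where N: "N \<in> NN" "N \<inter> (D \<inter> reps) = {}"
    using D[unfolded min_transversal_def] by meson
  have "N \<subseteq> reps" using NN[OF N(1)] by (simp add: reps_def)
  then have "N \<inter> D = {}" using N(2) by blast
  then show False using D[unfolded min_transversal_def] N(1) by blast
qed

text \<open>A socle monomial has exponent \<open>0\<close> on a minimal transversal and the largest admissible exponent
  elsewhere.\<close>

lemma SS_bij: "bij_betw (\<lambda>m. {r \<in> reps. lookup m r = 0}) SS {D. min_transversal NN D}"
  unfolding bij_betw_def
proof
  let ?e = "\<lambda>m. {r \<in> reps. lookup m r = (0::nat)}"
  show "inj_on ?e SS"
  proof (rule inj_onI)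
    fix a b assume a: "a \<in> SS" and b: "b \<in> SS" and eq: "?e a = ?e b"
    show "a = b"
    proof (rule poly_mapping_eqI)
      fix r
      show "lookup a r = lookup b r"
      proof (cases "r \<in> reps \<and> lookup a r \<noteq> 0")
        case True
        then have "r \<notin> ?e b" unfolding eq[symmetric] by simp
        then have "lookup b r \<noteq> 0" using True by simp
        then show ?thesis using SS_D(1)[OF a, of r] SS_D(1)[OF b, of r] True by simp
      next
        case False
        show ?thesis
        proof (cases "r \<in> reps")
          case True
          then have "r \<in> ?e a" using False by simp
          then have "r \<in> ?e b" unfolding eq .
          then show ?thesis using True False by simp
        qed (simp add: SS_D(4)[OF a] SS_D(4)[OF b])
      qed
    qed
  qed
  show "?e ` SS = {D. min_transversal NN D}"
  proof (intro equalityI subsetI)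
    fix D assume "D \<in> ?e ` SS"
    then obtain m where m: "m \<in> SS" "D = ?e m" by blast
    have NNr: "N \<subseteq> reps" if "N \<in> NN" for N using NN[OF that] by (simp add: reps_def)
    have "N \<inter> D \<noteq> {}" if "N \<in> NN" for N
      using SS_D(3)[OF m(1) that] NNr[OF that] m(2) by blast
    moreover have "\<exists>N\<in>NN. N \<inter> D' = {}" if D': "D' \<subset> D" for D'
    proof -
      obtain r where r: "r \<in> D" "r \<notin> D'" using D' by blast
      then have rr: "r \<in> reps" "lookup m r = 0" using m(2) by auto
      obtain N where N: "N \<in> NN" "r \<in> N" "\<forall>u\<in>N - {r}. lookup m u > 0"
        using SS_D(2)[OF m(1) rr] by blast
      have "N \<inter> D' = {}"
      proof (rule ccontr)
        assume "N \<inter> D' \<noteq> {}"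
        then obtain u where u: "u \<in> N" "u \<in> D'" by blast
        then have "u \<noteq> r" "lookup m u = 0" using r D' m(2) by auto
        then show False using N(3)[rule_format, of u] u(1) by simp
      qed
      then show ?thesis using N(1) by blast
    qed
    ultimately show "D \<in> {D. min_transversal NN D}" by (auto simp: min_transversal_def)
  next
    fix D assume "D \<in> {D. min_transversal NN D}"
    then have D: "min_transversal NN D" by simp
    note Dr = min_transversal_sub[OF D]
    have fr: "finite reps" using fin reps_sub by (meson finite_Diff finite_subset)
    define m where "m = (\<Sum>r\<in>reps - D. single r (card (block r) - 1))"
    have lm: "lookup m x = (if x \<in> reps - D then card (block x) - 1 else 0)" for x
      using fr by (simp add: m_def lookup_sum lookup_single when_def)
    have pos: "lookup m x > 0 \<longleftrightarrow> x \<in> reps - D" for x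
      using card_block[of x] by (auto simp: lm)
    have "m \<notin> upset (gens kill)"
      unfolding upset_gens_iff
    proof
      assume "(\<exists>r\<in>reps. card (block r) \<le> lookup m r) \<or> (\<exists>N\<in>NN. \<forall>u\<in>N. 0 < lookup m u)"
      then show False
      proof
        assume "\<exists>r\<in>reps. card (block r) \<le> lookup m r"
        then obtain r where "r \<in> reps" "card (block r) \<le> lookup m r" by blast
        then show False using card_block[of r] by (simp add: lm split: if_splits)
      next
        assume "\<exists>N\<in>NN. \<forall>u\<in>N. 0 < lookup m u"
        then show False using D by (auto simp: min_transversal_def pos)
      qed
    qed
    moreover have "single r 1 + m \<in> upset (gens kill)" if r: "r \<in> reps" for r
      unfolding upset_gens_iff
    proof (cases "r \<in> D")
      case False
      then have "card (block r) \<le> lookup (single r 1 + m) r" using r by (simp add: lookup_add lm)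
      then show "(\<exists>r'\<in>reps. card (block r') \<le> lookup (single r 1 + m) r') \<or> (\<exists>N\<in>NN. \<forall>u\<in>N. 0 < lookup (single r 1 + m) u)"
        using r by blast
    next
      case True
      then have "D - {r} \<subset> D" by blast
      then obtain N where N: "N \<in> NN" "N \<inter> (D - {r}) = {}"
        using D[unfolded min_transversal_def] by meson
      have "N \<subseteq> reps" using NN[OF N(1)] by (simp add: reps_def)
      have "0 < lookup (single r 1 + m) u" if u: "u \<in> N" for u
      proof (cases "u = r")
        case True then show ?thesis by (simp add: lookup_add)
      next
        case False
        then have "u \<in> reps - D" using u N(2) \<open>N \<subseteq> reps\<close> by blast
        then show ?thesis using pos[of u] by (simp add: lookup_add)
      qed
      then show "(\<exists>r'\<in>reps. card (block r') \<le> lookup (single r 1 + m) r') \<or> (\<exists>N\<in>NN. \<forall>u\<in>N. 0 < lookup (single r 1 + m) u)"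
        using N(1) by blast
    qed
    moreover have "keys m \<subseteq> reps" by (auto simp: in_keys_iff lm split: if_splits)
    ultimately have "m \<in> SS" by (simp add: SS_def)
    moreover have "?e m = {r \<in> reps. \<not> 0 < lookup m r}" by simp
    then have "?e m = D" using Dr unfolding pos by blast
    ultimately show "D \<in> ?e ` SS" by blast
  qed
qed

lemma min_transversal_exists: "\<exists>D. min_transversal NN D"
proof -
  have fr: "finite reps" using fin reps_sub by (meson finite_Diff finite_subset)
  let ?A = "{D. D \<subseteq> reps \<and> (\<forall>N\<in>NN. N \<inter> D \<noteq> {})}"
  have "finite ?A" using fr by simp
  moreover have "reps \<in> ?A" using NN by (fastforce simp: reps_def)
  ultimately obtain D where D: "D \<in> ?A" "\<And>B. B \<in> ?A \<Longrightarrow> B \<subseteq> D \<Longrightarrow> D = B"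
    using finite_has_minimal2[of ?A reps] by auto
  have "min_transversal NN D"
    unfolding min_transversal_def
  proof (intro conjI allI impI)
    show "\<forall>N\<in>NN. N \<inter> D \<noteq> {}" using D(1) by simp
    fix D' assume D': "D' \<subset> D"
    then have "D' \<notin> ?A" using D(2)[of D'] by blast
    moreover have "D' \<subseteq> reps" using D' D(1) by blast
    ultimately show "\<exists>N\<in>NN. N \<inter> D' = {}" by simp
  qed
  then show ?thesis by blast
qed

theorem regular_and_type:
  shows "\<And>zs. distinct zs \<Longrightarrow> set zs = zvar ` kill \<Longrightarrow> maximal_regular_seq_in RR II mm zs"
    and "cm_type RR mm II = card {D. min_transversal NN D}"
proof -
  have "{D. min_transversal NN D} \<subseteq> Pow reps" using min_transversal_sub by blast
  moreover have "finite reps" using fin reps_sub by (meson finite_Diff finite_subset)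
  ultimately have "finite {D. min_transversal NN D}" by (meson finite_Pow_iff finite_subset)
  then have finS: "finite SS" using bij_betw_finite[OF SS_bij] by simp
  \<comment> \<open>A minimal transversal exists, and the corresponding monomial is the socle
    element that certifies maximality.\<close>
  have "SS \<noteq> {}" using SS_bij min_transversal_exists by (auto simp: bij_betw_def)
  then obtain m where m: "m \<in> SS" by blast
  have one: "single m (1::'k) \<in> RR" "sig (single m (1::'k)) = single m 1" using single_SS[OF m] by auto
  have soc: "\<forall>x\<in>mm. x * single m 1 \<in> JJ kill" using socle_iff[OF one(1)] one(2) m by simp
  have nJ: "single m 1 \<notin> JJ kill"
    using in_JJ_iff[OF order_refl one(1)] one(2) m by (simp add: SS_def)
  note k = koszul_poly_ring[OF mm_ideal] and n = noeth_poly_ring[OF fin, where 'k = 'k]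
  show max: "maximal_regular_seq_in RR II mm zs" if zs: "distinct zs" "set zs = zvar ` kill" for zs
  proof -
    have "set zs \<subseteq> mm" using zs zvar_mm kill_W by auto
    from maximal_regular_seq_socle[OF k n II_ideal II_mm one_mm Z_regular[OF zs] this]
    show ?thesis using soc nJ one(1) zs by (auto simp: JJ_def)
  qed
  have "finite (zvar ` kill)" by (intro finite_imageI finite_subset[OF kill_W fin])
  from finite_distinct_list[OF this] obtain zs where zs: "set zs = zvar ` kill" "distinct zs"
    by (elim exE conjE)
  have "cm_type RR mm II = socle_dim RR mm (JJ kill)"
    using cm_type_eq_socle_dim[OF k n II_ideal II_mm one_mm max[OF zs(2,1)]] zs by (simp add: JJ_def)
  also have "\<dots> = card {D. min_transversal NN D}"
    using socle_dim_SS[OF finS] bij_betw_same_card[OF SS_bij] by simp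
  finally show "cm_type RR mm II = card {D. min_transversal NN D}" .
qed

end

section \<open>Walks, bridges and heights\<close>

lemma walk_Cons: "walk E (x # xs) \<longleftrightarrow> xs = [] \<or> (E x (hd xs) \<and> walk E xs)"
proof (cases xs)
  case (Cons y ys)
  have "(\<forall>i. Suc i < length (x # xs) \<longrightarrow> E ((x # xs) ! i) ((x # xs) ! Suc i)) \<longleftrightarrow>
    E x y \<and> (\<forall>i. Suc i < length xs \<longrightarrow> E (xs ! i) (xs ! Suc i))" (is "?L \<longleftrightarrow> ?R")
  proof
    assume ?L
    from this[rule_format, of 0] this[rule_format, of "Suc i" for i] show ?R using Cons by auto
  next
    assume ?R
    show ?L
    proof (intro allI impI)
      fix i assume "Suc i < length (x # xs)"
      then show "E ((x # xs) ! i) ((x # xs) ! Suc i)" using \<open>?R\<close> Cons by (cases i) auto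
    qed
  qed
  then show ?thesis using Cons by (simp add: walk_def)
qed (simp add: walk_def)

lemma simple_path:
  assumes "E\<^sup>*\<^sup>* x y"
  shows "\<exists>xs. walk E xs \<and> distinct xs \<and> hd xs = x \<and> last xs = y"
  using assms
proof (induction rule: converse_rtranclp_induct)
  case base
  show ?case by (intro exI[of _ "[y]"]) (simp add: walk_def)
next
  case (step x z)
  then obtain xs where xs: "walk E xs" "distinct xs" "hd xs = z" "last xs = y" by blast
  show ?case
  proof (cases "x \<in> set xs")
    case False
    have "xs \<noteq> []" using xs(1) by (simp add: walk_def)
    then show ?thesis using xs step False by (intro exI[of _ "x # xs"]) (simp add: walk_Cons)
  next
    case True
    \<comment> \<open>The new vertex is already on the path, so the part before it is cut
      off.\<close>
    then obtain ys zs where split: "xs = ys @ x # zs" by (meson split_list)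
    have "walk E (ys @ x # zs) \<Longrightarrow> walk E (x # zs)"
      by (induction ys) (auto simp: walk_Cons[of E _ "_ @ _"])
    then show ?thesis using xs split by (intro exI[of _ "x # zs"]) auto
  qed
qed

definition del_edge :: "('v \<Rightarrow> 'v \<Rightarrow> bool) \<Rightarrow> 'v \<Rightarrow> 'v \<Rightarrow> 'v \<Rightarrow> 'v \<Rightarrow> bool" where
  "del_edge E x y a b \<longleftrightarrow> E a b \<and> {a, b} \<noteq> {x, y}"

lemma del_edge_commute: "del_edge E x y = del_edge E y x"
  by (auto simp: del_edge_def fun_eq_iff insert_commute)

lemma rtranclp_sym: "symp E \<Longrightarrow> E\<^sup>*\<^sup>* a b \<Longrightarrow> E\<^sup>*\<^sup>* b a"
  using symp_rtranclp by (metis sympD)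

lemma symp_del_edge: "symp E \<Longrightarrow> symp (del_edge E x y)"
  by (auto simp: del_edge_def symp_def insert_commute)

text \<open>A simple path between the ends that avoids the edge has at least three vertices and
  closes to a cycle with it.\<close>

lemma bridge:
  assumes ac: "acyclic_graph E" and sym: "symp E" and E: "E x y" "x \<noteq> y"
  shows "\<not> (del_edge E x y)\<^sup>*\<^sup>* x y"
proof
  assume "(del_edge E x y)\<^sup>*\<^sup>* x y"
  from simple_path[OF this] obtain xs
    where xs: "walk (del_edge E x y) xs" "distinct xs" "hd xs = x" "last xs = y" by blast
  have w: "walk E xs" using xs(1) by (auto simp: walk_def del_edge_def)
  have "length xs \<ge> 3"
  proof (rule ccontr)
    assume "\<not> length xs \<ge> 3"
    moreover have "xs \<noteq> []" using w by (simp add: walk_def)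
    ultimately have "(\<exists>a. xs = [a]) \<or> (\<exists>a b. xs = [a, b])"
      by (cases xs; cases "tl xs"; cases "tl (tl xs)") auto
    then show False using xs E(2) by (auto simp: walk_Cons del_edge_def)
  qed
  moreover have "E (last xs) (hd xs)" using xs sym E(1) by (simp add: sympD)
  ultimately show False using ac w xs(2) unfolding acyclic_graph_def by blast
qed

text \<open>Rooting at \<open>s\<close>: the parent of \<open>v\<close> is the neighbour on the side of \<open>s\<close> once the edge is cut.\<close>

definition parent :: "('v \<Rightarrow> 'v \<Rightarrow> bool) \<Rightarrow> 'v \<Rightarrow> 'v \<Rightarrow> 'v \<Rightarrow> bool" where
  "parent E s p v \<longleftrightarrow> E p v \<and> (del_edge E p v)\<^sup>*\<^sup>* s p"

locale acyclic_gr =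
  fixes E :: "'v \<Rightarrow> 'v \<Rightarrow> bool"
  assumes ac: "acyclic_graph E" and sym: "symp E" and irr: "\<not> E x x"
begin

lemma not_both_sides:
  assumes "E x y" "(del_edge E x y)\<^sup>*\<^sup>* s x" "(del_edge E x y)\<^sup>*\<^sup>* s y"
  shows False
proof -
  have "(del_edge E x y)\<^sup>*\<^sup>* x s" by (rule rtranclp_sym[OF symp_del_edge[OF sym] assms(2)])
  then have "(del_edge E x y)\<^sup>*\<^sup>* x y" using assms(3) by (rule rtranclp_trans)
  then show False using bridge[OF ac sym assms(1)] irr assms(1) by metis
qed

text \<open>Before a walk from \<open>s\<close> first uses the edge, it has reached one end of it
  without crossing it.\<close>

lemma parent_total:
  assumes s: "E\<^sup>*\<^sup>* s p" and E: "E p v"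
  shows "parent E s p v \<or> parent E s v p"
proof -
  let ?d = "del_edge E p v"
  have "?d\<^sup>*\<^sup>* s z \<or> ?d\<^sup>*\<^sup>* s p \<or> ?d\<^sup>*\<^sup>* s v" if "E\<^sup>*\<^sup>* s z" for z
    using that
  proof (induction rule: rtranclp_induct)
    case (step z z')
    show ?case
    proof (cases "{z, z'} = {p, v}")
      case True then show ?thesis using step by (auto simp: doubleton_eq_iff)
    next
      case False
      then have "?d z z'" using step by (simp add: del_edge_def)
      then show ?thesis using step.IH rtranclp.rtrancl_into_rtrancl by metis
    qed
  qed simp
  then have "?d\<^sup>*\<^sup>* s p \<or> ?d\<^sup>*\<^sup>* s v" using s by blast
  then show ?thesis using E sym del_edge_commute[of E p v] unfolding parent_def by (auto dest: sympD)
qed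

lemma parent_root: "\<not> parent E s p s"
  unfolding parent_def using not_both_sides[of p s s] by auto

text \<open>A walk from \<open>s\<close> to \<open>q\<close> that avoids the edge \<open>q v\<close>
  either avoids \<open>p v\<close> as well, and then continues to \<open>v\<close> without
  \<open>p v\<close>, or it passes through \<open>v\<close>. Each case puts \<open>s\<close> on both
  sides of a bridge.\<close>

lemma parent_unique:
  assumes p: "parent E s p v" and q: "parent E s q v"
  shows "p = q"
proof (rule ccontr)
  assume pq: "p \<noteq> q"
  let ?p = "del_edge E p v" and ?q = "del_edge E q v"
  have Ep: "E p v" "?p\<^sup>*\<^sup>* s p" and Eq: "E q v" "?q\<^sup>*\<^sup>* s q" using p q by (auto simp: parent_def)
  have "?p\<^sup>*\<^sup>* s z \<or> ?q\<^sup>*\<^sup>* s v" if "?q\<^sup>*\<^sup>* s z" for z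
    using that
  proof (induction rule: rtranclp_induct)
    case (step z z')
    show ?case
    proof (cases "{z, z'} = {p, v}")
      case True
      then have "z = v \<or> z' = v" by (auto simp: doubleton_eq_iff)
      then show ?thesis using step.hyps rtranclp.rtrancl_into_rtrancl by metis
    next
      case False
      then have "?p z z'" using step by (simp add: del_edge_def)
      then show ?thesis using step.IH rtranclp.rtrancl_into_rtrancl by metis
    qed
  qed simp
  then consider "?p\<^sup>*\<^sup>* s q" | "?q\<^sup>*\<^sup>* s v" using Eq(2) by blast
  then show False
  proof cases
    case 1
    have "?p q v" using Eq(1) pq irr by (auto simp: del_edge_def doubleton_eq_iff)
    with 1 have "?p\<^sup>*\<^sup>* s v" by (rule rtranclp.rtrancl_into_rtrancl)
    then show False using not_both_sides[OF Ep(1,2)] by blast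
  next
    case 2 then show False using not_both_sides[OF Eq] by blast
  qed
qed

end

section \<open>Heights through walks to leaves\<close>

definition leaf_walk :: "('v \<Rightarrow> 'v \<Rightarrow> bool) \<Rightarrow> nat \<Rightarrow> 'v \<Rightarrow> bool" where
  "leaf_walk E n v \<longleftrightarrow> (\<exists>xs. walk E xs \<and> hd xs = v \<and> is_leaf E (last xs) \<and> length xs = Suc n)"

lemma leaf_walk_0: "leaf_walk E 0 v \<longleftrightarrow> is_leaf E v"
  by (auto simp: leaf_walk_def length_Suc_conv walk_def intro: exI[of _ "[v]"])

lemma leaf_walk_Suc: "leaf_walk E (Suc n) v \<longleftrightarrow> (\<exists>u. E v u \<and> leaf_walk E n u)"
proof
  assume "leaf_walk E (Suc n) v"
  then obtain xs where xs: "walk E xs" "hd xs = v" "is_leaf E (last xs)" "length xs = Suc (Suc n)"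
    by (auto simp: leaf_walk_def)
  then obtain ys where ys: "xs = v # ys" "length ys = Suc n" by (cases xs) auto
  then have "ys \<noteq> []" by auto
  then show "\<exists>u. E v u \<and> leaf_walk E n u"
    using xs ys unfolding leaf_walk_def by (intro exI[of _ "hd ys"]) (auto simp: walk_Cons)
next
  assume "\<exists>u. E v u \<and> leaf_walk E n u"
  then obtain u xs where u: "E v u" "walk E xs" "hd xs = u" "is_leaf E (last xs)" "length xs = Suc n"
    by (auto simp: leaf_walk_def)
  then have "xs \<noteq> []" by auto
  then show "leaf_walk E (Suc n) v"
    using u unfolding leaf_walk_def by (intro exI[of _ "v # xs"]) (auto simp: walk_Cons)
qed

lemma hgt_eq: "hgt E v = (if \<exists>n. leaf_walk E n v then LEAST n. leaf_walk E n v else 0)"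
proof -
  have "(\<exists>xs. walk E xs \<and> hd xs = v \<and> is_leaf E (last xs)) \<longleftrightarrow> (\<exists>n. leaf_walk E n v)"
  proof
    assume "\<exists>xs. walk E xs \<and> hd xs = v \<and> is_leaf E (last xs)"
    then obtain xs where "walk E xs \<and> hd xs = v \<and> is_leaf E (last xs)" by blast
    moreover from this have "length xs = Suc (length xs - 1)" by (cases xs) (auto simp: walk_def)
    ultimately show "\<exists>n. leaf_walk E n v" unfolding leaf_walk_def by blast
  qed (auto simp: leaf_walk_def)
  then show ?thesis unfolding hgt_def by (simp only: leaf_walk_def)
qed

lemma hgt_leaf_walk: "\<exists>n. leaf_walk E n v \<Longrightarrow> leaf_walk E (hgt E v) v"
  using LeastI_ex[of "\<lambda>n. leaf_walk E n v"] by (simp add: hgt_eq)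

lemma hgt_le: "leaf_walk E n v \<Longrightarrow> hgt E v \<le> n"
  unfolding hgt_eq by (auto intro: Least_le)

lemma hgt_leaf: "is_leaf E v \<Longrightarrow> hgt E v = 0"
  using hgt_le[of E 0 v] by (simp add: leaf_walk_0)

lemma hgt_step: "E v u \<Longrightarrow> \<exists>n. leaf_walk E n u \<Longrightarrow> hgt E v \<le> Suc (hgt E u)"
  using hgt_leaf_walk[of E u] leaf_walk_Suc[of E "hgt E u" v] by (intro hgt_le) blast

lemma hgt_Suc_leaf_walk: "hgt E v = Suc n \<Longrightarrow> leaf_walk E (Suc n) v"
  using hgt_leaf_walk[of E v] by (metis hgt_eq nat.distinct(1))

text \<open>The next vertex on a shortest walk to a leaf; were its height smaller, so would be that
  of \<open>v\<close>.\<close>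

lemma hgt_Suc_D:
  assumes "hgt E v = Suc n"
  shows "\<exists>u. E v u \<and> hgt E u = n"
proof -
  obtain u where u: "E v u" "leaf_walk E n u"
    using hgt_Suc_leaf_walk[OF assms] by (auto simp: leaf_walk_Suc)
  have "hgt E u \<le> n" by (rule hgt_le[OF u(2)])
  moreover have "Suc n \<le> Suc (hgt E u)" using hgt_step[where E = E and v = v and u = u] u assms by auto
  ultimately show ?thesis using u(1) by auto
qed

lemma hgt_isolated: "nbhd E v = {} \<Longrightarrow> (\<And>u. E v u \<Longrightarrow> E u v) \<Longrightarrow> hgt E v = 0"
  using hgt_Suc_D[of E v] by (cases "hgt E v") (auto simp: nbhd_def)

text \<open>Reconciles heights measured inside a component, as in
  \<open>balanced W (restr E W)\<close>, with heights in the whole graph, as in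
  \<open>component_Z\<close>.\<close>

lemma hgt_cong:
  assumes closed: "\<And>u v. u \<in> W \<Longrightarrow> E u v \<Longrightarrow> v \<in> W" and closed': "\<And>u v. u \<in> W \<Longrightarrow> E v u \<Longrightarrow> v \<in> W"
    and v: "v \<in> W"
  shows "hgt (restr E W) v = hgt E v"
proof -
  have leaf: "is_leaf (restr E W) v \<longleftrightarrow> is_leaf E v" if "v \<in> W" for v
  proof -
    have "nbhd (restr E W) v = nbhd E v" using that closed' by (auto simp: nbhd_def restr_def)
    then show ?thesis by (simp add: is_leaf_def)
  qed
  have "leaf_walk (restr E W) n v \<longleftrightarrow> leaf_walk E n v" if "v \<in> W" for n v
    using that
  proof (induction n arbitrary: v)
    case (Suc n)
    then show ?case using closed by (auto simp: leaf_walk_Suc restr_def)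
  qed (simp add: leaf_walk_0 leaf)
  then show ?thesis using v by (simp add: hgt_eq)
qed

section \<open>Components of an unmixed balanced forest\<close>

text \<open>A component that has a leaf, as opposed to an isolated vertex. The height bound will be
  read off from the cases of \<open>component_Z\<close>.\<close>

locale leafy_tree =
  fixes V :: "'v set" and E :: "'v \<Rightarrow> 'v \<Rightarrow> bool" and W :: "'v set"
  assumes simple: "simple_graph V E" and acyc: "acyclic_graph E"
    and W: "W \<in> components V E"
    and bal: "balanced W (restr E W)" and unm: "unmixed W (restr E W)"
    and leafy: "\<exists>v\<in>W. \<exists>n. leaf_walk E n v"
    and bound: "v \<in> W \<Longrightarrow> hgt E v \<le> 3"
begin

lemma E_facts: "E u v \<Longrightarrow> u \<in> V" "E u v \<Longrightarrow> v \<in> V" "E u v \<Longrightarrow> E v u" "\<not> E u u"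
  using simple by (auto simp: simple_graph_def)

sublocale acyclic_gr E
  by unfold_locales (use acyc E_facts in \<open>auto simp: symp_def\<close>)

lemma connected: "u \<in> W \<Longrightarrow> v \<in> W \<Longrightarrow> E\<^sup>*\<^sup>* u v"
proof -
  assume uv: "u \<in> W" "v \<in> W"
  obtain w where "W = {u. E\<^sup>*\<^sup>* w u}" using W by (auto simp: components_def)
  then have "E\<^sup>*\<^sup>* w u" "E\<^sup>*\<^sup>* w v" using uv by auto
  then show ?thesis using rtranclp_sym[OF sym] rtranclp_trans[of E u w v] by blast
qed

lemma closed: "u \<in> W \<Longrightarrow> E u v \<Longrightarrow> v \<in> W"
  using W by (auto simp: components_def intro: rtranclp.rtrancl_into_rtrancl)

lemma W_V: "W \<subseteq> V"
proof
  fix u assume "u \<in> W"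
  obtain w where w: "w \<in> V" "W = {u. E\<^sup>*\<^sup>* w u}" using W by (auto simp: components_def)
  have "E\<^sup>*\<^sup>* w u" using w \<open>u \<in> W\<close> by simp
  then show "u \<in> V" by (induction rule: rtranclp_induct) (use w(1) E_facts(2) in auto)
qed

lemma finW: "finite W"
  using simple W_V finite_subset by (auto simp: simple_graph_def)

lemma lw: "v \<in> W \<Longrightarrow> \<exists>n. leaf_walk E n v"
proof -
  assume v: "v \<in> W"
  obtain u n where u: "u \<in> W" "leaf_walk E n u" using leafy by blast
  from connected[OF v u(1)] show ?thesis
  proof (induction rule: converse_rtranclp_induct)
    case base show ?case using u(2) by blast
  next
    case (step y z)
    then show ?case using leaf_walk_Suc[of E _ y] by blast
  qed
qed

lemma hgt_restr: "v \<in> W \<Longrightarrow> hgt (restr E W) v = hgt E v"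
  by (rule hgt_cong) (use closed E_facts in blast)+

text \<open>Heights of neighbours differ by at most one, and balance excludes equality.\<close>

lemma adj:
  assumes "u \<in> W" "E u v"
  shows "hgt E v = Suc (hgt E u) \<or> hgt E u = Suc (hgt E v)"
proof -
  have v: "v \<in> W" using assms closed by blast
  have "hgt E u \<noteq> hgt E v"
    using bal assms v hgt_restr unfolding balanced_def by (auto simp: restr_def)
  moreover have "hgt E u \<le> Suc (hgt E v)" "hgt E v \<le> Suc (hgt E u)"
    using hgt_step[where E = E and v = u and u = v, OF assms(2) lw[OF v]]
      hgt_step[where E = E and v = v and u = u, OF E_facts(3)[OF assms(2)] lw[OF assms(1)]] .
  ultimately show ?thesis by linarith
qed

lemma hgt0_leaf: "v \<in> W \<Longrightarrow> hgt E v = 0 \<Longrightarrow> is_leaf E v"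
  using hgt_leaf_walk[OF lw] leaf_walk_0 by metis

lemma hgt0_unique: "v \<in> W \<Longrightarrow> hgt E v = 0 \<Longrightarrow> \<exists>!s. E s v"
proof -
  assume "v \<in> W" "hgt E v = 0"
  then have "card (nbhd E v) = 1" using hgt0_leaf by (simp add: is_leaf_def)
  then obtain x where "nbhd E v = {x}" by (rule card_1_singletonE)
  then show ?thesis by (auto simp: nbhd_def set_eq_iff)
qed

lemma two_nbrs:
  assumes "v \<in> W" "hgt E v = Suc n"
  shows "\<exists>y. E v y \<and> y \<noteq> x"
proof (rule ccontr)
  assume "\<not> ?thesis"
  moreover obtain u where "E v u" using hgt_Suc_D[OF assms(2)] by blast
  ultimately have "nbhd E v = {x}" using E_facts(3) by (auto simp: nbhd_def)
  then have "is_leaf E v" by (simp add: is_leaf_def)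
  then show False using hgt_leaf assms(2) by force
qed

section \<open>Vertices sorted by height, and what unmixedness forces on them\<close>

definition "S1 = {v \<in> W. hgt E v = 1}"
definition "S2 = {v \<in> W. hgt E v = 2}"
definition "S3 = {v \<in> W. hgt E v = 3}"

lemma S_disj: "v \<in> S1 \<Longrightarrow> v \<notin> S2" "v \<in> S1 \<Longrightarrow> v \<notin> S3" "v \<in> S2 \<Longrightarrow> v \<notin> S3"
  by (auto simp: S1_def S2_def S3_def)

lemma S_W: "v \<in> S1 \<Longrightarrow> v \<in> W" "v \<in> S2 \<Longrightarrow> v \<in> W" "v \<in> S3 \<Longrightarrow> v \<in> W"
  by (auto simp: S1_def S2_def S3_def)

lemma nbr_S3: "w \<in> S3 \<Longrightarrow> E w u \<Longrightarrow> u \<in> S2"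
  using adj[of w u] closed[of w u] bound[of u] by (auto simp: S2_def S3_def)

lemma nbr_S2: "u \<in> S2 \<Longrightarrow> E u v \<Longrightarrow> v \<in> S1 \<or> v \<in> S3"
  using adj[of u v] closed[of u v] by (auto simp: S2_def S3_def S1_def)

lemma nbr_S1: "s \<in> S1 \<Longrightarrow> E s v \<Longrightarrow> v \<in> S2 \<or> (v \<in> W \<and> hgt E v = 0)"
  using adj[of s v] closed[of s v] by (auto simp: S2_def S1_def)

lemma nbr_S0: "v \<in> W \<Longrightarrow> hgt E v = 0 \<Longrightarrow> E v s \<Longrightarrow> s \<in> S1"
  using adj[of v s] closed[of v s] by (auto simp: S1_def)

lemma S2_S1: "u \<in> S2 \<Longrightarrow> \<exists>s\<in>S1. E u s"
  using hgt_Suc_D[of E u 1] closed by (fastforce simp: S2_def S1_def)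

lemma S1_leaf: "s \<in> S1 \<Longrightarrow> \<exists>l\<in>W. E s l \<and> hgt E l = 0"
  using hgt_Suc_D[of E s 0] closed by (fastforce simp: S1_def)

text \<open>An irredundant cover \<open>A\<close> of the vertices of height 3 extends to a minimal TD-set by all
  vertices of height 1 and one leaf at each vertex of height 1 not adjacent to \<open>A\<close>.\<close>

definition icover :: "'v set \<Rightarrow> bool" where
  "icover A \<longleftrightarrow> A \<subseteq> S2 \<and> (\<forall>w\<in>S3. \<exists>a\<in>A. E w a) \<and>
     (\<forall>a\<in>A. \<exists>b\<in>S1 \<union> S3. E a b \<and> (\<forall>a'\<in>A. E a' b \<longrightarrow> a' = a))"

definition "uncov A = {s \<in> S1. \<not> (\<exists>a\<in>A. E a s)}"

text \<open>Minimality comes from private neighbours: the chosen leaf for a height-1 vertex, the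
  vertex granted by \<open>icover\<close> for an element of \<open>A\<close>, and the uncovered
  height-1 vertex itself for a chosen leaf. All of \<open>S1\<close> lies in the set, which is why
  its size is a fixed summand.\<close>

lemma icover_TD:
  assumes A: "icover A"
  shows "\<exists>D. minimal_TD_set W (restr E W) D \<and> card D = card S1 + (card A + card (uncov A))"
proof -
  note Ac = A[unfolded icover_def]
  obtain l where l: "\<And>s. s \<in> S1 \<Longrightarrow> l s \<in> W \<and> E s (l s) \<and> hgt E (l s) = 0"
    using S1_leaf by metis
  let ?L = "l ` uncov A"
  let ?D = "S1 \<union> (A \<union> ?L)"
  have lu: "s = t" if "E s (l t)" "t \<in> S1" for s t
    using hgt0_unique[of "l t"] l[OF that(2)] that(1) by metis
  have A2: "a \<in> S2" if "a \<in> A" for a using Ac that by blast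
  have DW: "?D \<subseteq> W" using S_W l A2 by (auto simp: uncov_def)
  have dom: "\<exists>d\<in>?D. E d w" if w: "w \<in> W" for w
  proof -
    consider "hgt E w = 0" | "w \<in> S1" | "w \<in> S2" | "w \<in> S3"
      using bound[OF w] w by (force simp: S1_def S2_def S3_def)
    then show ?thesis
    proof cases
      case 1
      then obtain s where "E s w" using hgt0_unique w by blast
      then show ?thesis using nbr_S0[OF w 1] E_facts(3) by blast
    next
      case 2
      show ?thesis
      proof (cases "w \<in> uncov A")
        case True then show ?thesis using l[OF 2] E_facts(3) by blast
      next
        case False then show ?thesis using 2 by (auto simp: uncov_def)
      qed
    next
      case 3 then show ?thesis using S2_S1 E_facts(3) by blast
    next
      case 4 then show ?thesis using Ac E_facts(3) by blast
    qed
  qed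
  have TD: "TD_set W (restr E W) ?D"
    unfolding TD_set_def
  proof
    show "?D \<subseteq> W" by (rule DW)
    show "nbhd_set (restr E W) ?D = W"
    proof
      show "nbhd_set (restr E W) ?D \<subseteq> W" by (auto simp: nbhd_set_def nbhd_def restr_def)
      show "W \<subseteq> nbhd_set (restr E W) ?D"
      proof
        fix w assume w: "w \<in> W"
        then obtain d where "d \<in> ?D" "E d w" using dom by blast
        then show "w \<in> nbhd_set (restr E W) ?D"
          using w DW E_facts(3) unfolding nbhd_set_def nbhd_def restr_def by blast
      qed
    qed
  qed
  have priv: "\<exists>v\<in>W. \<forall>d'\<in>?D. E d' v \<longrightarrow> d' = d" if d: "d \<in> ?D" for d
  proof -
    have nL: "d' \<in> W \<and> hgt E d' = 0" if "d' \<in> ?L" for d' using that l by (auto simp: uncov_def)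
    consider "d \<in> S1" | "d \<in> A" | s where "s \<in> uncov A" "d = l s" using d by blast
    then show ?thesis
    proof cases
      case 1
      then show ?thesis using lu l by blast
    next
      case 2
      obtain b where b: "b \<in> S1 \<union> S3" "E d b" "\<forall>a'\<in>A. E a' b \<longrightarrow> a' = d" using Ac 2 by blast
      have "d' = d" if d': "d' \<in> ?D" "E d' b" for d'
      proof -
        have "d' \<notin> S1"
        proof
          assume "d' \<in> S1"
          then have "b \<in> S2 \<or> hgt E b = 0" using nbr_S1[of d' b] d'(2) by auto
          then show False using b(1) by (auto simp: S1_def S2_def S3_def)
        qed
        moreover have "d' \<notin> ?L"
        proof
          assume dL: "d' \<in> ?L"
          then obtain s where s: "s \<in> uncov A" "d' = l s" by blast
          then have "b = s" using lu[of b s] d'(2) E_facts(3) by (auto simp: uncov_def)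
          then show False using s(1) b(2) 2 by (auto simp: uncov_def)
        qed
        ultimately show ?thesis using d' b(3) by blast
      qed
      then show ?thesis using b(1) S_W by blast
    next
      case 3
      have s1: "s \<in> S1" using 3 by (simp add: uncov_def)
      have "d' = d" if d': "d' \<in> ?D" "E d' s" for d'
      proof -
        have "d' \<notin> S1"
        proof
          assume "d' \<in> S1"
          then have "s \<in> S2 \<or> hgt E s = 0" using nbr_S1[of d' s] d'(2) by auto
          then show False using s1 by (auto simp: S1_def S2_def)
        qed
        moreover have "d' \<notin> A" using 3(1) d'(2) by (auto simp: uncov_def)
        moreover have "d' = d" if "d' \<in> ?L"
        proof -
          obtain t where t: "t \<in> uncov A" "d' = l t" using \<open>d' \<in> ?L\<close> by blast
          then have "s = t" using lu[of s t] d'(2) E_facts(3) by (auto simp: uncov_def)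
          then show ?thesis using t 3 by simp
        qed
        ultimately show ?thesis using d'(1) by blast
      qed
      then show ?thesis using s1 S_W by blast
    qed
  qed
  have "minimal_TD_set W (restr E W) ?D"
    unfolding minimal_TD_set_def
  proof (intro conjI allI impI)
    show "TD_set W (restr E W) ?D" by (rule TD)
    fix D' assume D': "D' \<subset> ?D"
    then obtain d where d: "d \<in> ?D" "d \<notin> D'" by blast
    then obtain v where v: "v \<in> W" "\<forall>d'\<in>?D. E d' v \<longrightarrow> d' = d" using priv by blast
    show "\<not> TD_set W (restr E W) D'"
    proof
      assume "TD_set W (restr E W) D'"
      then have "v \<in> nbhd_set (restr E W) D'" using v(1) by (simp add: TD_set_def)
      then obtain d' where "d' \<in> D'" "E v d'" by (auto simp: nbhd_set_def nbhd_def restr_def)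
      then show False using v(2) D' d(2) E_facts(3) by blast
    qed
  qed
  moreover have "card ?D = card S1 + (card A + card (uncov A))"
  proof -
    have fin: "finite S1" "finite A" "finite ?L"
      using finW A2 S_W by (auto simp: S1_def uncov_def intro: finite_subset[OF _ finW])
    have inj: "inj_on l (uncov A)"
    proof (rule inj_onI)
      fix s t assume "s \<in> uncov A" "t \<in> uncov A" "l s = l t"
      then show "s = t" using lu[of s t] l[of s] by (auto simp: uncov_def)
    qed
    have L0: "hgt E x = 0" if "x \<in> ?L" for x using that l by (auto simp: uncov_def)
    have "A \<inter> ?L = {}" using A2 L0 by (fastforce simp: S2_def)
    then have "card (A \<union> ?L) = card A + card (uncov A)"
      using fin by (simp add: card_Un_disjoint card_image[OF inj])
    moreover have "S1 \<inter> (A \<union> ?L) = {}" using A2 L0 by (fastforce simp: S1_def S2_def)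
    ultimately show ?thesis using fin by (simp add: card_Un_disjoint)
  qed
  ultimately show ?thesis by blast
qed

text \<open>The only form in which unmixedness is used.\<close>

lemma icover_card:
  assumes "icover A" "icover B"
  shows "card A + card (uncov A) = card B + card (uncov B)"
proof -
  obtain D where D: "minimal_TD_set W (restr E W) D" "card D = card S1 + (card A + card (uncov A))"
    using icover_TD[OF assms(1)] by blast
  obtain D' where D': "minimal_TD_set W (restr E W) D'" "card D' = card S1 + (card B + card (uncov B))"
    using icover_TD[OF assms(2)] by blast
  have "card D = card D'" using unm[unfolded unmixed_def, rule_format, OF D(1) D'(1)] .
  then show ?thesis using D(2) D'(2) by simp
qed

lemma finS: "finite S1" "finite S2" "finite S3"
  using finW by (auto simp: S1_def S2_def S3_def)

text \<open>Rooting the tree at a vertex \<open>s\<close> of height 1, every vertex of height 3 has a child; the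
  children chosen this way have disjoint neighbourhoods in height 1 that avoid \<open>s\<close>.\<close>

context
  fixes s c assumes s: "s \<in> S1"
    and c: "\<And>w. w \<in> S3 \<Longrightarrow> E w (c w) \<and> parent E s w (c w)"
begin

lemma c_S2: "w \<in> S3 \<Longrightarrow> c w \<in> S2"
  using c nbr_S3 by blast

lemma par_or: "u \<in> W \<Longrightarrow> E u v \<Longrightarrow> parent E s u v \<or> parent E s v u"
  using parent_total connected[OF S_W(1)[OF s]] by blast

lemma c_child:
  assumes "w \<in> S3" "E (c w) b" "b \<in> S1"
  shows "parent E s (c w) b"
proof (rule ccontr)
  assume "\<not> ?thesis"
  then have "parent E s b (c w)" using par_or assms c_S2 S_W by blast
  then have "b = w" using parent_unique c[OF assms(1)] by blast
  then show False using assms S_disj by blast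
qed

lemma c_private:
  assumes "w \<in> S3" "w' \<in> S3" "E (c w) b" "E (c w') b" "b \<in> S1"
  shows "c w = c w'"
  using c_child assms parent_unique by metis

lemma c_root:
  assumes "w \<in> S3" shows "\<not> E (c w) s"
  using c_child[OF assms _ s] parent_root by blast

lemma par_s: "E s u \<Longrightarrow> parent E s s u"
  using par_or[OF S_W(1)[OF s]] parent_root by blast

lemma c_neq: "w \<in> S3 \<Longrightarrow> E s u \<Longrightarrow> c w \<noteq> u"
  using par_s c parent_unique s S_disj by metis

text \<open>The parent of \<open>b\<close> is \<open>c w\<close>, so \<open>u\<close> could only be
  a child of \<open>b\<close>; but the parent of \<open>u\<close> is \<open>s\<close>, which
  \<open>c w\<close> does not touch.\<close>

lemma c_nbr:
  assumes w: "w \<in> S3" and u: "E s u" "u \<in> S2" and b: "E (c w) b" "b \<in> S1"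
  shows "\<not> E u b"
proof
  assume ub: "E u b"
  have cb: "parent E s (c w) b" using c_child[OF w b] .
  consider "parent E s u b" | "parent E s b u" using par_or[OF S_W(2)[OF u(2)] ub] by blast
  then show False
  proof cases
    case 1 then show False using parent_unique[OF cb] c_neq[OF w u(1)] by blast
  next
    case 2
    then have "b = s" using parent_unique par_s[OF u(1)] by blast
    then show False using c_root[OF w] b by blast
  qed
qed

lemma icover_children: "icover (c ` S3)"
  unfolding icover_def
proof (intro conjI ballI)
  show "c ` S3 \<subseteq> S2" using c_S2 by blast
  show "\<exists>a\<in>c ` S3. E w a" if "w \<in> S3" for w using c that by blast
  fix a assume "a \<in> c ` S3"
  then obtain w where w: "w \<in> S3" "a = c w" by blast
  obtain b where b: "b \<in> S1" "E a b" using S2_S1 c_S2 w by blast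
  then have "\<forall>a'\<in>c ` S3. E a' b \<longrightarrow> a' = a" using c_private w by blast
  then show "\<exists>b\<in>S1 \<union> S3. E a b \<and> (\<forall>a'\<in>c ` S3. E a' b \<longrightarrow> a' = a)" using b by blast
qed

text \<open>Adding \<open>u\<close> to the chosen children enlarges the cover by one, so exactly one
  height-1 vertex may become covered. By \<open>c_nbr\<close> every height-1 neighbour of
  \<open>u\<close> becomes newly covered, and \<open>s\<close> is one of them.\<close>

lemma one_S1_nbr:
  assumes u: "u \<in> S2" "E s u" and t: "t \<in> S1" "E u t"
  shows "t = s"
proof -
  let ?A = "c ` S3"
  have un: "u \<notin> ?A" using c_neq u by blast
  have ic: "icover (insert u ?A)"
    unfolding icover_def
  proof (intro conjI ballI)
    show "insert u ?A \<subseteq> S2" using c_S2 u by blast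
    show "\<exists>a\<in>insert u ?A. E w a" if "w \<in> S3" for w using c that by blast
    fix a assume "a \<in> insert u ?A"
    then consider "a = u" | w where "w \<in> S3" "a = c w" by blast
    then show "\<exists>b\<in>S1 \<union> S3. E a b \<and> (\<forall>a'\<in>insert u ?A. E a' b \<longrightarrow> a' = a)"
    proof cases
      case 1 then show ?thesis using s u(2) E_facts(3) c_root by (intro bexI[of _ s]) auto
    next
      case 2
      obtain b where b: "b \<in> S1" "E a b" using S2_S1 c_S2 2 by blast
      then have "\<forall>a'\<in>insert u ?A. E a' b \<longrightarrow> a' = a"
        using c_private 2 c_nbr[OF 2(1) u(2,1)] by blast
      then show ?thesis using b by blast
    qed
  qed
  have fin: "finite ?A" "finite (uncov ?A)" using finS by (auto simp: uncov_def)
  have eq: "Suc (card (uncov (insert u ?A))) = card (uncov ?A)"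
    using icover_card[OF ic icover_children] fin un by simp
  have sub: "uncov (insert u ?A) \<subseteq> uncov ?A" by (auto simp: uncov_def)
  have in_d: "x \<in> uncov ?A - uncov (insert u ?A)" if x: "x \<in> S1" "E u x" for x
    using x c_nbr[OF _ u(2,1) _ x(1)] by (auto simp: uncov_def)
  have "card (uncov ?A - uncov (insert u ?A)) = 1"
    using eq by (subst card_Diff_subset[OF finite_subset[OF sub fin(2)] sub]) simp
  then obtain y where "uncov ?A - uncov (insert u ?A) = {y}" by (auto simp: card_1_singleton_iff)
  then show ?thesis using in_d[OF t] in_d[OF s E_facts(3)[OF u(2)]] by auto
qed

end

text \<open>A vertex of height 3 is not a leaf, and at most one of its neighbours is its
  parent.\<close>

lemma children_exist:
  assumes s: "s \<in> S1"
  obtains c where "\<And>w. w \<in> S3 \<Longrightarrow> E w (c w) \<and> parent E s w (c w)"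
proof -
  have "\<exists>x. E w x \<and> parent E s w x" if w: "w \<in> S3" for w
  proof -
    obtain x where x: "E w x" using hgt_Suc_D[of E w 2] w by (auto simp: S3_def)
    obtain y where y: "E w y" "y \<noteq> x" using two_nbrs[of w 2] w by (auto simp: S3_def)
    have "parent E s w z \<or> parent E s z w" if "E w z" for z
      using parent_total[OF connected[OF S_W(1)[OF s] S_W(3)[OF w]] that] .
    then show ?thesis using x y parent_unique by metis
  qed
  then show ?thesis using that by metis
qed

lemma S2_unique:
  assumes "u \<in> S2" "s \<in> S1" "t \<in> S1" "E u s" "E u t"
  shows "t = s"
proof -
  obtain c where c: "\<And>w. w \<in> S3 \<Longrightarrow> E w (c w) \<and> parent E s w (c w)"
    using children_exist[OF assms(2)] by blast
  show ?thesis using one_S1_nbr[OF assms(2) c assms(1) E_facts(3)[OF assms(4)] assms(3,5)] by blast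
qed

lemma S2_S3: "u \<in> S2 \<Longrightarrow> \<exists>w\<in>S3. E u w"
proof -
  assume u: "u \<in> S2"
  obtain s where s: "s \<in> S1" "E u s" using S2_S1[OF u] by blast
  obtain y where y: "E u y" "y \<noteq> s" using two_nbrs[of u 1 s] u by (auto simp: S2_def)
  then show ?thesis using nbr_S2[OF u y(1)] S2_unique[OF u s(1) _ s(2) y(1)] by blast
qed

text \<open>The chosen children cover at least as many height-1 vertices as they number. A cover
  containing both \<open>u\<close> and \<open>u'\<close> wastes one element, since both cover only
  \<open>s\<close>; its count in \<open>icover_card\<close> would exceed
  \<open>card S1\<close>.\<close>

lemma S1_unique:
  assumes s: "s \<in> S1" and u: "u \<in> S2" "E s u" and u': "u' \<in> S2" "E s u'"
  shows "u' = u"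
proof (rule ccontr)
  assume ne: "u' \<noteq> u"
  obtain c where c: "\<And>w. w \<in> S3 \<Longrightarrow> E w (c w) \<and> parent E s w (c w)"
    using children_exist[OF s] by blast
  note P = s c
  \<comment> \<open>Height-3 vertices adjacent to \<open>u\<close> or \<open>u'\<close> are already
    covered, and leaving out their children makes room for private neighbours of \<open>u\<close>
    and \<open>u'\<close>.\<close>
  define T where "T = {w \<in> S3. \<not> E u w \<and> \<not> E u' w}"
  let ?B = "insert u (insert u' (c ` T))"
  have T3: "w \<in> S3" if "w \<in> T" for w using that by (simp add: T_def)
  have uE: "\<exists>b\<in>S1 \<union> S3. E x b \<and> (\<forall>a'\<in>?B. E a' b \<longrightarrow> a' = x)"
    if x: "x \<in> S2" "E s x" and xy: "{x, y} = {u, u'}" "x \<noteq> y" for x y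
  proof -
    have y: "y \<in> S2" "E s y" using xy u u' by (auto simp: doubleton_eq_iff)
    \<comment> \<open>The height-1 neighbour \<open>s\<close> is shared, so the private neighbour of
      \<open>x\<close> is taken in height 3, where it is a child of \<open>x\<close>.\<close>
    obtain w where w: "w \<in> S3" "E x w" using S2_S3[OF x(1)] by blast
    have down: "parent E s z w" if z: "z \<in> S2" "E s z" "E z w" for z
    proof (rule ccontr)
      assume "\<not> ?thesis"
      then have "parent E s w z" using par_or[OF P S_W(2)[OF z(1)] z(3)] by blast
      then have "w = s" using parent_unique par_s[OF P z(2)] by blast
      then show False using w s S_disj by blast
    qed
    have "a' = x" if a': "a' \<in> ?B" "E a' w" for a'
    proof -
      consider "a' = x" | "a' = y" | v where "v \<in> T" "a' = c v" using a'(1) xy(1) by blast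
      then show ?thesis
      proof cases
        case 2
        then show ?thesis using parent_unique[OF down[OF x w(2)] down[OF y]] a'(2) by blast
      next
        case 3
        have v: "v \<in> S3" "v \<noteq> w" using 3 w xy(1) by (auto simp: T_def doubleton_eq_iff)
        have "parent E s a' w \<or> parent E s w a'" using par_or[OF P _ a'(2)] c_S2[OF P v(1)] 3 S_W by blast
        then show ?thesis
        proof
          assume "parent E s a' w"
          then show ?thesis using parent_unique down[OF x w(2)] by blast
        next
          assume "parent E s w a'"
          then have "v = w" using parent_unique c[OF v(1)] 3 by blast
          then show ?thesis using v by blast
        qed
      qed
    qed
    then show ?thesis using w by blast
  qed
  have ic: "icover ?B"
    unfolding icover_def
  proof (intro conjI ballI)
    show "?B \<subseteq> S2" using c_S2[OF P] u u' T3 by blast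
    show "\<exists>a\<in>?B. E w a" if w: "w \<in> S3" for w
    proof (cases "w \<in> T")
      case True then show ?thesis using c w by blast
    next
      case False then show ?thesis using w E_facts(3) by (auto simp: T_def)
    qed
    fix a assume "a \<in> ?B"
    then consider "a = u" | "a = u'" | w where "w \<in> T" "a = c w" by blast
    then show "\<exists>b\<in>S1 \<union> S3. E a b \<and> (\<forall>a'\<in>?B. E a' b \<longrightarrow> a' = a)"
    proof cases
      case 1 then show ?thesis using uE[of u u'] u ne by auto
    next
      case 2 then show ?thesis using uE[of u' u] u' ne by (auto simp: insert_commute)
    next
      case 3
      obtain b where b: "b \<in> S1" "E a b" using S2_S1 c_S2[OF P] 3 T3 by blast
      have cw: "E (c w) b" using b(2) 3(2) by simp
      have "a' = a" if a': "a' \<in> ?B" "E a' b" for a'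
      proof -
        have "a' \<noteq> u" using c_nbr[OF P T3[OF 3(1)] u(2,1) cw b(1)] a'(2) by blast
        moreover have "a' \<noteq> u'" using c_nbr[OF P T3[OF 3(1)] u'(2,1) cw b(1)] a'(2) by blast
        ultimately obtain v where v: "v \<in> T" "a' = c v" using a'(1) by blast
        have "E (c v) b" using a'(2) v(2) by simp
        from c_private[OF P T3[OF v(1)] T3[OF 3(1)] this cw b(1)] show ?thesis using v(2) 3(2) by simp
      qed
      then show ?thesis using b by blast
    qed
  qed
  obtain t where t: "\<And>a. a \<in> S2 \<Longrightarrow> t a \<in> S1 \<and> E a (t a)" using S2_S1 by metis
  have cov: "card (uncov A) = card S1 - card (S1 - uncov A)" "card (S1 - uncov A) \<le> card S1" for A
  proof -
    have "uncov A \<subseteq> S1" by (auto simp: uncov_def)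
    then show "card (uncov A) = card S1 - card (S1 - uncov A)" "card (S1 - uncov A) \<le> card S1"
      using finS card_mono[of S1 "uncov A"] by (auto simp: card_Diff_subset finite_subset intro: card_mono)
  qed
  \<comment> \<open>By \<open>c_private\<close>, distinct chosen children have distinct height-1
    neighbours.\<close>
  have "card (c ` S3) \<le> card (S1 - uncov (c ` S3))"
  proof (rule card_inj_on_le)
    show "inj_on t (c ` S3)"
    proof (rule inj_onI)
      fix a a' assume "a \<in> c ` S3" "a' \<in> c ` S3" "t a = t a'"
      then show "a = a'" using c_private[OF P] t c_S2[OF P] by (metis imageE)
    qed
    show "t ` (c ` S3) \<subseteq> S1 - uncov (c ` S3)" using t c_S2[OF P] by (auto simp: uncov_def)
    show "finite (S1 - uncov (c ` S3))" using finS by simp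
  qed
  then have 1: "card (c ` S3) + card (uncov (c ` S3)) \<le> card S1" using cov[of "c ` S3"] by linarith
  \<comment> \<open>By \<open>S2_unique\<close> an element of the cover covers one height-1 vertex,
    and for \<open>u\<close> and \<open>u'\<close> this vertex is \<open>s\<close>.\<close>
  have "S1 - uncov ?B \<subseteq> insert s (t ` c ` T)"
  proof
    fix x assume "x \<in> S1 - uncov ?B"
    then obtain a where a: "x \<in> S1" "a \<in> ?B" "E a x" by (auto simp: uncov_def)
    have a2: "a \<in> S2" using a(2) ic by (auto simp: icover_def)
    have "x = t a" using S2_unique[OF a2 _ a(1) _ a(3)] t[OF a2] by blast
    moreover have "t a = s" if "E s a" using S2_unique[OF a2 s _ E_facts(3)[OF that]] t[OF a2] by blast
    ultimately show "x \<in> insert s (t ` c ` T)" using a(2) u(2) u'(2) by auto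
  qed
  moreover have finT: "finite (c ` T)" using finS by (simp add: T_def)
  ultimately have "card (S1 - uncov ?B) \<le> card (insert s (t ` c ` T))" by (intro card_mono) auto
  also have "\<dots> \<le> Suc (card (c ` T))" using card_image_le[OF finT, of t] finT by (simp add: card_insert_if)
  finally have "card (S1 - uncov ?B) \<le> Suc (card (c ` T))" .
  moreover have "card ?B = Suc (Suc (card (c ` T)))"
    using c_neq[OF P T3 u(2)] c_neq[OF P T3 u'(2)] ne finT by (auto simp: card_insert_if)
  ultimately have "card ?B + card (uncov ?B) > card S1" using cov[of ?B] by linarith
  then show False using 1 icover_card[OF ic icover_children[OF P]] by linarith
qed

text \<open>All neighbours of \<open>s\<close> are then leaves, so no walk from \<open>s\<close>
  leads further.\<close>

lemma star:
  assumes s: "s \<in> S1" and none: "\<And>u. E s u \<Longrightarrow> u \<notin> S2"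
  shows "W = insert s (nbhd E s)"
proof
  show "insert s (nbhd E s) \<subseteq> W" using S_W(1)[OF s] closed E_facts(3) by (auto simp: nbhd_def)
  show "W \<subseteq> insert s (nbhd E s)"
  proof
    fix v assume "v \<in> W"
    from connected[OF S_W(1)[OF s] this] show "v \<in> insert s (nbhd E s)"
    proof (induction rule: rtranclp_induct)
      case (step y z)
      show ?case
      proof (cases "y = s")
        case True then show ?thesis using step E_facts(3) by (auto simp: nbhd_def)
      next
        case False
        then have sy: "E s y" using step E_facts(3) by (auto simp: nbhd_def)
        then have "y \<in> W" "hgt E y = 0" using nbr_S1[OF s sy] none by auto
        then show ?thesis using hgt0_unique[of y] sy E_facts(3)[OF step(2)] by auto
      qed
    qed simp
  qed
qed

lemma S1_S2_exists:
  assumes s: "s \<in> S1" and w: "w \<in> S3"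
  shows "\<exists>u\<in>S2. E s u"
proof (rule ccontr)
  assume "\<not> ?thesis"
  then have none: "\<And>u. E s u \<Longrightarrow> u \<notin> S2" by blast
  have "w \<in> insert s (nbhd E s)" using star[OF s none] S_W(3)[OF w] by blast
  then have "E s w" using s w S_disj E_facts(3) by (auto simp: nbhd_def)
  then show False using nbr_S1[OF s] w none by (auto simp: S3_def)
qed

lemma S1_nonempty: "S1 \<noteq> {}"
proof -
  obtain v where v: "v \<in> W" using leafy by blast
  have *: "S1 \<noteq> {}" if "u \<in> S2" for u using S2_S1[OF that] by blast
  consider "hgt E v = 0" | "v \<in> S1" | "v \<in> S2" | "v \<in> S3"
    using bound[OF v] v by (force simp: S1_def S2_def S3_def)
  then show ?thesis
  proof cases
    case 1
    then obtain s where "E s v" using hgt0_unique v by blast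
    then show ?thesis using nbr_S0[OF v 1] E_facts(3) by blast
  next
    case 4
    then obtain u where "E v u" using hgt_Suc_D[of E v 2] by (auto simp: S3_def)
    then show ?thesis using nbr_S3[OF 4] * by blast
  qed (use * in blast)+
qed

lemma S1_nbr_even: "s \<in> S1 \<Longrightarrow> E s l \<Longrightarrow> even (hgt E l)"
  using nbr_S1[of s l] by (auto simp: S2_def)

lemma even_S1_unique:
  assumes l: "l \<in> W" "even (hgt E l)"
  shows "\<exists>!s. s \<in> S1 \<and> E s l"
proof -
  have "hgt E l \<noteq> 1" "hgt E l \<noteq> 3" using l(2) by auto
  then have "hgt E l = 0 \<or> l \<in> S2" using bound[OF l(1)] l(1) by (auto simp: S2_def)
  then show ?thesis
  proof
    assume z: "hgt E l = 0"
    then obtain s where "E s l" "\<And>t. E t l \<Longrightarrow> t = s" using hgt0_unique[OF l(1)] by blast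
    then show ?thesis using nbr_S0[OF l(1) z] E_facts(3) by blast
  next
    assume l2: "l \<in> S2"
    obtain s where s: "s \<in> S1" "E l s" using S2_S1[OF l2] by blast
    show ?thesis
    proof (rule ex1I[of _ s])
      show "s \<in> S1 \<and> E s l" using s E_facts(3) by blast
      show "t = s" if "t \<in> S1 \<and> E t l" for t
        using S2_unique[OF l2 s(1) _ s(2)] that E_facts(3) by blast
    qed
  qed
qed

text \<open>Unifies heights 1 and 3: \<open>rp s\<close> is the distinguished neighbour whose
  variable replaces the block of \<open>s\<close>, namely the leaf l_1 in a star and the height-2
  neighbour of \<open>s\<close> otherwise. The clause on \<open>S3\<close> makes neighbourhoods of
  height-3 vertices consist of such representatives.\<close>

lemma component_Z_rep:
  fixes Zi :: "('v, 'k::comm_ring_1) mpoly set"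
  assumes Z: "component_Z W E Zi"
  shows "\<exists>rp. (\<forall>s\<in>S1. E s (rp s)) \<and> (\<forall>w\<in>S3. \<forall>u. E w u \<longrightarrow> (\<exists>s\<in>S1. rp s = u)) \<and>
    Zi = {Var (rp s) - Var l | s l. s \<in> S1 \<and> E s l \<and> l \<noteq> rp s}"
proof -
  have fin: "finite (hgt E ` W)" using finW by simp
  have le: "hgt E v \<le> tree_height W E" if "v \<in> W" for v
    unfolding tree_height_def using fin that by (intro Max_ge) auto
  obtain s0 where s0: "s0 \<in> S1" using S1_nonempty by blast
  then have "tree_height W E \<noteq> 0" using le[of s0] by (auto simp: S1_def)
  then consider
    l1 where "tree_height W E = 1" "l1 \<in> W" "is_leaf E l1"
      "Zi = {Var l1 - Var l | l. l \<in> W \<and> is_leaf E l \<and> l \<noteq> l1}"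
  | "tree_height W E = 3"
      "Zi = {Var u - Var l | u l. \<exists>s \<in> W. hgt E s = 1 \<and> E s u \<and> hgt E u = 2 \<and> E s l \<and> is_leaf E l}"
    using Z unfolding component_Z_def by (elim disjE conjE bexE; meson)
  then show ?thesis
  proof cases
    case 1
    have no2: "v \<notin> S2" for v using le[of v] 1(1) by (auto simp: S2_def)
    have no3: "v \<notin> S3" for v using le[of v] 1(1) by (auto simp: S3_def)
    have leaf_iff: "E s l \<longleftrightarrow> l \<in> W \<and> is_leaf E l" if s: "s \<in> S1" for s l
    proof
      assume "E s l"
      then have "l \<in> W" "hgt E l = 0" using nbr_S1[OF s] no2 by auto
      then show "l \<in> W \<and> is_leaf E l" using hgt0_leaf by blast
    next
      assume l: "l \<in> W \<and> is_leaf E l"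
      then have "hgt E l = 0" using hgt_leaf[of E l] by simp
      then have "l \<noteq> s" using s by (auto simp: S1_def)
      then show "E s l" using star[OF s no2] l E_facts(3) by (auto simp: nbhd_def)
    qed
    show ?thesis
    proof (intro exI[of _ "\<lambda>_. l1"] conjI)
      show "\<forall>s\<in>S1. E s l1" using leaf_iff 1 by blast
      show "\<forall>w\<in>S3. \<forall>u. E w u \<longrightarrow> (\<exists>s\<in>S1. l1 = u)" using no3 by blast
      show "Zi = {Var l1 - Var l | s l. s \<in> S1 \<and> E s l \<and> l \<noteq> l1}"
        unfolding 1(4) using leaf_iff s0 by blast
    qed
  next
    case 2
    have "W \<noteq> {}" using s0 S_W by blast
    then have "tree_height W E \<in> hgt E ` W" unfolding tree_height_def using fin by (intro Max_in) auto
    then obtain w where w: "w \<in> S3" using 2(1) by (auto simp: S3_def)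
    have "\<exists>u. u \<in> S2 \<and> E s u" if "s \<in> S1" for s using S1_S2_exists[OF that w] by blast
    then obtain rp where rp: "\<And>s. s \<in> S1 \<Longrightarrow> rp s \<in> S2 \<and> E s (rp s)" by metis
    have rp_eq: "u = rp s" if "s \<in> S1" "u \<in> S2" "E s u" for s u
      using S1_unique[OF that(1) _ _ that(2,3)] rp[OF that(1)] by blast
    have leaf_iff: "is_leaf E l \<longleftrightarrow> l \<noteq> rp s" if s: "s \<in> S1" "E s l" for s l
    proof
      assume "is_leaf E l"
      then have "hgt E l = 0" by (rule hgt_leaf)
      then show "l \<noteq> rp s" using rp[OF s(1)] by (auto simp: S2_def)
    next
      assume "l \<noteq> rp s"
      then have "l \<in> W \<and> hgt E l = 0" using nbr_S1[OF s] rp_eq[OF s(1) _ s(2)] by blast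
      then show "is_leaf E l" using hgt0_leaf by blast
    qed
    show ?thesis
    proof (intro exI[of _ rp] conjI)
      show "\<forall>s\<in>S1. E s (rp s)" using rp by blast
      show "\<forall>w\<in>S3. \<forall>u. E w u \<longrightarrow> (\<exists>s\<in>S1. rp s = u)"
        using nbr_S3 S2_S1 rp_eq E_facts(3) by metis
      have iff: "(\<exists>s \<in> W. hgt E s = 1 \<and> E s u \<and> hgt E u = 2 \<and> E s l \<and> is_leaf E l) \<longleftrightarrow>
          (\<exists>s\<in>S1. u = rp s \<and> E s l \<and> l \<noteq> rp s)" (is "?L \<longleftrightarrow> ?R") for u l
      proof
        assume ?L
        then obtain s where s: "s \<in> W" "hgt E s = 1" "E s u" "hgt E u = 2" "E s l" "is_leaf E l" by blast
        then have "s \<in> S1" "u \<in> S2" using closed by (auto simp: S1_def S2_def)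
        then show ?R using s rp_eq leaf_iff by blast
      next
        assume ?R
        then obtain s where s: "s \<in> S1" "u = rp s" "E s l" "l \<noteq> rp s" by blast
        moreover have "is_leaf E l" using leaf_iff[OF s(1,3)] s(4) by blast
        ultimately show ?L using rp[OF s(1)] by (auto simp: S1_def S2_def)
      qed
      show "Zi = {Var (rp s) - Var l | s l. s \<in> S1 \<and> E s l \<and> l \<noteq> rp s}"
        unfolding 2(2) iff by auto
    qed
  qed
qed

end

section \<open>Assembling the components\<close>

theorem theorem5p18:
  fixes V :: "'v set" and E :: "'v \<Rightarrow> 'v \<Rightarrow> bool" and Z :: "('v, 'k::field) mpoly set"
  assumes "unmixed_balanced_forest V E"
    and "is_Z_set V E Z"
  shows "(\<forall>zs. distinct zs \<and> set zs = Z \<longrightarrow>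
            maximal_regular_seq_in (poly_ring (Veven V E)) (N_odd V E)
              (ideal_gen (poly_ring (Veven V E)) (Var ` Veven V E)) zs)
       \<and> cm_type (poly_ring (Veven V E)) (ideal_gen (poly_ring (Veven V E)) (Var ` Veven V E))
            (N_odd V E)
         = card {D. minimal_V3_TD_set V E D}"
proof -
  have simple: "simple_graph V E" and acyc: "acyclic_graph E"
    and comps: "\<And>W. W \<in> components V E \<Longrightarrow> balanced W (restr E W) \<and> unmixed W (restr E W)"
    using assms(1) by (auto simp: unmixed_balanced_forest_def)
  have finV: "finite V" and EV: "\<And>u v. E u v \<Longrightarrow> u \<in> V \<and> v \<in> V" and Esym: "\<And>u v. E u v \<Longrightarrow> E v u"
    and Eirr: "\<And>u. \<not> E u u"
    using simple by (auto simp: simple_graph_def)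
  obtain Zs where Zs: "\<And>W. W \<in> components V E \<Longrightarrow> component_Z W E (Zs W)"
    and Z: "Z = (\<Union>W \<in> components V E. Zs W)"
    using assms(2) unfolding is_Z_set_def by blast
  define comp where "comp v = {u. E\<^sup>*\<^sup>* v u}" for v
  have comp_in: "comp v \<in> components V E" if "v \<in> V" for v
    using that by (auto simp: comp_def components_def)
  have comp_self: "v \<in> comp v" for v by (simp add: comp_def)
  have comp_eq: "comp v = W" if W: "W \<in> components V E" and v: "v \<in> W" for v W
  proof -
    obtain w where w: "W = {u. E\<^sup>*\<^sup>* w u}" using W by (auto simp: components_def)
    have "E\<^sup>*\<^sup>* w v" using v w by simp
    moreover have "E\<^sup>*\<^sup>* v w" by (rule rtranclp_sym[OF _ calculation]) (use Esym in \<open>auto simp: symp_def\<close>)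
    ultimately show ?thesis unfolding comp_def w using rtranclp_trans[of E] by blast
  qed
  have W_V: "W \<subseteq> V" if W: "W \<in> components V E" for W
  proof
    fix u assume "u \<in> W"
    then obtain w where "w \<in> V" "E\<^sup>*\<^sup>* w u" using W by (auto simp: components_def)
    from this(2,1) show "u \<in> V" by (induction rule: rtranclp_induct) (use EV in auto)
  qed
  have triv: "\<exists>v. W = {v} \<and> Zs W = {Var v}"
    if W: "W \<in> components V E" and none: "\<not> (\<exists>v\<in>W. \<exists>n. leaf_walk E n v)" for W
  proof -
    have "hgt E v = 0" if "v \<in> W" for v using none that by (simp add: hgt_eq)
    moreover have "W \<noteq> {}" using W by (auto simp: components_def)
    ultimately have "hgt E ` W = {0}" by force
    then have "tree_height W E = 0" by (simp add: tree_height_def)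
    then show ?thesis using Zs[OF W] by (auto simp: component_Z_def)
  qed
  have leafy: "leafy_tree V E W" if W: "W \<in> components V E" and v: "v \<in> W" "leaf_walk E n v" for W v n
  proof unfold_locales
    show "simple_graph V E" "acyclic_graph E" "W \<in> components V E" "balanced W (restr E W)"
      "unmixed W (restr E W)" using simple acyc W comps by auto
    show "\<exists>v\<in>W. \<exists>n. leaf_walk E n v" using v by blast
    fix u assume u: "u \<in> W"
    have "finite (hgt E ` W)" using finite_subset[OF W_V[OF W] finV] by simp
    then have "hgt E u \<le> tree_height W E" unfolding tree_height_def using u by (intro Max_ge) auto
    moreover have "tree_height W E \<le> 3" using Zs[OF W] unfolding component_Z_def by (elim disjE conjE) simp_all
    ultimately show "hgt E u \<le> 3" by simp
  qed
  have isol: "nbhd E v = {}" if "comp v = {v}" for v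
  proof -
    have "u = v" if "E v u" for u
    proof -
      have "u \<in> comp v" using that by (auto simp: comp_def)
      then show ?thesis using \<open>comp v = {v}\<close> by simp
    qed
    then show ?thesis using Esym Eirr unfolding nbhd_def by blast
  qed
  have dich: "comp v = {v} \<and> Zs (comp v) = {Var v} \<and> nbhd E v = {} \<or> leafy_tree V E (comp v)"
    if v: "v \<in> V" for v
  proof (cases "\<exists>u\<in>comp v. \<exists>n. leaf_walk E n u")
    case True then show ?thesis using leafy[OF comp_in[OF v]] by blast
  next
    case False
    from triv[OF comp_in[OF v] this] obtain x where "comp v = {x}" "Zs (comp v) = {Var x}" by blast
    moreover from this have "x = v" using comp_self[of v] by simp
    ultimately show ?thesis using isol by simp
  qed
  have lt: "leafy_tree V E (comp v)" if "v \<in> V" "nbhd E v \<noteq> {}" for v using dich that by blast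
  have lt_hgt: "leafy_tree V E (comp v)" if v: "v \<in> V" "hgt E v \<noteq> 0" for v
    using lt[OF v(1)] v(2) hgt_isolated[of E v] Esym by metis
  have comp_E: "comp u = comp v" if "E u v" for u v
  proof -
    have "v \<in> comp u" using that by (auto simp: comp_def)
    then show ?thesis using comp_eq[OF comp_in[of u], of v] EV[OF that] by simp
  qed

  define good where "good W rp \<longleftrightarrow>
      (\<forall>s\<in>leafy_tree.S1 E W. E s (rp s)) \<and>
      (\<forall>w\<in>leafy_tree.S3 E W. \<forall>u. E w u \<longrightarrow> (\<exists>s\<in>leafy_tree.S1 E W. rp s = u)) \<and>
      Zs W = {Var (rp s) - Var l | s l. s \<in> leafy_tree.S1 E W \<and> E s l \<and> l \<noteq> rp s}" for W rp
  have "\<exists>rp. good W rp" if "leafy_tree V E W" "W \<in> components V E" for W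
    unfolding good_def by (rule leafy_tree.component_Z_rep[OF that(1) Zs[OF that(2)]])
  then obtain rpW where good: "\<And>W. leafy_tree V E W \<Longrightarrow> W \<in> components V E \<Longrightarrow> good W (rpW W)"
    by metis
  note rpW = good[unfolded good_def]
  \<comment> \<open>The choices made per component are glued by consulting the component of the
    argument.\<close>
  define rp where "rp s = rpW (comp s) s" for s
  define V1 where "V1 = {v \<in> V. hgt E v = 1}"
  define V3 where "V3 = {v \<in> V. hgt E v = 3}"
  have S1_iff: "s \<in> leafy_tree.S1 E W \<longleftrightarrow> s \<in> V1 \<and> comp s = W"
    if W: "W \<in> components V E" and l: "leafy_tree V E W" for W s
    using comp_eq[OF W] W_V[OF W] comp_self[of s] by (auto simp: leafy_tree.S1_def[OF l] V1_def)
  have S3_iff: "s \<in> leafy_tree.S3 E W \<longleftrightarrow> s \<in> V3 \<and> comp s = W"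
    if W: "W \<in> components V E" and l: "leafy_tree V E W" for W s
    using comp_eq[OF W] W_V[OF W] comp_self[of s] by (auto simp: leafy_tree.S3_def[OF l] V3_def)
  have V1_lt: "leafy_tree V E (comp s)" "comp s \<in> components V E" "s \<in> leafy_tree.S1 E (comp s)"
    if "s \<in> V1" for s
    using lt_hgt[of s] comp_in[of s] S1_iff[of "comp s" s] that by (auto simp: V1_def)
  have V3_lt: "leafy_tree V E (comp s)" "comp s \<in> components V E" "s \<in> leafy_tree.S3 E (comp s)"
    if "s \<in> V3" for s
    using lt_hgt[of s] comp_in[of s] S3_iff[of "comp s" s] that by (auto simp: V3_def)
  have rp_E: "E s (rp s)" if "s \<in> V1" for s
    using rpW[OF V1_lt(1,2)[OF that]] V1_lt(3)[OF that] by (auto simp: rp_def)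
  have rp_V3: "\<exists>s\<in>V1. rp s = u" if w: "w \<in> V3" "E w u" for w u
  proof -
    obtain s where s: "s \<in> leafy_tree.S1 E (comp w)" "rpW (comp w) s = u"
      using rpW[OF V3_lt(1,2)[OF w(1)]] V3_lt(3)[OF w(1)] w(2) by blast
    then have "s \<in> V1" "comp s = comp w" using S1_iff[OF V3_lt(2,1)[OF w(1)]] by auto
    then show ?thesis using s(2) by (intro bexI[of _ s]) (auto simp: rp_def)
  qed

  \<comment> \<open>The block structure on the even vertices of the forest\<close>
  define EV0 where "EV0 = Veven V E"
  define I0 where "I0 = {v \<in> V. nbhd E v = {}}"
  have I0_sub: "I0 \<subseteq> EV0"
    using hgt_isolated[of E] Esym by (auto simp: EV0_def Veven_def I0_def)
  have sp_ex: "\<exists>!s. s \<in> V1 \<and> E s l" if l: "l \<in> EV0 - I0" for l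
  proof -
    have lV: "l \<in> V" "even (hgt E l)" "nbhd E l \<noteq> {}" using l by (auto simp: EV0_def Veven_def I0_def)
    have L: "leafy_tree V E (comp l)" by (rule lt[OF lV(1,3)])
    have C: "comp l \<in> components V E" by (rule comp_in[OF lV(1)])
    have "s \<in> leafy_tree.S1 E (comp l) \<and> E s l \<longleftrightarrow> s \<in> V1 \<and> E s l" for s
      using S1_iff[OF C L] comp_E[of s l] by auto
    then show ?thesis using leafy_tree.even_S1_unique[OF L comp_self lV(2)] by simp
  qed
  define sp where "sp l = (THE s. s \<in> V1 \<and> E s l)" for l
  have sp: "sp l \<in> V1" "E (sp l) l" if "l \<in> EV0 - I0" for l
    using theI'[OF sp_ex[OF that]] by (auto simp: sp_def)
  have sp_eq: "sp l = s" if "l \<in> EV0 - I0" "s \<in> V1" "E s l" for l s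
    using sp_ex[OF that(1)] sp[OF that(1)] that(2,3) by blast
  have nbr_in: "l \<in> EV0 - I0" if s: "s \<in> V1" "E s l" for s l
    using leafy_tree.S1_nbr_even[OF V1_lt(1,3)[OF s(1)] s(2)] EV[OF s(2)] s(2)
    by (auto simp: EV0_def Veven_def I0_def nbhd_def)
  \<comment> \<open>Two non-isolated even vertices lie in one block when they share their height-1
    neighbour; the representative is the one chosen for that neighbour.\<close>
  define \<rho> where "\<rho> l = rp (sp l)" for l
  have rho_in: "\<rho> l \<in> EV0 - I0" if "l \<in> EV0 - I0" for l
    unfolding \<rho>_def using sp(1)[OF that] rp_E nbr_in by blast
  have sp_rp: "sp (rp s) = s" if "s \<in> V1" for s
    using sp_eq[OF nbr_in[OF that rp_E[OF that]] that rp_E[OF that]] .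
  define NN where "NN = nbhd E ` V3"
  interpret blocks EV0 I0 \<rho> NN "TYPE('k)"
  proof
    show "finite EV0" using finV by (simp add: EV0_def Veven_def)
    show "I0 \<subseteq> EV0" by (rule I0_sub)
    show "\<rho> l \<in> EV0 - I0" if "l \<in> EV0 - I0" for l by (rule rho_in[OF that])
    show "\<rho> (\<rho> l) = \<rho> l" if "l \<in> EV0 - I0" for l
      unfolding \<rho>_def using sp_rp sp(1)[OF that] by simp
    show "\<exists>l\<in>EV0 - I0. \<rho> l = r \<and> l \<noteq> r" if r: "r \<in> EV0 - I0" "\<rho> r = r" for r
    proof -
      note s = sp(1)[OF r(1)]
      have "sp r \<in> comp (sp r)" "hgt E (sp r) = Suc 0" using s comp_self by (auto simp: V1_def)
      \<comment> \<open>A vertex of height 1 is not a leaf and so has a neighbour other than the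
        representative.\<close>
      then obtain y where y: "E (sp r) y" "y \<noteq> r" using leafy_tree.two_nbrs[OF V1_lt(1)[OF s]] by blast
      have "y \<in> EV0 - I0" "sp y = sp r" using nbr_in[OF s y(1)] sp_eq[OF _ s y(1)] by auto
      then show ?thesis using y(2) r(2) by (intro bexI[of _ y]) (auto simp: \<rho>_def)
    qed
    show "N \<noteq> {} \<and> N \<subseteq> {l \<in> EV0 - I0. \<rho> l = l}" if N: "N \<in> NN" for N
    proof -
      obtain w where w: "w \<in> V3" "N = nbhd E w" using N by (auto simp: NN_def)
      have "hgt E w = Suc 2" using w by (simp add: V3_def)
      then have "N \<noteq> {}" using hgt_Suc_D[of E w 2] Esym w(2) by (auto simp: nbhd_def)
      moreover have "u \<in> EV0 - I0 \<and> \<rho> u = u" if "u \<in> N" for u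
      proof -
        have "E w u" using that w(2) Esym by (auto simp: nbhd_def)
        then obtain s where s: "s \<in> V1" "rp s = u" using rp_V3[OF w(1)] by blast
        then show ?thesis using nbr_in[OF s(1) rp_E[OF s(1)]] sp_rp[OF s(1)] by (auto simp: \<rho>_def)
      qed
      ultimately show ?thesis by blast
    qed
  qed
  have block: "block r = nbhd E (sp r)" if r: "r \<in> reps" for r
  proof -
    have rE: "r \<in> EV0 - I0" "\<rho> r = r" using r by (auto simp: reps_def)
    note s = sp[OF rE(1)]
    show ?thesis
    proof (intro equalityI subsetI)
      fix l assume "l \<in> block r"
      then have l: "l \<in> EV0 - I0" and "\<rho> l = \<rho> r" unfolding block_def rE(2) by simp_all
      then have "rp (sp l) = rp (sp r)" by (simp add: \<rho>_def)
      then have "sp l = sp r" using sp_rp[OF sp(1)[OF l]] sp_rp[OF s(1)] by metis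
      then show "l \<in> nbhd E (sp r)" using sp(2)[OF l] Esym by (simp add: nbhd_def)
    next
      fix l assume "l \<in> nbhd E (sp r)"
      then have E: "E (sp r) l" using Esym by (simp add: nbhd_def)
      have "l \<in> EV0 - I0" "sp l = sp r" using nbr_in[OF s(1) E] sp_eq[OF _ s(1) E] by auto
      moreover from this(2) have "\<rho> l = \<rho> r" by (simp add: \<rho>_def)
      ultimately show "l \<in> block r" unfolding block_def rE(2) by simp
    qed
  qed
  have rp_reps: "rp s \<in> reps" if "s \<in> V1" for s
    using nbr_in[OF that rp_E[OF that]] sp_rp[OF that] by (simp add: reps_def \<rho>_def)
  have "block ` reps = nbhd E ` V1"
  proof (intro equalityI subsetI)
    fix B assume "B \<in> block ` reps"
    then obtain r where r: "r \<in> reps" "B = block r" by blast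
    have "sp r \<in> V1" using r reps_sub by (intro sp) blast
    then show "B \<in> nbhd E ` V1" using block[OF r(1)] r(2) by blast
  next
    fix B assume "B \<in> nbhd E ` V1"
    then obtain s where s: "s \<in> V1" "B = nbhd E s" by blast
    then have "B = block (rp s)" using block[OF rp_reps[OF s(1)]] sp_rp[OF s(1)] by simp
    then show "B \<in> block ` reps" using rp_reps[OF s(1)] by blast
  qed
  moreover have "Vodd V E = V1 \<union> V3"
  proof (intro equalityI subsetI)
    fix v assume v: "v \<in> Vodd V E"
    then have vV: "v \<in> V" "odd (hgt E v)" by (auto simp: Vodd_def)
    then have nz: "hgt E v \<noteq> 0" by (metis even_zero)
    then have "hgt E v \<le> 3" using leafy_tree.bound[OF lt_hgt[OF vV(1)] comp_self] by blast
    moreover have "hgt E v \<noteq> 2" using vV(2) by auto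
    ultimately have "hgt E v = 1 \<or> hgt E v = 3" using nz by linarith
    then show "v \<in> V1 \<union> V3" using vV(1) by (auto simp: V1_def V3_def)
  qed (auto simp: Vodd_def V1_def V3_def)
  ultimately have edges: "edges = nbhd E ` Vodd V E" unfolding edges_def
    by (simp only: NN_def image_Un)
  have gens: "{monomial_of_set (nbhd E v) |v. v \<in> Vodd V E} = monomial_of_set ` edges"
    unfolding edges by blast
  have II: "II = N_odd V E"
    unfolding N_odd_def II_def EV0_def[symmetric] gens ..
  \<comment> \<open>The second conjunct of the theorem is polymorphic in its own coefficient field.\<close>
  interpret A: blocks EV0 I0 \<rho> NN "TYPE('a)"
    by unfold_locales (fact fin I0 rho_in rho_rho two NN)+
  have IIA: "A.II = N_odd V E"
    unfolding N_odd_def A.II_def EV0_def[symmetric] gens ..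
  have kill_eq: "kill = I0 \<union> {l \<in> EV0 - I0. \<rho> l \<noteq> l}"
    using I0_sub by (auto simp: kill_def reps_def)
  \<comment> \<open>Each element of \<open>Z\<close> belongs to one eliminated vertex: the isolated
    vertex itself, or the \<open>l\<close> subtracted from the representative of its block.\<close>
  have Z_eq: "Z = zvar ` kill"
  proof (intro equalityI subsetI)
    fix z assume "z \<in> Z"
    then obtain W where W: "W \<in> components V E" "z \<in> Zs W" using Z by blast
    then obtain v where v: "v \<in> V" "W = comp v" by (auto simp: components_def comp_def)
    from dich[OF v(1)] show "z \<in> zvar ` kill"
    proof
      assume *: "comp v = {v} \<and> Zs (comp v) = {Var v} \<and> nbhd E v = {}"
      then have "v \<in> I0" using v by (simp add: I0_def)
      moreover have "z = Var v" using W(2) unfolding v(2) conjunct1[OF conjunct2[OF *]] by simp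
      ultimately have "v \<in> I0" "z = zvar v" by (simp_all add: zvar_def)
      then show ?thesis using kill_eq by blast
    next
      assume L: "leafy_tree V E (comp v)"
      obtain s l where sl: "z = Var (rpW W s) - Var l" "s \<in> leafy_tree.S1 E W" "E s l" "l \<noteq> rpW W s"
        using rpW[OF L[folded v(2)] W(1)] W(2) by blast
      have s: "s \<in> V1" "comp s = W" using S1_iff[OF W(1) L[folded v(2)]] sl(2) by auto
      have l: "l \<in> EV0 - I0" "sp l = s" using nbr_in[OF s(1) sl(3)] sp_eq[OF _ s(1) sl(3)] by auto
      have rl: "\<rho> l = rpW W s" using l s by (simp add: \<rho>_def rp_def)
      then have "z = zvar l" using sl(1) l(1) by (simp add: zvar_def)
      moreover have "l \<in> kill" unfolding kill_eq using l rl sl(4) by auto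
      ultimately show ?thesis by blast
    qed
  next
    fix z assume "z \<in> zvar ` kill"
    then obtain l where l: "l \<in> kill" "z = zvar l" by blast
    have lV: "l \<in> V" using l kill_W by (auto simp: EV0_def Veven_def)
    have "z \<in> Zs (comp l)"
    proof (cases "l \<in> I0")
      case True
      then have ne: "nbhd E l = {}" by (simp add: I0_def)
      have "\<not> leafy_tree V E (comp l)"
      proof
        assume L: "leafy_tree V E (comp l)"
        have "hgt E l = 0" by (rule hgt_isolated[OF ne Esym])
        then have "\<exists>!s. E s l" using leafy_tree.hgt0_unique[OF L comp_self] by blast
        then show False using ne by (auto simp: nbhd_def)
      qed
      then have "Zs (comp l) = {Var l}" using dich[OF lV] by blast
      then show ?thesis using l(2) True by (simp add: zvar_def)
    next
      case False
      then have lE: "l \<in> EV0 - I0" "\<rho> l \<noteq> l" using l(1) kill_eq by auto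
      note s = sp[OF lE(1)]
      have c: "comp (sp l) = comp l" by (rule comp_E[OF s(2)])
      have "z = Var (rpW (comp l) (sp l)) - Var l" using l(2) False c by (simp add: zvar_def \<rho>_def rp_def)
      moreover have "l \<noteq> rpW (comp l) (sp l)" using lE(2) c by (simp add: \<rho>_def rp_def)
      moreover have "sp l \<in> leafy_tree.S1 E (comp l)" using V1_lt(3)[OF s(1)] c by simp
      ultimately show ?thesis
        using rpW[of "comp l"] V1_lt(1,2)[OF s(1)] c s(2) by auto
    qed
    then show "z \<in> Z" using Z comp_in[OF lV] by blast
  qed
  have TD: "V3_TD_set V E D \<longleftrightarrow> D \<subseteq> V \<and> (\<forall>N\<in>NN. N \<inter> D \<noteq> {})" for D
  proof -
    have "Vk V E 3 \<subseteq> nbhd_set E D \<longleftrightarrow> (\<forall>w\<in>V3. \<exists>d\<in>D. E w d)"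
      by (auto simp: Vk_def V3_def nbhd_set_def nbhd_def)
    also have "\<dots> \<longleftrightarrow> (\<forall>N\<in>NN. N \<inter> D \<noteq> {})"
    proof -
      have "nbhd E w \<inter> D \<noteq> {} \<longleftrightarrow> (\<exists>d\<in>D. E w d)" for w using Esym by (auto simp: nbhd_def)
      then show ?thesis by (simp add: NN_def)
    qed
    finally show ?thesis by (simp add: V3_TD_set_def)
  qed
  \<comment> \<open>The two notions differ only in the requirement that \<open>D\<close> lie in
    \<open>V\<close>, which minimality supplies through \<open>min_transversal_sub\<close>.\<close>
  have "minimal_V3_TD_set V E D \<longleftrightarrow> min_transversal NN D" for D
  proof
    assume D: "minimal_V3_TD_set V E D"
    then have "D \<subseteq> V" "\<forall>N\<in>NN. N \<inter> D \<noteq> {}" by (auto simp: minimal_V3_TD_set_def TD)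
    moreover have "\<exists>N\<in>NN. N \<inter> D' = {}" if "D' \<subset> D" for D'
    proof -
      have "\<not> V3_TD_set V E D'" using D that by (auto simp: minimal_V3_TD_set_def)
      then show ?thesis using that \<open>D \<subseteq> V\<close> unfolding TD by blast
    qed
    ultimately show "min_transversal NN D" by (simp add: min_transversal_def)
  next
    assume D: "min_transversal NN D"
    have "D \<subseteq> V" using min_transversal_sub[OF D] reps_sub by (auto simp: EV0_def Veven_def)
    then have "V3_TD_set V E D" using D by (simp add: TD min_transversal_def)
    moreover have "\<not> V3_TD_set V E D'" if "D' \<subset> D" for D'
    proof -
      obtain N where "N \<in> NN" "N \<inter> D' = {}" using D[unfolded min_transversal_def] \<open>D' \<subset> D\<close> by meson
      then show ?thesis by (auto simp: TD)
    qed
    ultimately show "minimal_V3_TD_set V E D" by (simp add: minimal_V3_TD_set_def)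
  qed
  then have "card {D. minimal_V3_TD_set V E D} = card {D. min_transversal NN D}" by simp
  then show ?thesis
    unfolding Z_eq II[symmetric] IIA[symmetric] EV0_def[symmetric] mm_def[symmetric] A.mm_def[symmetric]
    using regular_and_type(1) A.regular_and_type(2) by simp
qed

end
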